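(* Let $A_n=\sum_{k=0}^n \binom{n}{k}^2\binom{n+k}{k}^2$ for $n=0,1,2,\dots$. There exist a real number $c>0$ and a positive Lebesgue integrable function $\phi$ on $(0,c)$ such that $$A_n=\int_0^c x^n\,\phi(x)\,dx\qquad\text{for all } n=0,1,2,\dots.$$
   Context: The sequence $(A_n)_{n\ge 0}$ is called the Apéry sequence. *)

theory Defs
  imports "HOL-Analysis.Analysis"
begin

definition apery :: "nat \<Rightarrow> nat" where
  "apery n = (\<Sum>k=0..n. (n choose k)\<^sup>2 * ((n + k) choose k)\<^sup>2)"

end

(* With X = cos u + cos v + cos w for independent uniform angles, A_n is the mean of the Chebyshev
   polynomial U_{2n}(X). For X = cosh u > 1 one has U_{2n}(X) = (e^{(2n+1)u} - e^{-(2n+1)u}) / (2 sinh u),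
   and the substitution x = e^{2u} resp. x = e^{-2u} turns the two terms into moments x^n; what remains
   is to treat the part |X| < 1 and the minus sign.

   Write a for the arcsine weight 1/sqrt(1-t^2) on (-1,1) and b for the weight 1/sqrt(t^2-1) on (1,oo).
   Two facts are used. First, the complete elliptic integrals a*a, b*b and the correlation m of b with
   itself satisfy 2m = a*a + b*b on (0,oo). Second, for c > 0 the averages of T_{2n+1} against
   a(t-c) b(t) and b(c-t) a(t) differ by the average of U_{2n} against a(t-c). Since T_{2n+1} is odd,
   evaluating a triple convolution in two ways gives
     integral of R(c) (a*a)(c) over c > 0  =  -3 * integral of R(c) (b*b)(c),
   R(c) being the average of T_{2n+1} against b(c-t) a(t). Replacing the former by the latter leaves
   only positive integrands over t > 1, and the density
     phi(x) = (h(s) + 6 * [x < 1] g(s)) / (2 pi^3 sqrt x),   s = (sqrt x + 1/sqrt x)/2,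
   where h is the convolution of a with the restriction of a*a to (0,oo), and g that of a with b*b.
   For x > 1 it vanishes once s >= 3, that is from x = (3 + 2 sqrt 2)^2 on. *)

theory Submission
  imports Defs "HOL-Probability.Convolution"
begin

section \<open>Arcsine and hyperbolic weights\<close>

text \<open>The obstacle is the sign. U_{2n} oscillates where |X| < 1, and beyond that e^{-(2n+1)u}
  enters with a minus. Exchanging U_{2n} for T_{2n+1} repairs the part over t > 1, where T_{2n+1}
  carries both exponentials with a plus, but leaves R, which averages T_{2n+1} over |t| < 1 and
  oscillates again. R is therefore moved from c < 2, where a*a lives, to c > 2, the support of b*b.
  There the support of a(t-c) lies in t > 1, and the second fact, read backwards, writes R(c) as the
  average of e^{-(2n+1)u} / sinh u with t = cosh u, which is positive and a moment over x < 1. The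
  first fact is the inversion z -> pq/z on the curve w^2 = (z^2-p^2)(z^2-q^2), with p = |1-c/2| and
  q = 1+c/2. The second compares generating functions: antisymmetrising under t -> c-t leaves an odd
  function of the centred variable z, so that z^2 can be the new variable and the elliptic weight
  becomes an arcsine weight. The mean of U_{2n}(X) is A_n because A_n is a Legendre-type transform
  of the even moments of the planar three-step walk.\<close>

definition arcw :: "real \<Rightarrow> real" where
  "arcw t = (if \<bar>t\<bar> < 1 then 1 / sqrt (1 - t\<^sup>2) else 0)"

definition coshw :: "real \<Rightarrow> real" where
  "coshw t = (if 1 < t then 1 / sqrt (t\<^sup>2 - 1) else 0)"

lemma arcw_measurable [measurable]: "arcw \<in> borel_measurable borel"
  unfolding arcw_def by measurable

lemma coshw_measurable [measurable]: "coshw \<in> borel_measurable borel"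
  unfolding coshw_def by measurable

lemma arcw_nonneg [simp]: "0 \<le> arcw t"
  by (simp add: arcw_def abs_square_le_1)

lemma coshw_nonneg [simp]: "0 \<le> coshw t"
  by (simp add: coshw_def)

lemma arcw_minus [simp]: "arcw (- t) = arcw t"
  by (simp add: arcw_def)

lemma arcw_commute: "arcw (x - y) = arcw (y - x)"
  using arcw_minus[of "x - y"] by simp

lemma arcw_zero: "1 \<le> \<bar>t\<bar> \<Longrightarrow> arcw t = 0"
  by (simp add: arcw_def)

lemma arcw_pos: "\<bar>t\<bar> < 1 \<Longrightarrow> 0 < arcw t"
  by (simp add: arcw_def abs_square_less_1)

lemma coshw_zero: "t \<le> 1 \<Longrightarrow> coshw t = 0"
  by (simp add: coshw_def)

lemma coshw_pos: "1 < t \<Longrightarrow> 0 < coshw t"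
  by (simp add: coshw_def)

text \<open>For a nonnegative integrand the equivalence
  \<open>has_absolute_integral_change_of_variables_1'\<close> settles both cases: either both sides
  are integrable with the same value, or neither is and both are infinite. The formula can thus be
  applied before any finiteness is known.\<close>

lemma nn_integral_change_of_variables:
  fixes f g g' :: "real \<Rightarrow> real"
  assumes [measurable]: "S \<in> sets borel" "g ` S \<in> sets borel"
    "f \<in> borel_measurable borel" "g \<in> borel_measurable borel" "g' \<in> borel_measurable borel"
    and der: "\<And>x. x \<in> S \<Longrightarrow> (g has_real_derivative g' x) (at x)"
    and inj: "inj_on g S"
    and nonneg: "\<And>t. 0 \<le> f t"
  shows "(\<integral>\<^sup>+t\<in>g ` S. ennreal (f t) \<partial>lborel) = (\<integral>\<^sup>+x\<in>S. ennreal (\<bar>g' x\<bar> * f (g x)) \<partial>lborel)"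
proof -
  let ?F = "\<lambda>t. indicator (g ` S) t * f t" and ?G = "\<lambda>x. indicator S x * (\<bar>g' x\<bar> * f (g x))"
  have F: "(\<integral>\<^sup>+t\<in>g ` S. ennreal (f t) \<partial>lborel) = (\<integral>\<^sup>+t. ennreal (?F t) \<partial>lebesgue)"
    unfolding nn_integral_completion by (intro nn_integral_cong) (simp split: split_indicator)
  have G: "(\<integral>\<^sup>+x\<in>S. ennreal (\<bar>g' x\<bar> * f (g x)) \<partial>lborel) = (\<integral>\<^sup>+x. ennreal (?G x) \<partial>lebesgue)"
    unfolding nn_integral_completion by (intro nn_integral_cong) (simp split: split_indicator)
  have cv: "(\<lambda>x. \<bar>g' x\<bar> * f (g x)) absolutely_integrable_on S \<and>
      integral S (\<lambda>x. \<bar>g' x\<bar> * f (g x)) = b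
     \<longleftrightarrow> f absolutely_integrable_on (g ` S) \<and> integral (g ` S) f = b" for b
    using der inj by (intro has_absolute_integral_change_of_variables_1')
      (auto intro: has_field_derivative_at_within)
  have nn: "0 \<le> ?F t" "0 \<le> ?G t" for t
    using nonneg by auto
  have [measurable]: "?F \<in> borel_measurable lebesgue" "?G \<in> borel_measurable lebesgue"
    by (auto intro!: measurable_completion)
  show ?thesis
  proof (cases "integrable lebesgue ?F")
    case True
    then have "f absolutely_integrable_on (g ` S)"
      by (simp add: set_integrable_def)
    then have G': "(\<lambda>x. \<bar>g' x\<bar> * f (g x)) absolutely_integrable_on S"
      and eq: "integral S (\<lambda>x. \<bar>g' x\<bar> * f (g x)) = integral (g ` S) f"
      using cv[of "integral (g ` S) f"] by auto
    have "integral\<^sup>L lebesgue ?F = integral (g ` S) f"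
      using set_lebesgue_integral_eq_integral(2)[OF \<open>f absolutely_integrable_on (g ` S)\<close>]
      by (simp add: set_lebesgue_integral_def)
    moreover have "integral\<^sup>L lebesgue ?G = integral S (\<lambda>x. \<bar>g' x\<bar> * f (g x))"
      using set_lebesgue_integral_eq_integral(2)[OF G']
      by (simp add: set_lebesgue_integral_def)
    moreover have "integrable lebesgue ?G"
      using G' by (simp add: set_integrable_def)
    ultimately show ?thesis
      unfolding F G using True nn eq by (simp add: nn_integral_eq_integral)
  next
    case False
    then have "\<not> f absolutely_integrable_on (g ` S)"
      by (simp add: set_integrable_def)
    then have "\<not> integrable lebesgue ?G"
      using cv by (auto simp: set_integrable_def)
    have inf: "(\<integral>\<^sup>+x. ennreal (h x) \<partial>lebesgue) = \<infinity>"
      if "\<not> integrable lebesgue h" "\<And>x. 0 \<le> h x" "h \<in> borel_measurable lebesgue" for h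
      using integrableI_nonneg[of h lebesgue] that less_top[of "\<integral>\<^sup>+x. ennreal (h x) \<partial>lebesgue"] by auto
    show ?thesis
      unfolding F G using inf[OF False] inf[OF \<open>\<not> integrable lebesgue ?G\<close>] nn by simp
  qed
qed

lemma nn_integral_shift:
  fixes f :: "real \<Rightarrow> ennreal"
  assumes [measurable]: "f \<in> borel_measurable borel"
  shows "(\<integral>\<^sup>+x. f (x + t) \<partial>lborel) = (\<integral>\<^sup>+x. f x \<partial>lborel)"
  using nn_integral_real_affine[of f 1 t] by (simp add: add.commute)

lemma nn_integral_reflect:
  fixes f :: "real \<Rightarrow> ennreal"
  assumes [measurable]: "f \<in> borel_measurable borel"
  shows "(\<integral>\<^sup>+x. f (t - x) \<partial>lborel) = (\<integral>\<^sup>+x. f x \<partial>lborel)"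
  using nn_integral_real_affine[of f "-1" t] by simp

text \<open>Meant for integrands with singular end points: nonnegativity turns the existence of the
  end-point limits of the antiderivative into integrability.\<close>

lemma has_bochner_integral_FTC_interval:
  fixes f F :: "real \<Rightarrow> real"
  assumes "a < b"
    and der: "\<And>x. a < x \<Longrightarrow> x < b \<Longrightarrow> (F has_real_derivative f x) (at x)"
    and cont: "\<And>x. a < x \<Longrightarrow> x < b \<Longrightarrow> isCont f x"
    and nonneg: "\<And>x. a < x \<Longrightarrow> x < b \<Longrightarrow> 0 \<le> f x"
    and F: "continuous_on {a..b} F"
  shows "has_bochner_integral lborel (\<lambda>x. indicator {a<..<b} x * f x) (F b - F a)"
proof -
  have lim: "(F \<longlongrightarrow> F a) (at_right a)" "(F \<longlongrightarrow> F b) (at_left b)"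
    using F \<open>a < b\<close> continuous_on_Icc_at_rightD continuous_on_Icc_at_leftD by auto
  have "((F \<circ> real_of_ereal) \<longlongrightarrow> F a) (at_right (ereal a))"
       "((F \<circ> real_of_ereal) \<longlongrightarrow> F b) (at_left (ereal b))"
    using lim by (auto simp: at_right_ereal at_left_ereal filterlim_filtermap)
  then have "set_integrable lborel (einterval a b) f" "(LBINT x=a..b. f x) = F b - F a"
    using interval_integral_FTC_nonneg[of "ereal a" "ereal b" F f "F a" "F b"] assms by auto
  then show ?thesis
    using \<open>a < b\<close> by (simp add: has_bochner_integral_iff set_integrable_def interval_lebesgue_integral_def
        set_lebesgue_integral_def)
qed

lemma has_bochner_integral_arcw: "has_bochner_integral lborel arcw pi"
proof -
  have "has_bochner_integral lborel (\<lambda>x. indicator {-1<..<1} x * (1 / sqrt (1 - x\<^sup>2))) (arcsin 1 - arcsin (-1))"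
  proof (rule has_bochner_integral_FTC_interval)
    show "continuous_on {- 1..1} arcsin"
      by (rule continuous_on_arcsin')
    fix x :: real assume x: "-1 < x" "x < 1"
    then have "0 < 1 - x\<^sup>2"
      by (simp add: abs_square_less_1)
    then show "isCont (\<lambda>x. 1 / sqrt (1 - x\<^sup>2)) x" "0 \<le> 1 / sqrt (1 - x\<^sup>2)"
      by (auto intro!: continuous_intros)
    show "(arcsin has_real_derivative 1 / sqrt (1 - x\<^sup>2)) (at x)"
      using DERIV_arcsin[OF x] by (simp add: inverse_eq_divide)
  qed simp
  moreover have "(\<lambda>x. indicator {-1<..<1} x * (1 / sqrt (1 - x\<^sup>2))) = arcw"
    by (auto simp: arcw_def fun_eq_iff split: split_indicator)
  ultimately show ?thesis
    by simp
qed

text \<open>The Stieltjes transform of the arcsine weight. Both generating functions of the exchange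
  identity reduce to it.\<close>

lemma has_bochner_integral_arcw_resolvent:
  assumes "1 < w"
  shows "has_bochner_integral lborel (\<lambda>t. arcw t / (w - t)) (pi / sqrt (w\<^sup>2 - 1))"
proof -
  define s where "s = sqrt (w\<^sup>2 - 1)"
  have w: "0 < w\<^sup>2 - 1"
    using assms by simp
  then have s: "0 < s" "s\<^sup>2 = w\<^sup>2 - 1"
    by (auto simp: s_def)
  \<comment> \<open>The Moebius map t -> (w t - 1)/(w - t) fixes 1 and -1 and maps [-1,1] to itself,
    so composing it with arcsin gives an antiderivative that is continuous up to the end
    points.\<close>
  define F where "F t = arcsin ((w * t - 1) / (w - t)) / s" for t
  have "has_bochner_integral lborel (\<lambda>x. indicator {-1<..<1} x * (1 / (sqrt (1 - x\<^sup>2) * (w - x)))) (F 1 - F (-1))"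
  proof (rule has_bochner_integral_FTC_interval)
    have "- 1 \<le> (w * t - 1) / (w - t)" "(w * t - 1) / (w - t) \<le> 1" if "t \<in> {-1..1}" for t
    proof -
      have "0 \<le> (w - 1) * (1 + t)" "0 \<le> (w + 1) * (1 - t)"
        using that assms by auto
      then show "- 1 \<le> (w * t - 1) / (w - t)" "(w * t - 1) / (w - t) \<le> 1"
        using that assms by (auto simp: field_simps)
    qed
    then show "continuous_on {- 1..1} F"
      unfolding F_def using assms s by (intro continuous_intros) auto
    fix t :: real assume t: "-1 < t" "t < 1"
    then have t2: "0 < 1 - t\<^sup>2" and wt: "0 < w - t"
      using assms by (auto simp: abs_square_less_1)
    then show "isCont (\<lambda>x. 1 / (sqrt (1 - x\<^sup>2) * (w - x))) t" "0 \<le> 1 / (sqrt (1 - t\<^sup>2) * (w - t))"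
      by (auto intro!: continuous_intros)
    have "1 - ((w * t - 1) / (w - t))\<^sup>2 = ((w - t)\<^sup>2 - (w * t - 1)\<^sup>2) / (w - t)\<^sup>2"
      unfolding power_divide diff_divide_distrib[of "(w - t)\<^sup>2"] using wt by simp
    also have "(w - t)\<^sup>2 - (w * t - 1)\<^sup>2 = s\<^sup>2 * (1 - t\<^sup>2)"
      unfolding s(2) by algebra
    finally have e: "1 - ((w * t - 1) / (w - t))\<^sup>2 = (s * sqrt (1 - t\<^sup>2) / (w - t))\<^sup>2"
      using t2 by (simp add: power_divide power_mult_distrib)
    then have sq: "sqrt (1 - ((w * t - 1) / (w - t))\<^sup>2) = s * sqrt (1 - t\<^sup>2) / (w - t)"
      using s t2 wt by simp
    have "0 < (w - 1) * (1 + t)" "0 < (w + 1) * (1 - t)"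
      using t assms by auto
    then have b: "- 1 < (w * t - 1) / (w - t)" "(w * t - 1) / (w - t) < 1"
      using wt by (auto simp: field_simps)
    have d: "((\<lambda>t. (w * t - 1) / (w - t)) has_real_derivative s\<^sup>2 / (w - t)\<^sup>2) (at t)"
      using wt unfolding s by (auto intro!: derivative_eq_intros simp: power2_eq_square field_simps)
    have "(F has_real_derivative (inverse (sqrt (1 - ((w * t - 1) / (w - t))\<^sup>2)) * (s\<^sup>2 / (w - t)\<^sup>2)) / s) (at t)"
      unfolding F_def by (intro DERIV_cdivide DERIV_chain2[OF DERIV_arcsin[OF b] d])
    also have "(inverse (sqrt (1 - ((w * t - 1) / (w - t))\<^sup>2)) * (s\<^sup>2 / (w - t)\<^sup>2)) / s = 1 / (sqrt (1 - t\<^sup>2) * (w - t))"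
    proof -
      have "inverse (s * r / d) * (s\<^sup>2 / d\<^sup>2) / s = 1 / (r * d)" if "0 < r" "0 < d" for r d :: real
        using s(1) that by (simp add: field_simps power2_eq_square)
      then show ?thesis
        unfolding sq using t2 wt by simp
    qed
    finally show "(F has_real_derivative 1 / (sqrt (1 - t\<^sup>2) * (w - t))) (at t)" .
  qed simp
  moreover have "(\<lambda>x. indicator {-1<..<1} x * (1 / (sqrt (1 - x\<^sup>2) * (w - x)))) = (\<lambda>t. arcw t / (w - t))"
    by (auto simp: arcw_def fun_eq_iff split: split_indicator)
  moreover have "F 1 - F (-1) = pi / s"
  proof -
    have "(w * 1 - 1) / (w - 1) = 1" "(w * (-1) - 1) / (w - (-1)) = -1"
      using assms by (auto simp: field_simps)
    then show ?thesis
      unfolding F_def by (simp add: field_simps)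
  qed
  ultimately show ?thesis
    by (simp add: s_def)
qed

section \<open>Convolutions of the weights\<close>

text \<open>Extended nonnegative values are used throughout, because infinite values do occur:
  \<open>conv_arc 0\<close> and \<open>corr_mixed 2\<close> are infinite.\<close>

definition conv_arc :: "real \<Rightarrow> ennreal" where
  "conv_arc c = (\<integral>\<^sup>+y. ennreal (arcw (c - y)) * ennreal (arcw y) \<partial>lborel)"

definition conv_cosh :: "real \<Rightarrow> ennreal" where
  "conv_cosh c = (\<integral>\<^sup>+y. ennreal (coshw (c - y)) * ennreal (coshw y) \<partial>lborel)"

definition corr_cosh :: "real \<Rightarrow> ennreal" where
  "corr_cosh c = (\<integral>\<^sup>+y. ennreal (coshw (c + y)) * ennreal (coshw y) \<partial>lborel)"

definition corr_mixed :: "real \<Rightarrow> ennreal" where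
  "corr_mixed c = (\<integral>\<^sup>+y. ennreal (arcw (y - c)) * ennreal (coshw y) \<partial>lborel)"

lemma conv_measurable [measurable]:
  "conv_arc \<in> borel_measurable borel" "conv_cosh \<in> borel_measurable borel"
  "corr_cosh \<in> borel_measurable borel" "corr_mixed \<in> borel_measurable borel"
  unfolding conv_arc_def conv_cosh_def corr_cosh_def corr_mixed_def by measurable

lemma conv_arc_minus [simp]: "conv_arc (- c) = conv_arc c"
proof -
  have "conv_arc (- c) = (\<integral>\<^sup>+y. ennreal (arcw (c - - y)) * ennreal (arcw (- y)) \<partial>lborel)"
    unfolding conv_arc_def using arcw_minus by (intro nn_integral_cong) (metis minus_diff_eq minus_diff_commute diff_minus_eq_add add.commute)
  also have "\<dots> = conv_arc c"
    using nn_integral_reflect[of "\<lambda>y. ennreal (arcw (c - y)) * ennreal (arcw y)" 0]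
    unfolding conv_arc_def by simp
  finally show ?thesis .
qed

text \<open>With \<open>p = 1 - c/2\<close> and \<open>q = 1 + c/2\<close>, centring at \<open>c/2\<close> turns all four integrals into
  integrals of \<open>1 / sqrt \<bar>(z\<^sup>2 - p\<^sup>2) (z\<^sup>2 - q\<^sup>2)\<bar>\<close> over the intervals between the branch points.\<close>

definition ellip :: "real \<Rightarrow> real \<Rightarrow> ennreal" where
  "ellip p q = (\<integral>\<^sup>+z\<in>{-p<..<p}. ennreal (1 / sqrt ((p\<^sup>2 - z\<^sup>2) * (q\<^sup>2 - z\<^sup>2))) \<partial>lborel)"

lemma conv_arc_eq_ellip:
  assumes "0 < c" "c < 2"
  shows "conv_arc c = ellip (1 - c / 2) (1 + c / 2)"
proof -
  have "conv_arc c = (\<integral>\<^sup>+z. ennreal (arcw (c - (z + c / 2))) * ennreal (arcw (z + c / 2)) \<partial>lborel)"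
    unfolding conv_arc_def by (rule nn_integral_shift[symmetric]) simp
  also have "\<dots> = ellip (1 - c / 2) (1 + c / 2)"
    unfolding ellip_def
  proof (intro nn_integral_cong)
    fix z :: real
    let ?x = "c - (z + c / 2)" and ?y = "z + c / 2"
    have d: "\<bar>?x\<bar> < 1 \<and> \<bar>?y\<bar> < 1 \<longleftrightarrow> z \<in> {-(1 - c / 2)<..<1 - c / 2}"
      using assms by (auto simp: abs_if)
    show "ennreal (arcw ?x) * ennreal (arcw ?y) =
        ennreal (1 / sqrt (((1 - c / 2)\<^sup>2 - z\<^sup>2) * ((1 + c / 2)\<^sup>2 - z\<^sup>2))) * indicator {-(1 - c / 2)<..<1 - c / 2} z"
    proof (cases "z \<in> {-(1 - c / 2)<..<1 - c / 2}")
      case True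
      have "(1 - ?x\<^sup>2) * (1 - ?y\<^sup>2) = ((1 - c / 2)\<^sup>2 - z\<^sup>2) * ((1 + c / 2)\<^sup>2 - z\<^sup>2)"
        by (simp add: power2_eq_square field_simps)
      then have "arcw ?x * arcw ?y = 1 / sqrt (((1 - c / 2)\<^sup>2 - z\<^sup>2) * ((1 + c / 2)\<^sup>2 - z\<^sup>2))"
        using True d by (simp add: arcw_def flip: real_sqrt_mult)
      then show ?thesis
        using True by (simp flip: ennreal_mult')
    qed (use d in \<open>auto simp: arcw_def\<close>)
  qed
  finally show ?thesis .
qed

lemma conv_cosh_eq_ellip:
  assumes "2 < c"
  shows "conv_cosh c = ellip (c / 2 - 1) (1 + c / 2)"
proof -
  have "conv_cosh c = (\<integral>\<^sup>+z. ennreal (coshw (c - (z + c / 2))) * ennreal (coshw (z + c / 2)) \<partial>lborel)"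
    unfolding conv_cosh_def by (rule nn_integral_shift[symmetric]) simp
  also have "\<dots> = ellip (c / 2 - 1) (1 + c / 2)"
    unfolding ellip_def
  proof (intro nn_integral_cong)
    fix z :: real
    let ?x = "c - (z + c / 2)" and ?y = "z + c / 2"
    have d: "1 < ?x \<and> 1 < ?y \<longleftrightarrow> z \<in> {-(c / 2 - 1)<..<c / 2 - 1}"
      using assms by auto
    show "ennreal (coshw ?x) * ennreal (coshw ?y) =
        ennreal (1 / sqrt (((c / 2 - 1)\<^sup>2 - z\<^sup>2) * ((1 + c / 2)\<^sup>2 - z\<^sup>2))) * indicator {-(c / 2 - 1)<..<c / 2 - 1} z"
    proof (cases "z \<in> {-(c / 2 - 1)<..<c / 2 - 1}")
      case True
      have "(?x\<^sup>2 - 1) * (?y\<^sup>2 - 1) = ((c / 2 - 1)\<^sup>2 - z\<^sup>2) * ((1 + c / 2)\<^sup>2 - z\<^sup>2)"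
        by (simp add: power2_eq_square field_simps)
      then show ?thesis
        using True d by (simp add: coshw_def flip: real_sqrt_mult ennreal_mult')
    qed (use d in \<open>auto simp: coshw_def\<close>)
  qed
  finally show ?thesis .
qed

lemma conv_cosh_zero: "c \<le> 2 \<Longrightarrow> conv_cosh c = 0"
  unfolding conv_cosh_def
  by (subst nn_integral_0_iff_AE) (auto simp: coshw_def)

lemma conv_arc_zero: "2 \<le> c \<Longrightarrow> conv_arc c = 0"
  unfolding conv_arc_def
  by (subst nn_integral_0_iff_AE) (auto simp: arcw_def)

text \<open>Centring places the left integral over z > q. The inversion z -> pq/z carries (0,p) onto
  (q,oo) and preserves dz / sqrt |(z^2-p^2)(z^2-q^2)| up to sign; by evenness the integral over
  (0,p) is half of \<open>ellip p q\<close>.\<close>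

lemma corr_cosh_eq_ellip:
  assumes c: "0 < c" "c \<noteq> 2"
  shows "2 * corr_cosh c = ellip \<bar>1 - c / 2\<bar> (1 + c / 2)"
proof -
  define p where "p = \<bar>1 - c / 2\<bar>"
  define q where "q = 1 + c / 2"
  have p: "0 < p" "p < q" and p2: "p\<^sup>2 = (1 - c / 2)\<^sup>2"
    using c by (auto simp: p_def q_def)
  have q: "0 < q" using c by (simp add: q_def)
  define g where "g \<zeta> = p * q / \<zeta>" for \<zeta> :: real
  define f where "f z = (if q < z then 1 / sqrt ((z\<^sup>2 - p\<^sup>2) * (z\<^sup>2 - q\<^sup>2)) else 0)" for z
  let ?e = "\<lambda>z. 1 / sqrt ((p\<^sup>2 - z\<^sup>2) * (q\<^sup>2 - z\<^sup>2))"
  have sq: "p\<^sup>2 < z\<^sup>2" "q\<^sup>2 < z\<^sup>2" if "q < z" for z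
    using that p q by (intro power_strict_mono; simp)+
  have "corr_cosh c = (\<integral>\<^sup>+z. ennreal (coshw (c + (z + - c / 2))) * ennreal (coshw (z + - c / 2)) \<partial>lborel)"
    unfolding corr_cosh_def by (rule nn_integral_shift[symmetric]) simp
  also have "\<dots> = (\<integral>\<^sup>+z\<in>{q<..}. ennreal (f z) \<partial>lborel)"
  proof (intro nn_integral_cong)
    fix z :: real
    let ?x = "c + (z + - c / 2)" and ?y = "z + - c / 2"
    have d: "1 < ?x \<and> 1 < ?y \<longleftrightarrow> q < z"
      using c by (auto simp: q_def)
    show "ennreal (coshw ?x) * ennreal (coshw ?y) = ennreal (f z) * indicator {q<..} z"
    proof (cases "q < z")
      case True
      have "(?x\<^sup>2 - 1) * (?y\<^sup>2 - 1) = (z\<^sup>2 - p\<^sup>2) * (z\<^sup>2 - q\<^sup>2)"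
        unfolding p2 q_def by (simp add: power2_eq_square field_simps)
      then show ?thesis
        using True d by (simp add: coshw_def f_def flip: real_sqrt_mult ennreal_mult')
    qed (use d in \<open>auto simp: coshw_def\<close>)
  qed
  also have "{q<..} = g ` {0<..<p}"
  proof (intro set_eqI iffI)
    fix z assume "z \<in> {q<..}"
    then have z: "q < z" by simp
    then have "p * q / z \<in> {0<..<p}" "z = g (p * q / z)"
      using p q by (auto simp: g_def field_simps)
    then show "z \<in> g ` {0<..<p}" by blast
  qed (use p q in \<open>auto simp: g_def field_simps\<close>)
  also have "(\<integral>\<^sup>+z\<in>g ` {0<..<p}. ennreal (f z) \<partial>lborel)
     = (\<integral>\<^sup>+\<zeta>\<in>{0<..<p}. ennreal (\<bar>- (p * q) / \<zeta>\<^sup>2\<bar> * f (g \<zeta>)) \<partial>lborel)"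
  proof (rule nn_integral_change_of_variables)
    show "g ` {0<..<p} \<in> sets borel"
      unfolding \<open>{q<..} = g ` {0<..<p}\<close>[symmetric] by simp
    show "g \<in> borel_measurable borel"
      unfolding g_def by measurable
    show "inj_on g {0<..<p}"
      using p q by (auto simp: inj_on_def g_def)
    show "0 \<le> f t" for t
      using sq[of t] by (auto simp: f_def)
    fix x assume "x \<in> {0<..<p}"
    then show "(g has_real_derivative - (p * q) / x\<^sup>2) (at x)"
      unfolding g_def by (auto intro!: derivative_eq_intros simp: power2_eq_square)
  qed (auto simp: f_def)
  also have "\<dots> = (\<integral>\<^sup>+z\<in>{0<..<p}. ennreal (?e z) \<partial>lborel)"
  proof (intro nn_integral_cong)
    fix x :: real
    show "ennreal (\<bar>- (p * q) / x\<^sup>2\<bar> * f (g x)) * indicator {0<..<p} x = ennreal (?e x) * indicator {0<..<p} x"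
    proof (cases "x \<in> {0<..<p}")
      case True
      then have x: "0 < x" "x < p" by auto
      then have gx: "q < g x"
        using p q by (simp add: g_def field_simps)
      have x2: "x\<^sup>2 < p\<^sup>2" "x\<^sup>2 < q\<^sup>2"
        using x p by (intro power_strict_mono; simp)+
      have "((g x)\<^sup>2 - p\<^sup>2) * ((g x)\<^sup>2 - q\<^sup>2) = (p * q / x\<^sup>2)\<^sup>2 * ((p\<^sup>2 - x\<^sup>2) * (q\<^sup>2 - x\<^sup>2))"
        using x by (simp add: g_def power_divide power_mult_distrib field_simps)
      then have "sqrt (((g x)\<^sup>2 - p\<^sup>2) * ((g x)\<^sup>2 - q\<^sup>2)) = p * q / x\<^sup>2 * sqrt ((p\<^sup>2 - x\<^sup>2) * (q\<^sup>2 - x\<^sup>2))"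
        using p q x by (simp only: real_sqrt_mult) simp
      then have "\<bar>- (p * q) / x\<^sup>2\<bar> * f (g x) = ?e x"
        using p q x x2 gx by (simp add: f_def abs_mult)
      then show ?thesis by simp
    qed simp
  qed
  finally have *: "corr_cosh c = (\<integral>\<^sup>+z\<in>{0<..<p}. ennreal (?e z) \<partial>lborel)" .
  have "ellip p q = (\<integral>\<^sup>+z. ennreal (?e z) * indicator {0<..<p} z + ennreal (?e z) * indicator {-p<..<0} z \<partial>lborel)"
    unfolding ellip_def using p AE_lborel_singleton[of 0]
    by (intro nn_integral_cong_AE) (auto elim!: eventually_mono split: split_indicator)
  also have "\<dots> = (\<integral>\<^sup>+z\<in>{0<..<p}. ennreal (?e z) \<partial>lborel) + (\<integral>\<^sup>+z\<in>{-p<..<0}. ennreal (?e z) \<partial>lborel)"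
    by (rule nn_integral_add) auto
  also have "(\<integral>\<^sup>+z\<in>{-p<..<0}. ennreal (?e z) \<partial>lborel) = (\<integral>\<^sup>+z\<in>{0<..<p}. ennreal (?e z) \<partial>lborel)"
    by (subst nn_integral_reflect[of _ 0, symmetric]) (auto intro!: nn_integral_cong split: split_indicator)
  finally show ?thesis
    unfolding * p_def q_def by (simp add: mult_2)
qed

text \<open>On either side of 2 exactly one summand survives, and it is the same elliptic integral.
  At \<open>c = 2\<close> the identity fails: both convolutions vanish there while the correlation
  stays positive.\<close>

lemma corr_cosh_eq:
  assumes "0 < c" "c \<noteq> 2"
  shows "2 * corr_cosh c = conv_arc c + conv_cosh c"
proof (cases "c < 2")
  case True
  then show ?thesis
    using corr_cosh_eq_ellip[OF assms] conv_arc_eq_ellip conv_cosh_zero assms by simp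
next
  case False
  then show ?thesis
    using corr_cosh_eq_ellip[OF assms] conv_cosh_eq_ellip conv_arc_zero assms
    by (simp add: abs_minus_commute)
qed

section \<open>Bounds for the elliptic integrals, and integrability of their product\<close>

lemma nn_integral_arcsine_interval:
  fixes l r :: real
  assumes "l < r"
  shows "(\<integral>\<^sup>+x\<in>{l<..<r}. ennreal (1 / sqrt ((x - l) * (r - x))) \<partial>lborel) = ennreal pi"
proof -
  define m where "m = (l + r) / 2"
  define \<rho> where "\<rho> = (r - l) / 2"
  have \<rho>: "0 < \<rho>" using assms by (simp add: \<rho>_def)
  have "(\<integral>\<^sup>+x\<in>{l<..<r}. ennreal (1 / sqrt ((x - l) * (r - x))) \<partial>lborel)
     = ennreal \<bar>\<rho>\<bar> * (\<integral>\<^sup>+t. ennreal (1 / sqrt ((m + \<rho> * t - l) * (r - (m + \<rho> * t)))) * indicator {l<..<r} (m + \<rho> * t) \<partial>lborel)"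
    using \<rho> by (subst nn_integral_real_affine[of _ \<rho> m]) auto
  also have "\<dots> = (\<integral>\<^sup>+t. ennreal \<rho> * (ennreal (1 / sqrt ((m + \<rho> * t - l) * (r - (m + \<rho> * t)))) * indicator {l<..<r} (m + \<rho> * t)) \<partial>lborel)"
    using \<rho> by (subst nn_integral_cmult) auto
  also have "\<dots> = (\<integral>\<^sup>+t. ennreal (arcw t) \<partial>lborel)"
  proof (intro nn_integral_cong)
    fix t :: real
    have lr: "l = m - \<rho>" "r = m + \<rho>"
      by (auto simp: m_def \<rho>_def field_simps)
    have d: "m + \<rho> * t \<in> {l<..<r} \<longleftrightarrow> \<bar>t\<bar> < 1"
    proof -
      have "m + \<rho> * t \<in> {l<..<r} \<longleftrightarrow> \<rho> * (-1) < \<rho> * t \<and> \<rho> * t < \<rho> * 1"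
        unfolding lr by auto
      then show ?thesis
        using \<rho> by (simp only: mult_less_cancel_left_pos) auto
    qed
    have "(m + \<rho> * t - l) * (r - (m + \<rho> * t)) = \<rho>\<^sup>2 * (1 - t\<^sup>2)"
      unfolding lr by (simp add: power2_eq_square algebra_simps)
    then have "sqrt ((m + \<rho> * t - l) * (r - (m + \<rho> * t))) = \<rho> * sqrt (1 - t\<^sup>2)"
      using \<rho> by (simp add: real_sqrt_mult)
    then show "ennreal \<rho> * (ennreal (1 / sqrt ((m + \<rho> * t - l) * (r - (m + \<rho> * t)))) * indicator {l<..<r} (m + \<rho> * t)) = ennreal (arcw t)"
      using \<rho> d by (auto simp: arcw_def indicator_def simp flip: ennreal_mult')
  qed
  also have "\<dots> = ennreal pi"
    using has_bochner_integral_arcw by (simp add: has_bochner_integral_iff nn_integral_eq_integral)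
  finally show ?thesis .
qed

text \<open>The factor q^2 - z^2 is at least q^2 - p^2 on the interval; what is left is an arcsine
  integral of value pi. For the p and q that occur, q^2 - p^2 = 2c.\<close>

lemma ellip_le:
  assumes "0 < p" "p < q"
  shows "ellip p q \<le> ennreal (pi / sqrt (q\<^sup>2 - p\<^sup>2))"
proof -
  have q2: "0 < q\<^sup>2 - p\<^sup>2"
    using assms by (simp add: power_strict_mono)
  have "ellip p q \<le> (\<integral>\<^sup>+z. ennreal (1 / sqrt (q\<^sup>2 - p\<^sup>2)) * (ennreal (1 / sqrt ((z - (- p)) * (p - z))) * indicator {-p<..<p} z) \<partial>lborel)"
    unfolding ellip_def
  proof (intro nn_integral_mono)
    fix z :: real
    show "ennreal (1 / sqrt ((p\<^sup>2 - z\<^sup>2) * (q\<^sup>2 - z\<^sup>2))) * indicator {-p<..<p} z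
        \<le> ennreal (1 / sqrt (q\<^sup>2 - p\<^sup>2)) * (ennreal (1 / sqrt ((z - (- p)) * (p - z))) * indicator {-p<..<p} z)"
    proof (cases "z \<in> {-p<..<p}")
      case True
      then have z2: "0 < p\<^sup>2 - z\<^sup>2"
        using abs_le_square_iff[of p z] assms by (auto simp: not_le[symmetric])
      have e: "(z - (- p)) * (p - z) = p\<^sup>2 - z\<^sup>2"
        by (simp add: power2_eq_square algebra_simps)
      have "sqrt (q\<^sup>2 - p\<^sup>2) * sqrt (p\<^sup>2 - z\<^sup>2) \<le> sqrt ((p\<^sup>2 - z\<^sup>2) * (q\<^sup>2 - z\<^sup>2))"
        using z2 q2 by (simp add: real_sqrt_mult)
      then have "1 / sqrt ((p\<^sup>2 - z\<^sup>2) * (q\<^sup>2 - z\<^sup>2)) \<le> 1 / (sqrt (q\<^sup>2 - p\<^sup>2) * sqrt (p\<^sup>2 - z\<^sup>2))"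
        using z2 q2 by (intro divide_left_mono) auto
      then show ?thesis
        using True z2 q2 unfolding e by (simp add: ennreal_leI flip: ennreal_mult')
    qed simp
  qed
  also have "\<dots> = ennreal (1 / sqrt (q\<^sup>2 - p\<^sup>2)) * ennreal pi"
    using assms by (subst nn_integral_cmult) (use nn_integral_arcsine_interval[of "- p" p] in auto)
  also have "\<dots> = ennreal (pi / sqrt (q\<^sup>2 - p\<^sup>2))"
    using q2 by (simp flip: ennreal_mult')
  finally show ?thesis .
qed

lemma conv_arc_add_conv_cosh_le:
  assumes "0 < c" "c \<noteq> 2"
  shows "conv_arc c + conv_cosh c \<le> ennreal (pi / sqrt (2 * c))"
proof -
  have "ellip \<bar>1 - c / 2\<bar> (1 + c / 2) \<le> ennreal (pi / sqrt ((1 + c / 2)\<^sup>2 - \<bar>1 - c / 2\<bar>\<^sup>2))"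
    using assms by (intro ellip_le) auto
  also have "(1 + c / 2)\<^sup>2 - \<bar>1 - c / 2\<bar>\<^sup>2 = 2 * c"
    by (simp add: power2_eq_square field_simps)
  finally show ?thesis
    using assms corr_cosh_eq corr_cosh_eq_ellip by simp
qed

text \<open>The test function stays arbitrary because two choices are needed: the constant 1 for the
  bound on \<open>corr_mixed\<close>, and a rational function for the generating function of the
  Chebyshev polynomials T.\<close>

lemma corr_mixed_eq:
  fixes \<Psi> :: "real \<Rightarrow> ennreal"
  assumes c: "0 < c" and [measurable]: "\<Psi> \<in> borel_measurable borel"
  defines "p \<equiv> \<bar>1 - c / 2\<bar>" and "q \<equiv> 1 + c / 2"
  shows "(\<integral>\<^sup>+t. ennreal (arcw (t - c)) * ennreal (coshw t) * \<Psi> t \<partial>lborel)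
    = (\<integral>\<^sup>+z\<in>{p<..<q}. ennreal (1 / sqrt ((q\<^sup>2 - z\<^sup>2) * (z\<^sup>2 - p\<^sup>2))) * \<Psi> (z + c / 2) \<partial>lborel)"
proof -
  have "(\<integral>\<^sup>+t. ennreal (arcw (t - c)) * ennreal (coshw t) * \<Psi> t \<partial>lborel)
    = (\<integral>\<^sup>+z. ennreal (arcw (z + c / 2 - c)) * ennreal (coshw (z + c / 2)) * \<Psi> (z + c / 2) \<partial>lborel)"
    by (rule nn_integral_shift[symmetric]) simp
  also have "\<dots> = (\<integral>\<^sup>+z\<in>{p<..<q}. ennreal (1 / sqrt ((q\<^sup>2 - z\<^sup>2) * (z\<^sup>2 - p\<^sup>2))) * \<Psi> (z + c / 2) \<partial>lborel)"
  proof (intro nn_integral_cong)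
    fix z :: real
    let ?x = "z + c / 2 - c" and ?y = "z + c / 2"
    have d: "\<bar>?x\<bar> < 1 \<and> 1 < ?y \<longleftrightarrow> z \<in> {p<..<q}"
      using c by (auto simp: p_def q_def abs_if split: if_splits)
    show "ennreal (arcw ?x) * ennreal (coshw ?y) * \<Psi> ?y =
        ennreal (1 / sqrt ((q\<^sup>2 - z\<^sup>2) * (z\<^sup>2 - p\<^sup>2))) * \<Psi> ?y * indicator {p<..<q} z"
    proof (cases "z \<in> {p<..<q}")
      case True
      have "(1 - ?x\<^sup>2) * (?y\<^sup>2 - 1) = (q\<^sup>2 - z\<^sup>2) * (z\<^sup>2 - p\<^sup>2)"
        by (simp add: power2_eq_square field_simps p_def q_def)
      then have "arcw ?x * coshw ?y = 1 / sqrt ((q\<^sup>2 - z\<^sup>2) * (z\<^sup>2 - p\<^sup>2))"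
        using True d by (simp add: coshw_def arcw_def flip: real_sqrt_mult)
      then show ?thesis
        using True by (simp flip: ennreal_mult')
    qed (use d in \<open>auto simp: coshw_def arcw_def\<close>)
  qed
  finally show ?thesis .
qed

text \<open>In the factorisation (z+p)(q+z)(z-p)(q-z) of the radicand the first two factors are at
  least 2p and q, and the last two give an arcsine integral. The integral blows up as c approaches
  2, where p becomes 0, but an inverse square root of |2 - c| is still integrable.\<close>

lemma corr_mixed_le:
  assumes c: "0 < c" "c \<noteq> 2"
  shows "corr_mixed c \<le> ennreal (pi / sqrt (\<bar>2 - c\<bar> * (1 + c / 2)))"
proof -
  define p where "p = \<bar>1 - c / 2\<bar>"
  define q where "q = 1 + c / 2"
  have p: "0 < p" "p < q" using c by (auto simp: p_def q_def)
  have "corr_mixed c = (\<integral>\<^sup>+z\<in>{p<..<q}. ennreal (1 / sqrt ((q\<^sup>2 - z\<^sup>2) * (z\<^sup>2 - p\<^sup>2))) \<partial>lborel)"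
    unfolding corr_mixed_def p_def q_def using corr_mixed_eq[OF c(1), of "\<lambda>_. 1"] by simp
  also have "\<dots> \<le> (\<integral>\<^sup>+z. ennreal (1 / sqrt (2 * p * q)) * (ennreal (1 / sqrt ((z - p) * (q - z))) * indicator {p<..<q} z) \<partial>lborel)"
  proof (intro nn_integral_mono)
    fix z :: real
    show "ennreal (1 / sqrt ((q\<^sup>2 - z\<^sup>2) * (z\<^sup>2 - p\<^sup>2))) * indicator {p<..<q} z
       \<le> ennreal (1 / sqrt (2 * p * q)) * (ennreal (1 / sqrt ((z - p) * (q - z))) * indicator {p<..<q} z)"
    proof (cases "z \<in> {p<..<q}")
      case True
      then have z: "p < z" "z < q" by auto
      have "2 * p * q \<le> (z + p) * (q + z)"
        using z p by (intro mult_mono) auto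
      then have "2 * p * q * ((z - p) * (q - z)) \<le> (z + p) * (q + z) * ((z - p) * (q - z))"
        using z by (intro mult_right_mono) auto
      also have "\<dots> = (q\<^sup>2 - z\<^sup>2) * (z\<^sup>2 - p\<^sup>2)"
        by (simp add: power2_eq_square algebra_simps)
      finally have "sqrt (2 * p * q) * sqrt ((z - p) * (q - z)) \<le> sqrt ((q\<^sup>2 - z\<^sup>2) * (z\<^sup>2 - p\<^sup>2))"
        by (simp flip: real_sqrt_mult)
      moreover have "0 < sqrt (2 * p * q) * sqrt ((z - p) * (q - z))"
        using z p by simp
      ultimately have "1 / sqrt ((q\<^sup>2 - z\<^sup>2) * (z\<^sup>2 - p\<^sup>2)) \<le> 1 / (sqrt (2 * p * q) * sqrt ((z - p) * (q - z)))"
        by (intro frac_le) (simp_all only: zero_le_one order_refl)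
      then show ?thesis
        using True z p by (simp add: ennreal_leI flip: ennreal_mult')
    qed simp
  qed
  also have "\<dots> = ennreal (1 / sqrt (2 * p * q)) * ennreal pi"
    using p by (subst nn_integral_cmult) (auto simp: nn_integral_arcsine_interval)
  also have "\<dots> = ennreal (pi / sqrt (2 * p * q))"
    using p by (simp flip: ennreal_mult')
  also have "2 * p = \<bar>2 - c\<bar>"
    by (simp add: p_def abs_if)
  finally show ?thesis
    by (simp add: q_def)
qed

text \<open>The two bounds multiply to pi^2 \<open>k c\<close>, and \<open>k c\<close> dc is
  invariant under c -> 4/c, which exchanges (0,2) and (2,oo). On (0,2) it is dominated by an arcsine
  integrand. This single estimate supplies all integrability in c that is used later, over a*a as
  well as over b*b.\<close>

lemma nn_integral_conv_corr_mixed_finite: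
  "(\<integral>\<^sup>+c\<in>{0<..}. (conv_arc c + conv_cosh c) * corr_mixed c \<partial>lborel) < \<infinity>"
proof -
  define k where "k c = 1 / sqrt (c * \<bar>4 - c\<^sup>2\<bar>)" for c :: real
  define g where "g x = 4 / x" for x :: real
  have [measurable]: "k \<in> borel_measurable borel" "g \<in> borel_measurable borel"
    unfolding k_def g_def by measurable
  have bound: "(conv_arc c + conv_cosh c) * corr_mixed c \<le> ennreal (pi\<^sup>2) * ennreal (k c)" if "0 < c" "c \<noteq> 2" for c
  proof -
    have "(conv_arc c + conv_cosh c) * corr_mixed c
        \<le> ennreal (pi / sqrt (2 * c)) * ennreal (pi / sqrt (\<bar>2 - c\<bar> * (1 + c / 2)))"
      using that by (intro mult_mono conv_arc_add_conv_cosh_le corr_mixed_le) auto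
    also have "\<dots> = ennreal (pi\<^sup>2 * (1 / sqrt ((2 * c) * (\<bar>2 - c\<bar> * (1 + c / 2)))))"
      unfolding real_sqrt_mult[of "2 * c"] using that by (simp add: power2_eq_square flip: ennreal_mult')
    also have "(2 * c) * (\<bar>2 - c\<bar> * (1 + c / 2)) = c * (\<bar>2 - c\<bar> * \<bar>2 + c\<bar>)"
      using that by (simp add: field_simps)
    also have "\<bar>2 - c\<bar> * \<bar>2 + c\<bar> = \<bar>4 - c\<^sup>2\<bar>"
      by (simp add: power2_eq_square algebra_simps flip: abs_mult)
    finally show ?thesis
      using that by (simp add: k_def flip: ennreal_mult')
  qed
  have I02: "(\<integral>\<^sup>+c\<in>{0<..<2}. ennreal (k c) \<partial>lborel) \<le> ennreal pi"
  proof -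
    have "(\<integral>\<^sup>+c\<in>{0<..<2}. ennreal (k c) \<partial>lborel) \<le> (\<integral>\<^sup>+c\<in>{0<..<2}. ennreal (1 / sqrt ((c - 0) * (2 - c))) \<partial>lborel)"
    proof (intro nn_integral_mono)
      fix c :: real
      show "ennreal (k c) * indicator {0<..<2} c \<le> ennreal (1 / sqrt ((c - 0) * (2 - c))) * indicator {0<..<2} c"
      proof (cases "c \<in> {0<..<2}")
        case True
        then have c: "0 < c" "c < 2" by auto
        have "(c - 0) * (2 - c) * 1 \<le> (c - 0) * (2 - c) * (2 + c)"
          using c by (intro mult_left_mono) auto
        also have "\<dots> = c * (4 - c\<^sup>2)"
          by (simp add: power2_eq_square algebra_simps)
        also have "\<dots> \<le> c * \<bar>4 - c\<^sup>2\<bar>"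
          using c by simp
        finally have "1 / sqrt (c * \<bar>4 - c\<^sup>2\<bar>) \<le> 1 / sqrt ((c - 0) * (2 - c))"
          using c by (intro frac_le) auto
        then show ?thesis
          using True by (simp add: k_def ennreal_leI)
      qed simp
    qed
    also have "\<dots> = ennreal pi"
      by (rule nn_integral_arcsine_interval) simp
    finally show ?thesis .
  qed
  have "{2<..} = g ` {0<..<2}"
  proof (intro set_eqI iffI)
    fix z :: real assume "z \<in> {2<..}"
    then have "4 / z \<in> {0<..<2}" "z = g (4 / z)"
      by (auto simp: g_def field_simps)
    then show "z \<in> g ` {0<..<2}" by blast
  qed (auto simp: g_def field_simps)
  moreover have "(\<integral>\<^sup>+c\<in>{2<..}. ennreal (k c) \<partial>lborel) = (\<integral>\<^sup>+c\<in>{2<..}. ennreal (\<bar>k c\<bar>) \<partial>lborel)"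
    by (auto intro!: nn_integral_cong simp: k_def split: split_indicator)
  ultimately have "(\<integral>\<^sup>+c\<in>{2<..}. ennreal (k c) \<partial>lborel) = (\<integral>\<^sup>+c\<in>g ` {0<..<2}. ennreal (\<bar>k c\<bar>) \<partial>lborel)"
    by simp
  also have "\<dots> = (\<integral>\<^sup>+x\<in>{0<..<2}. ennreal (\<bar>- 4 / x\<^sup>2\<bar> * \<bar>k (g x)\<bar>) \<partial>lborel)"
  proof (rule nn_integral_change_of_variables)
    show "g ` {0<..<2} \<in> sets borel"
      unfolding \<open>{2<..} = g ` {0<..<2}\<close>[symmetric] by simp
    show "inj_on g {0<..<2}"
      by (auto simp: inj_on_def g_def)
    fix x :: real assume "x \<in> {0<..<2}"
    then show "(g has_real_derivative - 4 / x\<^sup>2) (at x)"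
      unfolding g_def by (auto intro!: derivative_eq_intros simp: power2_eq_square)
  qed auto
  also have "\<dots> = (\<integral>\<^sup>+c\<in>{0<..<2}. ennreal (k c) \<partial>lborel)"
  proof (intro nn_integral_cong)
    fix x :: real
    show "ennreal (\<bar>- 4 / x\<^sup>2\<bar> * \<bar>k (g x)\<bar>) * indicator {0<..<2} x = ennreal (k x) * indicator {0<..<2} x"
    proof (cases "x \<in> {0<..<2}")
      case True
      then have x: "0 < x" "x < 2" by auto
      then have "x\<^sup>2 < 2\<^sup>2"
        by (intro power_strict_mono) auto
      then have x2: "x\<^sup>2 < 4" by simp
      have "\<bar>4 - (g x)\<^sup>2\<bar> = \<bar>(x\<^sup>2 - 4) * (4 / x\<^sup>2)\<bar>"
        using x by (intro arg_cong[where f=abs]) (simp add: g_def power2_eq_square field_simps)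
      then have "g x * \<bar>4 - (g x)\<^sup>2\<bar> = (4 / x\<^sup>2)\<^sup>2 * (x * \<bar>4 - x\<^sup>2\<bar>)"
        using x x2 by (simp add: abs_mult g_def) (simp add: power2_eq_square field_simps)
      then have "sqrt (g x * \<bar>4 - (g x)\<^sup>2\<bar>) = 4 / x\<^sup>2 * sqrt (x * \<bar>4 - x\<^sup>2\<bar>)"
        using x by (simp only: real_sqrt_mult real_sqrt_abs) simp
      then have "\<bar>- 4 / x\<^sup>2\<bar> * \<bar>k (g x)\<bar> = k x"
        using x x2 by (simp add: k_def abs_mult)
      then show ?thesis by simp
    qed simp
  qed
  finally have I2: "(\<integral>\<^sup>+c\<in>{2<..}. ennreal (k c) \<partial>lborel) \<le> ennreal pi"
    using I02 by simp
  have "(\<integral>\<^sup>+c\<in>{0<..}. (conv_arc c + conv_cosh c) * corr_mixed c \<partial>lborel)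
    \<le> (\<integral>\<^sup>+c. ennreal (pi\<^sup>2) * (ennreal (k c) * indicator {0<..<2} c + ennreal (k c) * indicator {2<..} c) \<partial>lborel)"
    using AE_lborel_singleton[of 2] bound
    by (intro nn_integral_mono_AE) (auto elim!: eventually_mono split: split_indicator)
  also have "\<dots> = ennreal (pi\<^sup>2) * ((\<integral>\<^sup>+c\<in>{0<..<2}. ennreal (k c) \<partial>lborel) + (\<integral>\<^sup>+c\<in>{2<..}. ennreal (k c) \<partial>lborel))"
    by (simp add: nn_integral_cmult nn_integral_add)
  also have "\<dots> \<le> ennreal (pi\<^sup>2) * (ennreal pi + ennreal pi)"
    by (intro mult_left_mono add_mono I02 I2) auto
  also have "\<dots> < \<infinity>"
    by (simp add: ennreal_mult_less_top flip: ennreal_plus)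
  finally show ?thesis .
qed

text \<open>Both sides integrate \<open>\<sigma>\<close> against the law of \<open>cosh u + cosh v - cosh w\<close>, the two
  positive terms being combined first on the left, the outer two on the right.\<close>

lemma conv_cosh_corr_cosh_exchange:
  fixes \<sigma> :: "real \<Rightarrow> ennreal"
  assumes [measurable]: "\<sigma> \<in> borel_measurable borel"
  shows "(\<integral>\<^sup>+c. conv_cosh c * (\<integral>\<^sup>+t. ennreal (coshw (c - t)) * \<sigma> t \<partial>lborel) \<partial>lborel)
    = (\<integral>\<^sup>+c. corr_cosh c * (\<integral>\<^sup>+t. ennreal (coshw (c - t)) * \<sigma> (- t) \<partial>lborel) \<partial>lborel)"
proof -
  let ?w = "\<lambda>x. ennreal (coshw x)"
  define S where "S c = (\<integral>\<^sup>+t. ?w (c - t) * \<sigma> t \<partial>lborel)" for c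
  define S' where "S' c = (\<integral>\<^sup>+t. ?w (c - t) * \<sigma> (- t) \<partial>lborel)" for c
  have [measurable]: "S \<in> borel_measurable borel" "S' \<in> borel_measurable borel"
    unfolding S_def S'_def by measurable
  have S: "S c = (\<integral>\<^sup>+s. ?w s * \<sigma> (c - s) \<partial>lborel)" for c
    using nn_integral_reflect[of "\<lambda>t. ?w (c - t) * \<sigma> t" c] by (simp add: S_def)
  have S': "S' c = (\<integral>\<^sup>+s. ?w s * \<sigma> (s - c) \<partial>lborel)" for c
    using nn_integral_reflect[of "\<lambda>t. ?w (c - t) * \<sigma> (- t)" c] by (simp add: S'_def)
  have "(\<integral>\<^sup>+c. conv_cosh c * S c \<partial>lborel) = (\<integral>\<^sup>+c. (\<integral>\<^sup>+y. ?w (c - y) * ?w y * S c \<partial>lborel) \<partial>lborel)"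
    unfolding conv_cosh_def by (intro nn_integral_cong nn_integral_multc[symmetric]) simp
  also have "\<dots> = (\<integral>\<^sup>+y. (\<integral>\<^sup>+c. ?w (c - y) * ?w y * S c \<partial>lborel) \<partial>lborel)"
    by (rule lborel_pair.Fubini') simp
  also have "\<dots> = (\<integral>\<^sup>+y. ?w y * (\<integral>\<^sup>+c. ?w c * S (c + y) \<partial>lborel) \<partial>lborel)"
  proof (intro nn_integral_cong)
    fix y
    have "(\<integral>\<^sup>+c. ?w (c - y) * ?w y * S c \<partial>lborel) = (\<integral>\<^sup>+c. ?w y * (?w c * S (c + y)) \<partial>lborel)"
      using nn_integral_shift[of "\<lambda>c. ?w (c - y) * ?w y * S c" y] by (simp add: ac_simps)
    then show "(\<integral>\<^sup>+c. ?w (c - y) * ?w y * S c \<partial>lborel) = ?w y * (\<integral>\<^sup>+c. ?w c * S (c + y) \<partial>lborel)"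
      by (simp add: nn_integral_cmult)
  qed
  \<comment> \<open>The regrouping happens here: the argument c + y - s is read as c - (s - y),
    which pairs the subtracted term s with y instead of pairing c with y.\<close>
  also have "\<dots> = (\<integral>\<^sup>+y. ?w y * (\<integral>\<^sup>+c. ?w c * S' (c - y) \<partial>lborel) \<partial>lborel)"
  proof (rule nn_integral_cong, rule arg_cong2[where f = "(*)", OF refl])
    fix y
    have "(\<integral>\<^sup>+c. ?w c * S (c + y) \<partial>lborel) = (\<integral>\<^sup>+c. (\<integral>\<^sup>+s. ?w c * (?w s * \<sigma> (c + y - s)) \<partial>lborel) \<partial>lborel)"
      unfolding S by (simp add: nn_integral_cmult)
    also have "\<dots> = (\<integral>\<^sup>+s. (\<integral>\<^sup>+c. ?w c * (?w s * \<sigma> (c + y - s)) \<partial>lborel) \<partial>lborel)"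
      by (rule lborel_pair.Fubini') simp
    also have "\<dots> = (\<integral>\<^sup>+s. ?w s * (\<integral>\<^sup>+c. ?w c * \<sigma> (c - (s - y)) \<partial>lborel) \<partial>lborel)"
      by (simp add: mult.left_commute[of "?w _" "?w _"] nn_integral_cmult diff_diff_eq2)
    finally show "(\<integral>\<^sup>+c. ?w c * S (c + y) \<partial>lborel) = (\<integral>\<^sup>+c. ?w c * S' (c - y) \<partial>lborel)"
      unfolding S' .
  qed
  also have "\<dots> = (\<integral>\<^sup>+y. (\<integral>\<^sup>+c. ?w (c + y) * ?w y * S' c \<partial>lborel) \<partial>lborel)"
  proof (intro nn_integral_cong)
    fix y
    have "(\<integral>\<^sup>+c. ?w (c + y) * ?w y * S' c \<partial>lborel) = (\<integral>\<^sup>+c. ?w y * (?w c * S' (c - y)) \<partial>lborel)"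
      using nn_integral_shift[of "\<lambda>c. ?w (c + y) * ?w y * S' c" "- y"] by (simp add: ac_simps)
    then show "?w y * (\<integral>\<^sup>+c. ?w c * S' (c - y) \<partial>lborel) = (\<integral>\<^sup>+c. ?w (c + y) * ?w y * S' c \<partial>lborel)"
      by (simp add: nn_integral_cmult)
  qed
  also have "\<dots> = (\<integral>\<^sup>+c. (\<integral>\<^sup>+y. ?w (c + y) * ?w y * S' c \<partial>lborel) \<partial>lborel)"
    by (rule lborel_pair.Fubini') simp
  also have "\<dots> = (\<integral>\<^sup>+c. corr_cosh c * S' c \<partial>lborel)"
    unfolding corr_cosh_def by (intro nn_integral_cong nn_integral_multc) simp
  finally show ?thesis
    unfolding S_def S'_def .
qed

section \<open>Chebyshev polynomials: bounds, generating functions, trigonometric and hyperbolic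
  forms\<close>

fun cheb_T :: "nat \<Rightarrow> real \<Rightarrow> real" where
  "cheb_T 0 x = 1"
| "cheb_T (Suc 0) x = x"
| "cheb_T (Suc (Suc n)) x = 2 * x * cheb_T (Suc n) x - cheb_T n x"

fun cheb_U :: "nat \<Rightarrow> real \<Rightarrow> real" where
  "cheb_U 0 x = 1"
| "cheb_U (Suc 0) x = 2 * x"
| "cheb_U (Suc (Suc n)) x = 2 * x * cheb_U (Suc n) x - cheb_U n x"

lemma cheb_continuous [continuous_intros]:
  "continuous_on A (cheb_T n)" "continuous_on A (cheb_U n)"
proof -
  show "continuous_on A (cheb_T n)"
  proof (induction n rule: induct_nat_012)
    case (ge2 n)
    then show ?case by (simp add: continuous_intros del: continuous_on_op_minus)
  qed (simp_all add: continuous_intros)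
  show "continuous_on A (cheb_U n)"
  proof (induction n rule: induct_nat_012)
    case (ge2 n)
    then show ?case by (simp add: continuous_intros del: continuous_on_op_minus)
  qed (simp_all add: continuous_intros)
qed

lemma cheb_measurable [measurable]:
  "cheb_T n \<in> borel_measurable borel" "cheb_U n \<in> borel_measurable borel"
  by (auto intro!: borel_measurable_continuous_onI continuous_intros)

text \<open>Stated for any solution of the recurrence, so that T and U are handled together. The
  bound is crude, but it is uniform on bounded sets of x and gives the generating series a common
  radius of convergence there.\<close>

lemma cheb_bound:
  fixes a :: "nat \<Rightarrow> real"
  assumes rec: "\<And>n. a (Suc (Suc n)) = 2 * x * a (Suc n) - a n"
    and "\<bar>a 0\<bar> \<le> 1" "\<bar>a 1\<bar> \<le> 2 * \<bar>x\<bar> + 1"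
  shows "\<bar>a n\<bar> \<le> (2 * \<bar>x\<bar> + 1) ^ n"
proof (induction n rule: induct_nat_012)
  case (ge2 n)
  let ?b = "2 * \<bar>x\<bar> + 1"
  have "\<bar>a (Suc (Suc n))\<bar> \<le> (2 * \<bar>x\<bar>) * \<bar>a (Suc n)\<bar> + \<bar>a n\<bar>"
    unfolding rec by (rule order_trans[OF abs_triangle_ineq4]) (simp add: abs_mult)
  also have "\<dots> \<le> (2 * \<bar>x\<bar>) * ?b ^ Suc n + ?b ^ n"
    using ge2 by (intro add_mono mult_left_mono) auto
  also have "\<dots> \<le> (2 * \<bar>x\<bar>) * ?b ^ Suc n + ?b ^ Suc n"
    by (intro add_left_mono power_increasing) auto
  also have "\<dots> = ?b ^ Suc (Suc n)"
    by (simp add: algebra_simps)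
  finally show ?case .
qed (use assms in auto)

lemma cheb_sums:
  fixes a :: "nat \<Rightarrow> real"
  assumes rec: "\<And>n. a (Suc (Suc n)) = 2 * x * a (Suc n) - a n"
    and "\<bar>a 0\<bar> \<le> 1" "\<bar>a 1\<bar> \<le> 2 * \<bar>x\<bar> + 1" and y: "0 \<le> y" "(2 * \<bar>x\<bar> + 1) * y < 1"
  shows "(\<lambda>n. a n * y ^ n) sums ((a 0 + (a 1 - 2 * x * a 0) * y) / (1 - 2 * x * y + y\<^sup>2))"
proof -
  have "summable (\<lambda>n. ((2 * \<bar>x\<bar> + 1) * y) ^ n)"
    using y by (intro summable_geometric) auto
  then have sm: "summable (\<lambda>n. a n * y ^ n)"
  proof (rule summable_comparison_test'[where N = 0])
    fix n
    show "norm (a n * y ^ n) \<le> ((2 * \<bar>x\<bar> + 1) * y) ^ n"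
      using cheb_bound[OF assms(1-3), of n] y by (simp add: abs_mult power_mult_distrib mult_right_mono)
  qed
  define S where "S = (\<Sum>n. a n * y ^ n)"
  have s1: "(\<lambda>n. a n * y ^ n) sums S"
    using sm by (simp add: S_def summable_sums)
  have s2: "(\<lambda>n. a (Suc n) * y ^ Suc n) sums (S - a 0)"
    using s1 by (subst sums_Suc_iff) simp
  have s3: "(\<lambda>n. a (Suc (Suc n)) * y ^ Suc (Suc n)) sums (S - a 0 - a 1 * y)"
    using s2 by (subst sums_Suc_iff) simp
  have "(\<lambda>n. (2 * x * y) * (a (Suc n) * y ^ Suc n) - y\<^sup>2 * (a n * y ^ n)) sums
      ((2 * x * y) * (S - a 0) - y\<^sup>2 * S)"
    by (intro sums_diff sums_mult s1 s2)
  also have "(\<lambda>n. (2 * x * y) * (a (Suc n) * y ^ Suc n) - y\<^sup>2 * (a n * y ^ n)) = (\<lambda>n. a (Suc (Suc n)) * y ^ Suc (Suc n))"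
    by (auto simp: fun_eq_iff rec power2_eq_square algebra_simps)
  finally have "S - a 0 - a 1 * y = (2 * x * y) * (S - a 0) - y\<^sup>2 * S"
    using s3 sums_unique2 by blast
  then have *: "S * (1 - 2 * x * y + y\<^sup>2) = a 0 + (a 1 - 2 * x * a 0) * y"
    by (simp add: algebra_simps)
  have "2 * x * y \<le> 2 * \<bar>x\<bar> * y"
    using y by (intro mult_right_mono) auto
  also have "\<dots> < 1"
    using y by (simp add: algebra_simps)
  finally have "1 - 2 * x * y + y\<^sup>2 > 0"
    by (simp add: add_pos_nonneg)
  then have "S = (a 0 + (a 1 - 2 * x * a 0) * y) / (1 - 2 * x * y + y\<^sup>2)"
    using * by (simp add: field_simps)
  then show ?thesis
    using s1 by simp
qed

lemma cheb_T_bound: "\<bar>cheb_T n x\<bar> \<le> (2 * \<bar>x\<bar> + 1) ^ n"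
  by (rule cheb_bound) auto

lemma cheb_U_bound: "\<bar>cheb_U n x\<bar> \<le> (2 * \<bar>x\<bar> + 1) ^ n"
  by (rule cheb_bound) auto

lemma cheb_T_sums:
  assumes "0 \<le> y" "(2 * \<bar>x\<bar> + 1) * y < 1"
  shows "(\<lambda>n. cheb_T n x * y ^ n) sums ((1 - x * y) / (1 - 2 * x * y + y\<^sup>2))"
  using cheb_sums[of "\<lambda>n. cheb_T n x" x y] assms by (simp add: algebra_simps)

lemma cheb_U_sums:
  assumes "0 \<le> y" "(2 * \<bar>x\<bar> + 1) * y < 1"
  shows "(\<lambda>n. cheb_U n x * y ^ n) sums (1 / (1 - 2 * x * y + y\<^sup>2))"
  using cheb_sums[of "\<lambda>n. cheb_U n x" x y] assms by simp

lemma cheb_T_minus: "cheb_T n (- x) = (- 1) ^ n * cheb_T n x"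
  by (induction n x rule: cheb_T.induct) (auto simp: algebra_simps)

lemma cheb_U_minus: "cheb_U n (- x) = (- 1) ^ n * cheb_U n x"
  by (induction n x rule: cheb_U.induct) (auto simp: algebra_simps)

lemma cheb_T_cos: "cheb_T n (cos \<theta>) = cos (real n * \<theta>)"
proof (induction n rule: induct_nat_012)
  case (ge2 n)
  have "cos (real (Suc (Suc n)) * \<theta>) + cos (real n * \<theta>) = 2 * cos \<theta> * cos (real (Suc n) * \<theta>)"
    using cos_add[of "real (Suc n) * \<theta>" \<theta>] cos_diff[of "real (Suc n) * \<theta>" \<theta>] by (simp add: algebra_simps)
  then show ?case using ge2 by simp
qed auto

lemma cheb_T_le_1: "\<bar>x\<bar> \<le> 1 \<Longrightarrow> \<bar>cheb_T n x\<bar> \<le> 1"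
  using cheb_T_cos[of n "arccos x"] by (simp add: cos_arccos_abs)

lemma cheb_T_cosh: "cheb_T n (cosh u) = cosh (real n * u)" for u :: real
proof (induction n rule: induct_nat_012)
  case (ge2 n)
  have "cosh (real (Suc (Suc n)) * u) + cosh (real n * u) = 2 * cosh u * cosh (real (Suc n) * u)"
    using cosh_add[of "real (Suc n) * u" u] cosh_diff[of "real (Suc n) * u" u] by (simp add: algebra_simps)
  then show ?case using ge2 by simp
qed auto

lemma cheb_U_cosh: "cheb_U n (cosh u) * sinh u = sinh (real (Suc n) * u)" for u :: real
proof (induction n rule: induct_nat_012)
  case 1
  show ?case using sinh_double[of u] by simp
next
  case (ge2 n)
  have "sinh (real (Suc (Suc (Suc n))) * u) + sinh (real (Suc n) * u) = 2 * cosh u * sinh (real (Suc (Suc n)) * u)"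
    using sinh_add[of "real (Suc (Suc n)) * u" u] sinh_diff[of "real (Suc (Suc n)) * u" u] by (simp add: algebra_simps)
  moreover have "cheb_U (Suc (Suc n)) (cosh u) * sinh u = 2 * cosh u * (cheb_U (Suc n) (cosh u) * sinh u) - cheb_U n (cosh u) * sinh u"
    by (simp add: algebra_simps)
  ultimately show ?case using ge2 by simp
qed auto

section \<open>The exchange identity for Chebyshev polynomials\<close>

text \<open>Only positive \<open>y\<close> are assumed, since the generating functions are evaluated
  for \<open>0 < y\<close>. The constant term is a limit from the right; the later ones follow after
  division by y.\<close>

lemma powser_sums_zero_right_imp_zero:
  fixes a :: "nat \<Rightarrow> real"
  assumes r: "0 < r" and sums: "\<And>y. 0 < y \<Longrightarrow> y < r \<Longrightarrow> (\<lambda>n. a n * y ^ n) sums 0"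
  shows "a n = 0"
  using sums
proof (induction n arbitrary: a)
  have a0: "a 0 = 0" if sums: "\<And>y. 0 < y \<Longrightarrow> y < r \<Longrightarrow> (\<lambda>n. a n * y ^ n) sums 0" for a :: "nat \<Rightarrow> real"
  proof -
    have sm: "summable (\<lambda>n. a n * (r / 2) ^ n)"
      using sums[of "r / 2"] r by (simp add: sums_iff)
    define f where "f x = (\<Sum>n. a n * x ^ n)" for x
    have "(\<lambda>n. a n * x ^ n) sums f x" if "norm x < r / 2" for x
      unfolding f_def using powser_inside[OF sm, of x] that r by (simp add: summable_sums)
    then have "(f \<longlongrightarrow> a 0) (at 0)"
      using r by (intro powser_limit_0[of "r / 2" a f]) auto
    then have "(f \<longlongrightarrow> a 0) (at_right 0)"
      by (rule tendsto_within_subset) simp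
    moreover have "eventually (\<lambda>x. f x = 0) (at_right 0)"
      using r sums unfolding f_def eventually_at_right_field by (auto intro!: exI[of _ r] simp: sums_iff)
    then have "(f \<longlongrightarrow> 0) (at_right 0)"
      by (rule tendsto_eventually)
    ultimately show "a 0 = 0"
      by (rule tendsto_unique[rotated]) simp
  qed
  case 0
  then show ?case by (rule a0)
  case (Suc n)
  have "(\<lambda>n. a (Suc n) * y ^ n) sums 0" if y: "0 < y" "y < r" for y
  proof -
    have "(\<lambda>n. a (Suc n) * y ^ Suc n) sums 0"
      using Suc.prems[OF y] a0[OF Suc.prems] by (subst sums_Suc_iff) simp
    then have "(\<lambda>n. (1 / y) * (a (Suc n) * y ^ Suc n)) sums ((1 / y) * 0)"
      by (rule sums_mult)
    then show ?thesis
      using y by simp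
  qed
  then show ?case
    by (rule Suc.IH)
qed

text \<open>Termwise integration under a geometric majorant. Bound and convergence are demanded only
  where the weight is nonzero, because the polynomials are bounded by powers of one constant only on
  a bounded support.\<close>

lemma weighted_power_series_sums:
  fixes \<omega> H :: "real \<Rightarrow> real" and h :: "nat \<Rightarrow> real \<Rightarrow> real"
  assumes \<omega>: "integrable lborel \<omega>" "\<And>t. 0 \<le> \<omega> t"
    and [measurable]: "\<And>m. h m \<in> borel_measurable borel"
    and bound: "\<And>m t. \<omega> t \<noteq> 0 \<Longrightarrow> \<bar>h m t\<bar> \<le> C * K ^ m"
    and K: "0 \<le> K" and y: "0 \<le> y" "K * y < 1"
    and sums: "\<And>t. \<omega> t \<noteq> 0 \<Longrightarrow> (\<lambda>m. h m t * y ^ m) sums H t"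
  shows "(\<lambda>m. (\<integral>t. \<omega> t * h m t \<partial>lborel) * y ^ m) sums (\<integral>t. \<omega> t * H t \<partial>lborel)"
proof -
  have [measurable]: "\<omega> \<in> borel_measurable borel"
    using \<omega> by auto
  define f where "f m t = \<omega> t * h m t * y ^ m" for m t
  have fb: "norm (f m t) \<le> \<omega> t * (C * (K * y) ^ m)" for m t
  proof (cases "\<omega> t = 0")
    case False
    have "\<bar>\<omega> t\<bar> * \<bar>h m t\<bar> * \<bar>y ^ m\<bar> \<le> \<bar>\<omega> t\<bar> * (C * K ^ m) * \<bar>y ^ m\<bar>"
      using bound[OF False] by (intro mult_right_mono mult_left_mono) auto
    then show ?thesis
      using \<omega> y by (simp add: f_def abs_mult power_mult_distrib mult.assoc)
  qed (simp add: f_def)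
  have int: "integrable lborel (f m)" for m
  proof (rule Bochner_Integration.integrable_bound)
    show "integrable lborel (\<lambda>t. \<omega> t * (C * (K * y) ^ m))"
      using \<omega> by simp
    show "f m \<in> borel_measurable lborel"
      unfolding f_def by measurable
    show "AE t in lborel. norm (f m t) \<le> norm (\<omega> t * (C * (K * y) ^ m))"
      unfolding real_norm_def by (intro AE_I2 order_trans[OF fb[unfolded real_norm_def] abs_ge_self])
  qed
  have geo: "summable (\<lambda>m. A * (C * (K * y) ^ m))" for A
    using K y by (intro summable_mult summable_geometric) auto
  have "(\<lambda>m. integral\<^sup>L lborel (f m)) sums (\<integral>t. (\<Sum>m. f m t) \<partial>lborel)"
  proof (rule sums_integral[OF int])
    show "AE t in lborel. summable (\<lambda>m. norm (f m t))"
    proof (rule AE_I2, rule summable_comparison_test'[where N = 0])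
      show "summable (\<lambda>m. \<omega> t * (C * (K * y) ^ m))" for t
        by (rule geo)
      show "norm (norm (f m t)) \<le> \<omega> t * (C * (K * y) ^ m)" for m t
        using fb by simp
    qed
    show "summable (\<lambda>m. \<integral>t. norm (f m t) \<partial>lborel)"
    proof (rule summable_comparison_test'[where N = 0])
      show "summable (\<lambda>m. integral\<^sup>L lborel \<omega> * (C * (K * y) ^ m))"
        by (rule geo)
      fix m
      have "(\<integral>t. norm (f m t) \<partial>lborel) \<le> (\<integral>t. \<omega> t * (C * (K * y) ^ m) \<partial>lborel)"
        using \<omega> int fb by (intro integral_mono) auto
      then show "norm (\<integral>t. norm (f m t) \<partial>lborel) \<le> integral\<^sup>L lborel \<omega> * (C * (K * y) ^ m)"
        by simp
    qed
  qed
  also have "(\<lambda>m. integral\<^sup>L lborel (f m)) = (\<lambda>m. (\<integral>t. \<omega> t * h m t \<partial>lborel) * y ^ m)"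
    by (simp add: f_def[abs_def])
  also have "(\<lambda>t. \<Sum>m. f m t) = (\<lambda>t. \<omega> t * H t)"
  proof
    fix t
    show "(\<Sum>m. f m t) = \<omega> t * H t"
    proof (cases "\<omega> t = 0")
      case False
      then show ?thesis
        using sums_mult[OF sums[OF False], of "\<omega> t"] by (simp add: f_def sums_iff mult.assoc)
    qed (simp add: f_def)
  qed
  finally show ?thesis .
qed

lemma integrable_arcw_shift: "integrable lborel (\<lambda>t. arcw (t - c))"
  using has_bochner_integral_arcw lborel_integrable_real_affine[of arcw 1 "- c"]
  by (simp add: has_bochner_integral_iff)

lemma integrable_corr_mixed:
  assumes "0 < c" "c \<noteq> 2"
  shows "integrable lborel (\<lambda>t. arcw (t - c) * coshw t)"
proof (rule integrableI_nonneg)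
  have "(\<integral>\<^sup>+t. ennreal (arcw (t - c) * coshw t) \<partial>lborel) = corr_mixed c"
    by (simp add: corr_mixed_def ennreal_mult')
  also have "\<dots> < \<infinity>"
    using corr_mixed_le[OF assms] by (auto simp: less_top[symmetric] top_unique)
  finally show "(\<integral>\<^sup>+t. ennreal (arcw (t - c) * coshw t) \<partial>lborel) < \<infinity>" .
qed auto

text \<open>With t = c + x the denominator is 2y(w - x), so the integral is a Stieltjes transform at
  w. The number 2c + 3 bounds 2|t| + 1 on the support |t - c| < 1; its product with y being below 1
  also forces w > 1.\<close>

lemma integral_generating_U:
  assumes c: "0 < c" and y: "0 < y" "(2 * c + 3) * y < 1"
  shows "(\<integral>t. arcw (t - c) * (y / (1 - 2 * t * y + y\<^sup>2)) \<partial>lborel)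
    = pi * y / sqrt ((1 + y\<^sup>2 - 2 * c * y)\<^sup>2 - (2 * y)\<^sup>2)"
proof -
  define w where "w = (1 + y\<^sup>2 - 2 * c * y) / (2 * y)"
  have cy: "2 * c * y + 3 * y < 1"
    using y by (simp add: algebra_simps)
  have w: "1 < w"
    unfolding w_def using y cy by (simp add: field_simps add_pos_nonneg) (smt (verit) zero_le_power2)
  have "(\<integral>t. arcw (t - c) * (y / (1 - 2 * t * y + y\<^sup>2)) \<partial>lborel)
     = (\<integral>x. arcw x * (y / (1 - 2 * (c + x) * y + y\<^sup>2)) \<partial>lborel)"
    by (subst lborel_integral_real_affine[where c = 1 and t = c]) simp_all
  also have "\<dots> = (\<integral>x. (1 / 2) * (arcw x / (w - x)) \<partial>lborel)"
  proof (intro Bochner_Integration.integral_cong refl)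
    fix x
    have "1 - 2 * (c + x) * y + y\<^sup>2 = (w - x) * (2 * y)"
      using y by (simp add: w_def field_simps)
    then show "arcw x * (y / (1 - 2 * (c + x) * y + y\<^sup>2)) = (1 / 2) * (arcw x / (w - x))"
      using y by simp
  qed
  also have "\<dots> = (1 / 2) * (pi / sqrt (w\<^sup>2 - 1))"
    using has_bochner_integral_arcw_resolvent[OF w]
    by (simp only: has_bochner_integral_iff integral_mult_right_zero)
  also have "w\<^sup>2 - 1 = ((1 + y\<^sup>2 - 2 * c * y)\<^sup>2 - (2 * y)\<^sup>2) / (2 * y)\<^sup>2"
    unfolding w_def power_divide diff_divide_distrib[of "(1 + y\<^sup>2 - 2 * c * y)\<^sup>2"] using y by simp
  finally show ?thesis
    using y by (simp add: real_sqrt_divide real_sqrt_mult)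
qed

text \<open>In the centred variable z = t - c/2 the reflection t -> c - t is z -> -z, so the
  difference of the two generating functions is odd in z. The factor z dz is half of d(z^2), and in
  the variable z^2 the elliptic weight turns into an arcsine weight: the integral is elementary and
  again a Stieltjes transform.\<close>

lemma integral_generating_T:
  assumes c: "0 < c" "c \<noteq> 2" and y: "0 < y" "(2 * c + 3) * y < 1"
  shows "(\<integral>t. (arcw (t - c) * coshw t) * ((1 - t * y) / (1 - 2 * t * y + y\<^sup>2) - (1 - (c - t) * y) / (1 - 2 * (c - t) * y + y\<^sup>2)) \<partial>lborel)
    = pi * y / sqrt ((1 + y\<^sup>2 - 2 * c * y)\<^sup>2 - (2 * y)\<^sup>2)" (is "integral\<^sup>L lborel ?F = _")
proof -
  define p where "p = \<bar>1 - c / 2\<bar>"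
  define q where "q = 1 + c / 2"
  \<comment> \<open>\<open>m\<close> is the midpoint and \<open>c\<close> the half-length of the
    interval from p^2 to q^2, whence the substitution z^2 = m + c x with x in (-1,1).\<close>
  define m where "m = 1 + c\<^sup>2 / 4"
  define B where "B = 1 + y\<^sup>2 - c * y"
  define \<Psi> where "\<Psi> t = y * (1 - y\<^sup>2) * (2 * t - c) / (B\<^sup>2 - y\<^sup>2 * (2 * t - c)\<^sup>2)" for t
  define D where "D = (1 - y\<^sup>2)\<^sup>2 - 2 * c * y * (1 + y\<^sup>2)"
  define w where "w = D / (4 * c * y\<^sup>2)"
  define g where "g x = sqrt (m + c * x)" for x
  \<comment> \<open>Cut off outside (p,q) so as to be nonnegative everywhere, which the change of
    variables asks for.\<close>
  define f where "f z = (if p < z \<and> z < q then 1 / sqrt ((q\<^sup>2 - z\<^sup>2) * (z\<^sup>2 - p\<^sup>2)) * \<Psi> (z + c / 2) else 0)" for z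
  have [measurable]: "g \<in> borel_measurable borel" "\<Psi> \<in> borel_measurable borel" "f \<in> borel_measurable borel"
    unfolding g_def \<Psi>_def f_def by measurable
  have p: "0 < p" "p < q" and p2: "p\<^sup>2 = m - c" and q2: "q\<^sup>2 = m + c"
    using c by (auto simp: p_def q_def m_def power2_eq_square field_simps)
  have cyp: "0 < c * y" and cy: "2 * (c * y) + 3 * y < 1"
    using y c by (simp_all add: algebra_simps)
  then have y1: "y < 1" using y by linarith
  then have y2: "y\<^sup>2 < 1"
    using y by (simp add: abs_square_less_1)
  have sub: "\<Psi> t = (1 - t * y) / (1 - 2 * t * y + y\<^sup>2) - (1 - (c - t) * y) / (1 - 2 * (c - t) * y + y\<^sup>2)"
    and \<Psi>_nonneg: "0 \<le> \<Psi> t" if t: "0 < 2 * t - c" "2 * t - c < c + 2" for t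
  proof -
    define d where "d = 2 * t - c"
    have yd: "0 < y * d" "y * d < c * y + 2 * y"
      using t y mult_strict_left_mono[of d "c + 2" y] by (auto simp: d_def algebra_simps)
    have pos: "0 < B - y * d" "0 < B + y * d"
      using yd cy cyp y unfolding B_def by (smt (verit) zero_le_power2)+
    have den: "1 - 2 * t * y + y\<^sup>2 = B - y * d" "1 - 2 * (c - t) * y + y\<^sup>2 = B + y * d"
      by (auto simp: B_def d_def algebra_simps)
    have num: "(1 - t * y) * (B + y * d) - (1 - (c - t) * y) * (B - y * d) = y * (1 - y\<^sup>2) * d"
      unfolding B_def d_def by algebra
    have prod: "(B - y * d) * (B + y * d) = B\<^sup>2 - y\<^sup>2 * d\<^sup>2"
      by algebra
    show "\<Psi> t = (1 - t * y) / (1 - 2 * t * y + y\<^sup>2) - (1 - (c - t) * y) / (1 - 2 * (c - t) * y + y\<^sup>2)"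
      unfolding den \<Psi>_def d_def[symmetric]
      using pos by (subst diff_frac_eq) (simp_all only: num prod less_irrefl simp_thms)
    show "0 \<le> \<Psi> t"
      unfolding \<Psi>_def d_def[symmetric] prod[symmetric]
      using pos y y2 t by (simp add: d_def)
  qed
  have supp: "0 < 2 * t - c" "2 * t - c < c + 2" if "arcw (t - c) * coshw t \<noteq> 0" for t
    using that by (auto simp: arcw_def coshw_def split: if_splits)
  have F: "?F t = arcw (t - c) * coshw t * \<Psi> t" for t
  proof (cases "arcw (t - c) * coshw t = 0")
    case False
    show ?thesis
      by (simp only: sub[OF supp[OF False]])
  qed (simp only: mult_zero_left)
  have img: "{p<..<q} = g ` {-1<..<1}"
  proof (intro set_eqI iffI)
    fix z assume z: "z \<in> {p<..<q}"
    then have "p\<^sup>2 < z\<^sup>2" "z\<^sup>2 < q\<^sup>2"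
      using p by (auto intro!: power_strict_mono)
    then have "(z\<^sup>2 - m) / c \<in> {-1<..<1}"
      using c unfolding p2 q2 by (auto simp: field_simps)
    moreover have "z = g ((z\<^sup>2 - m) / c)"
      using c z p by (simp add: g_def)
    ultimately show "z \<in> g ` {-1<..<1}" by blast
  next
    fix z assume "z \<in> g ` {-1<..<1}"
    then obtain x where x: "-1 < x" "x < 1" "z = sqrt (m + c * x)"
      by (auto simp: g_def)
    have "c * (-1) < c * x" "c * x < c * 1"
      using x c by (simp_all only: mult_less_cancel_left_pos)
    then have "p\<^sup>2 < m + c * x" "m + c * x < q\<^sup>2"
      unfolding p2 q2 by auto
    then show "z \<in> {p<..<q}"
      using x p by (auto intro!: real_less_rsqrt real_less_lsqrt)
  qed
  have gx: "p\<^sup>2 < m + c * x" "m + c * x < q\<^sup>2" "p < g x" "g x < q" "0 < g x" "(g x)\<^sup>2 = m + c * x" if "-1 < x" "x < 1" for x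
  proof -
    have "c * (-1) < c * x" "c * x < c * 1"
      using that c by (simp_all only: mult_less_cancel_left_pos)
    then show "p\<^sup>2 < m + c * x" "m + c * x < q\<^sup>2"
      unfolding p2 q2 by auto
    have "g x \<in> {p<..<q}"
      unfolding img using that by (intro imageI) simp
    then show "p < g x" "g x < q" "0 < g x" using p by simp_all
    show "(g x)\<^sup>2 = m + c * x"
      using \<open>p\<^sup>2 < m + c * x\<close> zero_le_power2[of p] unfolding g_def by (intro real_sqrt_pow2) linarith
  qed
  have f_nonneg: "0 \<le> f z" for z
  proof (cases "p < z \<and> z < q")
    case True
    then have "p\<^sup>2 < z\<^sup>2" "z\<^sup>2 < q\<^sup>2" "0 \<le> \<Psi> (z + c / 2)"
      using p by (auto intro!: power_strict_mono \<Psi>_nonneg simp: q_def)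
    then show ?thesis
      by (simp add: f_def)
  qed (auto simp: f_def)
  have wgt1: "(1 + y)\<^sup>2 * ((1 - y)\<^sup>2 - 2 * c * y) = D - 4 * c * y\<^sup>2"
    unfolding D_def by algebra
  have "0 < (1 + y)\<^sup>2 * ((1 - y)\<^sup>2 - 2 * c * y)"
  proof (rule mult_pos_pos)
    have "(1 - y)\<^sup>2 - 2 * c * y = 1 - 2 * y - 2 * (c * y) + y\<^sup>2"
      by (simp add: power2_eq_square algebra_simps)
    moreover have "0 \<le> y\<^sup>2" by simp
    ultimately show "0 < (1 - y)\<^sup>2 - 2 * c * y"
      using cy y by linarith
  qed (use y in simp)
  then have w: "1 < w"
    unfolding wgt1 w_def using c y by (simp add: field_simps)
  have nn: "(\<integral>\<^sup>+t. ennreal (?F t) \<partial>lborel) = ennreal ((1 - y\<^sup>2) / (4 * c * y) * (pi / sqrt (w\<^sup>2 - 1)))"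
  proof -
    have "(\<integral>\<^sup>+t. ennreal (?F t) \<partial>lborel)
       = (\<integral>\<^sup>+t. ennreal (arcw (t - c)) * ennreal (coshw t) * ennreal (\<Psi> t) \<partial>lborel)"
      unfolding F by (simp add: ennreal_mult' mult.assoc)
    also have "\<dots> = (\<integral>\<^sup>+z\<in>{p<..<q}. ennreal (1 / sqrt ((q\<^sup>2 - z\<^sup>2) * (z\<^sup>2 - p\<^sup>2))) * ennreal (\<Psi> (z + c / 2)) \<partial>lborel)"
      unfolding p_def q_def by (rule corr_mixed_eq[OF c(1)]) simp
    also have "\<dots> = (\<integral>\<^sup>+z\<in>{p<..<q}. ennreal (f z) \<partial>lborel)"
    proof (intro nn_integral_cong)
      fix z
      show "ennreal (1 / sqrt ((q\<^sup>2 - z\<^sup>2) * (z\<^sup>2 - p\<^sup>2))) * ennreal (\<Psi> (z + c / 2)) * indicator {p<..<q} z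
          = ennreal (f z) * indicator {p<..<q} z"
      proof (cases "z \<in> {p<..<q}")
        case True
        then have nonneg: "0 \<le> \<Psi> (z + c / 2)"
          using p by (intro \<Psi>_nonneg) (auto simp: q_def)
        have fz: "f z = 1 / sqrt ((q\<^sup>2 - z\<^sup>2) * (z\<^sup>2 - p\<^sup>2)) * \<Psi> (z + c / 2)"
          using True by (simp add: f_def)
        show ?thesis
          by (simp only: fz ennreal_mult''[OF nonneg])
      qed simp
    qed
    also have "\<dots> = (\<integral>\<^sup>+x\<in>{-1<..<1}. ennreal (\<bar>c / (2 * g x)\<bar> * f (g x)) \<partial>lborel)"
      unfolding img
    proof (rule nn_integral_change_of_variables[OF _ _ _ _ _ _ _ f_nonneg])
      show "g ` {-1<..<1} \<in> sets borel"
        unfolding img[symmetric] by simp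
      show "inj_on g {-1<..<1}"
        using c by (auto simp: inj_on_def g_def)
      fix x :: real assume x: "x \<in> {-1<..<1}"
      then have "0 < m + c * x"
        using gx(1)[of x] le_less_trans[OF zero_le_power2[of p]] by simp
      then show "(g has_real_derivative c / (2 * g x)) (at x)"
        unfolding g_def by (auto intro!: derivative_eq_intros simp: field_simps)
    qed auto
    also have "\<dots> = (\<integral>\<^sup>+x. ennreal ((1 - y\<^sup>2) / (4 * c * y) * (arcw x / (w - x))) \<partial>lborel)"
    proof (intro nn_integral_cong)
      fix x :: real
      show "ennreal (\<bar>c / (2 * g x)\<bar> * f (g x)) * indicator {-1<..<1} x = ennreal ((1 - y\<^sup>2) / (4 * c * y) * (arcw x / (w - x)))"
      proof (cases "x \<in> {-1<..<1}")
        case True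
        then have x: "-1 < x" "x < 1" by auto
        note g = gx[OF x]
        have x2: "0 < 1 - x\<^sup>2"
          using x by (simp add: abs_square_less_1)
        have "(q\<^sup>2 - (g x)\<^sup>2) * ((g x)\<^sup>2 - p\<^sup>2) = c\<^sup>2 * (1 - x\<^sup>2)"
          unfolding g(6) p2 q2 by algebra
        then have sq: "sqrt ((q\<^sup>2 - (g x)\<^sup>2) * ((g x)\<^sup>2 - p\<^sup>2)) = c * sqrt (1 - x\<^sup>2)"
          using c by (simp add: real_sqrt_mult)
        have den: "B\<^sup>2 - y\<^sup>2 * (2 * (g x + c / 2) - c)\<^sup>2 = 4 * c * y\<^sup>2 * (w - x)"
        proof -
          have "B\<^sup>2 - y\<^sup>2 * (2 * (g x + c / 2) - c)\<^sup>2 = B\<^sup>2 - 4 * y\<^sup>2 * (g x)\<^sup>2"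
            by (simp add: power_mult_distrib)
          also have "\<dots> = D - 4 * c * y\<^sup>2 * x"
            unfolding g(6) B_def D_def m_def by (simp add: power2_eq_square algebra_simps)
          also have "\<dots> = 4 * c * y\<^sup>2 * (w - x)"
            using c y by (simp add: w_def right_diff_distrib)
          finally show ?thesis .
        qed
        have "\<bar>c / (2 * g x)\<bar> * f (g x)
            = c / (2 * g x) * (1 / (c * sqrt (1 - x\<^sup>2)) * (y * (1 - y\<^sup>2) * (2 * g x) / (4 * c * y\<^sup>2 * (w - x))))"
          using g c unfolding f_def \<Psi>_def den sq by simp
        also have "\<dots> = (1 - y\<^sup>2) / (4 * c * y) * (1 / sqrt (1 - x\<^sup>2) / (w - x))"
        proof -
          have alg: "c / (2 * G) * (1 / (c * S) * (y * A * (2 * G) / (4 * c * y\<^sup>2 * W))) = A / (4 * c * y) * (1 / S / W)"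
            if "G \<noteq> 0" "S \<noteq> 0" "W \<noteq> 0" for A G S W
            using that c y by (simp add: field_simps power2_eq_square)
          show ?thesis
            by (rule alg) (use g(5) x2 w x in auto)
        qed
        also have "1 / sqrt (1 - x\<^sup>2) = arcw x"
          using x by (simp add: arcw_def)
        finally show ?thesis
          using True by simp
      qed (auto simp: arcw_def)
    qed
    also have "\<dots> = ennreal ((1 - y\<^sup>2) / (4 * c * y) * (pi / sqrt (w\<^sup>2 - 1)))"
    proof (rule nn_integral_eq_integral[THEN trans])
      show "integrable lborel (\<lambda>x. (1 - y\<^sup>2) / (4 * c * y) * (arcw x / (w - x)))"
        using has_bochner_integral_arcw_resolvent[OF w]
        by (intro integrable_mult_right) (simp add: has_bochner_integral_iff)
      have "0 \<le> arcw x / (w - x)" for x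
        using w by (cases "\<bar>x\<bar> < 1") (auto simp: arcw_zero)
      then show "AE x in lborel. 0 \<le> (1 - y\<^sup>2) / (4 * c * y) * (arcw x / (w - x))"
        using c y y2 by (intro AE_I2 mult_nonneg_nonneg) auto
      show "ennreal (\<integral>x. (1 - y\<^sup>2) / (4 * c * y) * (arcw x / (w - x)) \<partial>lborel) = ennreal ((1 - y\<^sup>2) / (4 * c * y) * (pi / sqrt (w\<^sup>2 - 1)))"
        using has_bochner_integral_arcw_resolvent[OF w]
        by (simp only: has_bochner_integral_iff integral_mult_right_zero)
    qed
    finally show ?thesis .
  qed
  have "has_bochner_integral lborel ?F ((1 - y\<^sup>2) / (4 * c * y) * (pi / sqrt (w\<^sup>2 - 1)))"
  proof (rule has_bochner_integral_nn_integral[OF _ _ _ nn])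
    show "AE t in lborel. 0 \<le> ?F t"
      unfolding F
    proof (intro AE_I2)
      fix t
      show "0 \<le> arcw (t - c) * coshw t * \<Psi> t"
      proof (cases "arcw (t - c) * coshw t = 0")
        case False
        show ?thesis
          by (intro mult_nonneg_nonneg arcw_nonneg coshw_nonneg \<Psi>_nonneg supp[OF False])
      qed (simp only: mult_zero_left order_refl)
    qed
    show "0 \<le> (1 - y\<^sup>2) / (4 * c * y) * (pi / sqrt (w\<^sup>2 - 1))"
      using c y y2 w by (intro mult_nonneg_nonneg divide_nonneg_nonneg) (auto simp: less_imp_le)
  qed (unfold F, measurable)
  moreover have "(1 - y\<^sup>2) / (4 * c * y) * (pi / sqrt (w\<^sup>2 - 1)) = pi * y / sqrt ((1 + y\<^sup>2 - 2 * c * y)\<^sup>2 - (2 * y)\<^sup>2)"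
  proof -
    have "w\<^sup>2 - 1 = (D\<^sup>2 - (4 * c * y\<^sup>2)\<^sup>2) / (4 * c * y\<^sup>2)\<^sup>2"
      unfolding w_def power_divide diff_divide_distrib[of "D\<^sup>2"] using c y by simp
    \<comment> \<open>The two sides meet here: D - 4cy^2 = (1+y)^2 ((1-y)^2 - 2cy) and D + 4cy^2 =
      (1-y)^2 ((1+y)^2 - 2cy), so that the radicand of the U side appears up to the square of 1 -
      y^2.\<close>
    also have "D\<^sup>2 - (4 * c * y\<^sup>2)\<^sup>2 = (1 - y\<^sup>2)\<^sup>2 * ((1 + y\<^sup>2 - 2 * c * y)\<^sup>2 - (2 * y)\<^sup>2)"
      unfolding D_def by algebra
    finally have "sqrt (w\<^sup>2 - 1) = (1 - y\<^sup>2) * sqrt ((1 + y\<^sup>2 - 2 * c * y)\<^sup>2 - (2 * y)\<^sup>2) / (4 * c * y\<^sup>2)"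
      using c y y2 by (simp add: real_sqrt_divide real_sqrt_mult)
    then show ?thesis
      using c y y2 by (simp add: power2_eq_square)
  qed
  ultimately show ?thesis
    by (simp add: has_bochner_integral_iff)
qed

text \<open>Both families in n have the same generating function for small positive y, so their
  coefficients agree.\<close>

lemma integral_cheb_exchange:
  assumes c: "0 < c" "c \<noteq> 2"
  shows "(\<integral>t. (arcw (t - c) * coshw t) * (cheb_T (Suc n) t - cheb_T (Suc n) (c - t)) \<partial>lborel)
    = (\<integral>t. arcw (t - c) * cheb_U n t \<partial>lborel)"
proof -
  define L where "L m = (\<integral>t. (arcw (t - c) * coshw t) * (cheb_T m t - cheb_T m (c - t)) \<partial>lborel)" for m
  \<comment> \<open>The shift aligns \<open>cheb_U k\<close> with \<open>cheb_T (Suc k)\<close>. The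
    coefficient at 0 is 0 because \<open>cheb_T 0\<close> is constant and cancels in the
    difference.\<close>
  define u where "u m t = (case m of 0 \<Rightarrow> 0 | Suc k \<Rightarrow> cheb_U k t)" for m t
  define V where "V m = (\<integral>t. arcw (t - c) * u m t \<partial>lborel)" for m
  define K where "K = 2 * c + 3"
  have um [measurable]: "u m \<in> borel_measurable borel" for m
    unfolding u_def by (cases m) auto
  have bd: "2 * \<bar>t\<bar> + 1 \<le> K" if "\<bar>t\<bar> \<le> c + 1" for t
    using that by (simp add: K_def)
  have supp: "\<bar>t\<bar> \<le> c + 1" "\<bar>c - t\<bar> \<le> c + 1" if "arcw (t - c) \<noteq> 0" for t
    using that c by (auto simp: arcw_def split: if_splits)
  have "L m - V m = 0" for m
  proof (rule powser_sums_zero_right_imp_zero[of "1 / K" "\<lambda>m. L m - V m"])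
    show "0 < 1 / K" using c by (simp add: K_def)
    fix y :: real assume y: "0 < y" "y < 1 / K"
    then have Ky: "K * y < 1"
      using c by (simp add: K_def field_simps)
    have small: "(2 * \<bar>t\<bar> + 1) * y < 1" if "\<bar>t\<bar> \<le> c + 1" for t
    proof -
      have "(2 * \<bar>t\<bar> + 1) * y \<le> K * y"
        using bd[OF that] y by (intro mult_right_mono) auto
      then show ?thesis using Ky by linarith
    qed
    have L: "(\<lambda>m. L m * y ^ m) sums (\<integral>t. (arcw (t - c) * coshw t) * ((1 - t * y) / (1 - 2 * t * y + y\<^sup>2) - (1 - (c - t) * y) / (1 - 2 * (c - t) * y + y\<^sup>2)) \<partial>lborel)"
      unfolding L_def
    proof (rule weighted_power_series_sums[OF integrable_corr_mixed[OF c]])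
      show "0 \<le> K" "0 \<le> y" "K * y < 1"
        using c y Ky by (auto simp: K_def)
      fix t assume "arcw (t - c) * coshw t \<noteq> 0"
      then have t: "\<bar>t\<bar> \<le> c + 1" "\<bar>c - t\<bar> \<le> c + 1"
        using supp[of t] by auto
      show "\<bar>cheb_T m t - cheb_T m (c - t)\<bar> \<le> 2 * K ^ m" for m
      proof -
        have "\<bar>cheb_T m t\<bar> \<le> K ^ m" "\<bar>cheb_T m (c - t)\<bar> \<le> K ^ m"
          using t by (auto intro!: order_trans[OF cheb_T_bound] power_mono bd)
        then show ?thesis by linarith
      qed
      show "(\<lambda>m. (cheb_T m t - cheb_T m (c - t)) * y ^ m) sums ((1 - t * y) / (1 - 2 * t * y + y\<^sup>2) - (1 - (c - t) * y) / (1 - 2 * (c - t) * y + y\<^sup>2))"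
        unfolding left_diff_distrib[of "cheb_T _ _"] using t y by (intro sums_diff cheb_T_sums small) auto
    qed auto
    have V: "(\<lambda>m. V m * y ^ m) sums (\<integral>t. arcw (t - c) * (y / (1 - 2 * t * y + y\<^sup>2)) \<partial>lborel)"
      unfolding V_def
    proof (rule weighted_power_series_sums[OF integrable_arcw_shift _ um])
      show "0 \<le> K" "0 \<le> y" "K * y < 1"
        using c y Ky by (auto simp: K_def)
      fix t assume "arcw (t - c) \<noteq> 0"
      then have t: "\<bar>t\<bar> \<le> c + 1"
        using supp[of t] by auto
      show "\<bar>u m t\<bar> \<le> 1 * K ^ m" for m
      proof (cases m)
        case (Suc k)
        have "\<bar>cheb_U k t\<bar> \<le> K ^ k"
          using t by (auto intro!: order_trans[OF cheb_U_bound] power_mono bd)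
        also have "\<dots> \<le> K ^ m"
          using c by (intro power_increasing) (auto simp: Suc K_def)
        finally show ?thesis
          by (simp add: Suc u_def)
      qed (simp add: u_def)
      have "(\<lambda>m. y * (cheb_U m t * y ^ m)) sums (y * (1 / (1 - 2 * t * y + y\<^sup>2)))"
        using t y by (intro sums_mult cheb_U_sums small) auto
      then have "(\<lambda>m. u (Suc m) t * y ^ Suc m) sums (y / (1 - 2 * t * y + y\<^sup>2))"
        by (simp add: u_def ac_simps)
      then show "(\<lambda>m. u m t * y ^ m) sums (y / (1 - 2 * t * y + y\<^sup>2))"
        by (subst (asm) sums_Suc_iff) (simp add: u_def)
    qed auto
    have Ky': "(2 * c + 3) * y < 1"
      using Ky by (simp only: K_def)
    show "(\<lambda>m. (L m - V m) * y ^ m) sums 0"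
      using sums_diff[OF L V]
      by (simp only: integral_generating_T[OF c y(1) Ky'] integral_generating_U[OF c(1) y(1) Ky']
          left_diff_distrib[of "L _"] diff_self)
  qed
  from this[of "Suc n"] show ?thesis
    by (simp add: L_def V_def u_def)
qed

section \<open>Apery numbers as moments of a three-step random walk\<close>

text \<open>The sum is the a-th finite difference of \<open>x choose r\<close> in x; by Pascal's
  rule each difference lowers the lower index by one.\<close>

lemma alternating_binomial_sum:
  "a \<le> r \<Longrightarrow> (\<Sum>i\<le>a. (- 1) ^ (a + i) * int (a choose i) * int ((x + i) choose r)) = int (x choose (r - a))"
proof (induction a arbitrary: x)
  case (Suc a)
  let ?g = "\<lambda>x i. (- 1) ^ (a + i) * int (a choose i) * int ((x + i) choose r)"
  have "(\<Sum>i\<le>Suc a. (- 1) ^ (Suc a + i) * int (Suc a choose i) * int ((x + i) choose r))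
      = - ((- 1) ^ a * int (x choose r)) + (\<Sum>i\<le>a. ?g (Suc x) i - (- 1) ^ (a + Suc i) * int (a choose Suc i) * int ((x + Suc i) choose r))"
    by (subst sum.atMost_Suc_shift) (simp add: algebra_simps)
  also have "\<dots> = (\<Sum>i\<le>a. ?g (Suc x) i) - (\<Sum>i\<le>Suc a. ?g x i)"
    by (subst sum.atMost_Suc_shift) (simp add: sum_subtractf sum.distrib sum_negf)
  also have "(\<Sum>i\<le>Suc a. ?g x i) = (\<Sum>i\<le>a. ?g x i)"
    by simp
  finally have "(\<Sum>i\<le>Suc a. (- 1) ^ (Suc a + i) * int (Suc a choose i) * int ((x + i) choose r))
      = int (Suc x choose (r - a)) - int (x choose (r - a))"
    using Suc.IH[of "Suc x"] Suc.IH[of x] Suc.prems by simp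
  also have "r - a = Suc (r - Suc a)"
    using Suc.prems by simp
  finally show ?case
    by simp
qed simp

text \<open>Even moments of the length of a three-step random walk in the plane.\<close>

definition walk_moment :: "nat \<Rightarrow> nat" where
  "walk_moment m = (\<Sum>j\<le>m. (m choose j)\<^sup>2 * ((2 * j) choose j))"

lemma binomial_product_shift:
  assumes "j \<le> m"
  shows "((n + m) choose m) * (m choose j) = ((n + j) choose j) * ((n + m) choose (n + j))"
proof -
  have "((n + m) choose (n + j)) * ((n + j) choose n) = ((n + m) choose n) * ((n + m - n) choose (n + j - n))"
    using assms by (intro choose_mult) auto
  moreover have "((n + j) choose n) = ((n + j) choose j)" "((n + m) choose n) = ((n + m) choose m)"
    using binomial_symmetric[of n "n + j"] binomial_symmetric[of n "n + m"] by simp_all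
  ultimately show ?thesis
    by (simp add: mult.commute)
qed

text \<open>After expanding \<open>walk_moment\<close> the sum over m is done first. Of the
  rearranged binomials only (n-j choose m-j)(n+m choose n+j) depends on m, and with its signs this
  is a finite difference of order n - j with value (n+j choose 2j).\<close>

lemma apery_eq_walk_moment_sum:
  "int (apery n) = (\<Sum>m\<le>n. (- 1) ^ (n + m) * int (n choose m) * int ((n + m) choose m) * int (walk_moment m))"
proof -
  let ?p = "\<lambda>j. int (n choose j) * int ((n + j) choose j)"
  let ?G = "\<lambda>m j. int ((2 * j) choose j) * ((- 1) ^ (n + m) * int (n choose m) * int ((n + m) choose m) * int ((m choose j)\<^sup>2))"
  have inner: "(\<Sum>m\<in>{j..n}. (- 1) ^ (n + m) * int (n choose m) * int ((n + m) choose m) * int ((m choose j)\<^sup>2))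
      = ?p j * int ((n + j) choose (2 * j))" if "j \<le> n" for j
  proof -
    have "(\<Sum>m\<in>{j..n}. (- 1) ^ (n + m) * int (n choose m) * int ((n + m) choose m) * int ((m choose j)\<^sup>2))
       = (\<Sum>m\<in>{j..n}. ?p j * ((- 1) ^ (n + m) * int ((n - j) choose (m - j)) * int ((n + m) choose (n + j))))"
    proof (intro sum.cong refl)
      fix m assume m: "m \<in> {j..n}"
      have "int (n choose m) * int (m choose j) = int (n choose j) * int ((n - j) choose (m - j))"
        using m choose_mult[of j m n] by (simp flip: of_nat_mult)
      moreover have "int ((n + m) choose m) * int (m choose j) = int ((n + j) choose j) * int ((n + m) choose (n + j))"
        using m binomial_product_shift[of j m n] by (simp flip: of_nat_mult)
      moreover have "(- 1) ^ (n + m) * int (n choose m) * int ((n + m) choose m) * int ((m choose j)\<^sup>2)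
        = (- 1) ^ (n + m) * (int (n choose m) * int (m choose j)) * (int ((n + m) choose m) * int (m choose j))"
        by (simp add: power2_eq_square)
      ultimately show "(- 1) ^ (n + m) * int (n choose m) * int ((n + m) choose m) * int ((m choose j)\<^sup>2)
        = ?p j * ((- 1) ^ (n + m) * int ((n - j) choose (m - j)) * int ((n + m) choose (n + j)))"
        by (simp add: ac_simps)
    qed
    also have "\<dots> = ?p j * (\<Sum>m\<in>{j..n}. (- 1) ^ (n + m) * int ((n - j) choose (m - j)) * int ((n + m) choose (n + j)))"
      by (simp add: sum_distrib_left)
    also have "(\<Sum>m\<in>{j..n}. (- 1) ^ (n + m) * int ((n - j) choose (m - j)) * int ((n + m) choose (n + j)))
       = (\<Sum>i\<le>n - j. (- 1) ^ (n - j + i) * int ((n - j) choose i) * int ((n + j + i) choose (n + j)))"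
    proof (rule sum.reindex_bij_witness[of _ "\<lambda>i. i + j" "\<lambda>m. m - j"])
      fix m assume m: "m \<in> {j..n}"
      then have "n + m = 2 * j + (n - j + (m - j))"
        by simp
      then have "(- 1 :: int) ^ (n + m) = (- 1) ^ (n - j + (m - j))"
        by (simp only: power_add power_mult) simp
      moreover have "n + j + (m - j) = n + m"
        using m by simp
      ultimately show "(- 1) ^ (n - j + (m - j)) * int ((n - j) choose (m - j)) * int ((n + j + (m - j)) choose (n + j))
        = (- 1) ^ (n + m) * int ((n - j) choose (m - j)) * int ((n + m) choose (n + j))"
        by simp
    qed (use that in auto)
    also have "\<dots> = int ((n + j) choose (n + j - (n - j)))"
      by (rule alternating_binomial_sum) simp
    also have "n + j - (n - j) = 2 * j"
      using that by simp
    finally show ?thesis .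
  qed
  have "(\<Sum>m\<le>n. (- 1) ^ (n + m) * int (n choose m) * int ((n + m) choose m) * int (walk_moment m))
     = (\<Sum>m\<le>n. \<Sum>j\<le>m. ?G m j)"
    by (simp add: walk_moment_def sum_distrib_left ac_simps)
  also have "\<dots> = (\<Sum>m\<le>n. \<Sum>j\<in>{j \<in> {..n}. j \<le> m}. ?G m j)"
    by (intro sum.cong) auto
  also have "\<dots> = (\<Sum>j\<le>n. \<Sum>m\<in>{m \<in> {..n}. j \<le> m}. ?G m j)"
    by (rule sum.swap_restrict) auto
  also have "\<dots> = (\<Sum>j\<le>n. \<Sum>m\<in>{j..n}. ?G m j)"
    by (intro sum.cong) auto
  also have "\<dots> = (\<Sum>j\<le>n. int ((2 * j) choose j) * (?p j * int ((n + j) choose (2 * j))))"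
  proof (intro sum.cong refl)
    fix j assume "j \<in> {..n}"
    then show "(\<Sum>m\<in>{j..n}. ?G m j) = int ((2 * j) choose j) * (?p j * int ((n + j) choose (2 * j)))"
      by (simp only: inner atMost_iff sum_distrib_left[symmetric])
  qed
  also have "\<dots> = (\<Sum>j\<le>n. int ((n choose j)\<^sup>2 * ((n + j) choose j)\<^sup>2))"
  proof (intro sum.cong refl)
    fix j assume "j \<in> {..n}"
    then have "((n + j) choose (2 * j)) * ((2 * j) choose j) = ((n + j) choose j) * (n choose j)"
      using choose_mult[of j "2 * j" "n + j"] by simp
    then have "int ((2 * j) choose j) * int ((n + j) choose (2 * j)) = ?p j"
      by (simp add: mult.commute flip: of_nat_mult)
    then show "int ((2 * j) choose j) * (?p j * int ((n + j) choose (2 * j))) = int ((n choose j)\<^sup>2 * ((n + j) choose j)\<^sup>2)"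
      by (simp add: power2_eq_square algebra_simps)
  qed
  also have "\<dots> = int (apery n)"
    by (simp add: apery_def atLeast0AtMost)
  finally show ?thesis ..
qed

text \<open>The upper limit may be any \<open>N\<close> beyond n, because the binomials vanish for m
  > n. This freedom lets the sums in the recurrence be taken with the lengths that match after an
  index shift.\<close>

lemma cheb_U_expand:
  "n < N \<Longrightarrow> cheb_U (2 * n) x = (\<Sum>m<N. (- 1) ^ (n + m) * real ((n + m) choose (2 * m)) * (2 * x) ^ (2 * m))"
  "n < N \<Longrightarrow> cheb_U (Suc (2 * n)) x = (\<Sum>m<N. (- 1) ^ (n + m) * real (Suc (n + m) choose Suc (2 * m)) * (2 * x) ^ Suc (2 * m))"
proof (induction n arbitrary: N)
  case 0
  {
    case 1
    then obtain M where N: "N = Suc M" by (cases N) auto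
    have "(\<Sum>m<N. (- 1) ^ (0 + m) * real ((0 + m) choose (2 * m)) * (2 * x) ^ (2 * m)) = 1"
      unfolding N sum.lessThan_Suc_shift by (simp add: binomial_eq_0 del: binomial_Suc_Suc)
    then show ?case by simp
  next
    case 2
    then obtain M where N: "N = Suc M" by (cases N) auto
    have "(\<Sum>m<N. (- 1) ^ (0 + m) * real (Suc (0 + m) choose Suc (2 * m)) * (2 * x) ^ Suc (2 * m)) = 2 * x"
      unfolding N sum.lessThan_Suc_shift by (simp add: binomial_eq_0 del: binomial_Suc_Suc)
    then show ?case by simp
  }
next
  case (Suc n)
  have even: "cheb_U (2 * Suc n) x = (\<Sum>m<N. (- 1) ^ (Suc n + m) * real ((Suc n + m) choose (2 * m)) * (2 * x) ^ (2 * m))"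
    if "Suc n < N" for N
  proof -
    obtain M where N: "N = Suc M" and M: "n < M" using \<open>Suc n < N\<close> by (cases N) auto
    have "cheb_U (2 * Suc n) x = 2 * x * cheb_U (Suc (2 * n)) x - cheb_U (2 * n) x"
      by simp
    also have "\<dots> = 2 * x * (\<Sum>m<M. (- 1) ^ (n + m) * real (Suc (n + m) choose Suc (2 * m)) * (2 * x) ^ Suc (2 * m))
        - (\<Sum>m<Suc M. (- 1) ^ (n + m) * real ((n + m) choose (2 * m)) * (2 * x) ^ (2 * m))"
      using M Suc.IH(1)[of "Suc M"] Suc.IH(2)[of M] by simp
    also have "\<dots> = (\<Sum>m<Suc M. (- 1) ^ (Suc n + m) * real ((Suc n + m) choose (2 * m)) * (2 * x) ^ (2 * m))"
      unfolding sum.lessThan_Suc_shift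
      by (simp add: sum_distrib_left sum_subtractf[symmetric] sum_negf[symmetric] algebra_simps del: sum_negf)
    finally show ?thesis
      unfolding N .
  qed
  {
    case 1
    then show ?case by (rule even)
  next
    case 2
    have "cheb_U (Suc (2 * Suc n)) x = 2 * x * cheb_U (2 * Suc n) x - cheb_U (Suc (2 * n)) x"
      by simp
    also have "\<dots> = 2 * x * (\<Sum>m<N. (- 1) ^ (Suc n + m) * real ((Suc n + m) choose (2 * m)) * (2 * x) ^ (2 * m))
        - (\<Sum>m<N. (- 1) ^ (n + m) * real (Suc (n + m) choose Suc (2 * m)) * (2 * x) ^ Suc (2 * m))"
      using 2 even[of N] Suc.IH(2)[of N] by (simp del: cheb_U.simps mult_Suc_right)
    also have "\<dots> = (\<Sum>m<N. (- 1) ^ (Suc n + m) * real (Suc (Suc n + m) choose Suc (2 * m)) * (2 * x) ^ Suc (2 * m))"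
      unfolding sum_distrib_left sum_subtractf[symmetric]
      by (intro sum.cong refl) (simp add: algebra_simps)
    finally show ?case .
  }
qed

text \<open>The k-th moment of 2 cos u for a uniform angle u, equivalently the constant term of (x +
  1/x)^k.\<close>

definition central :: "nat \<Rightarrow> nat" where
  "central k = (if even k then k choose (k div 2) else 0)"

lemma central_even [simp]: "central (2 * k) = (2 * k) choose k"
  and central_odd [simp]: "odd k \<Longrightarrow> central k = 0"
  by (auto simp: central_def)

lemma sum_even_support:
  fixes f :: "nat \<Rightarrow> nat"
  assumes "\<And>l. odd l \<Longrightarrow> f l = 0"
  shows "(\<Sum>l\<le>2 * m. f l) = (\<Sum>l\<le>m. f (2 * l))"
  using assms by (induction m) auto

text \<open>Both sides equal (2i)! / (l!^2 (i-l)!^2).\<close>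

lemma binomial_even_product:
  assumes "l \<le> i"
  shows "((2 * i) choose (2 * l)) * ((2 * l) choose l) * ((2 * i - 2 * l) choose (i - l)) = ((2 * i) choose i) * (i choose l)\<^sup>2"
proof -
  have e: "2 * i - 2 * l - (i - l) = i - l" using assms by simp
  have "real (((2 * i) choose (2 * l)) * ((2 * l) choose l) * ((2 * i - 2 * l) choose (i - l))) = real (((2 * i) choose i) * (i choose l)\<^sup>2)"
    using assms by (simp add: binomial_fact e power2_eq_square)
  then show ?thesis
    by (simp only: of_nat_eq_iff)
qed

text \<open>The left side is the k-th moment of 2 cos u + 2 cos v. For even k,
  \<open>binomial_even_product\<close> extracts a central binomial coefficient and leaves the sum of
  squared binomials, which is that coefficient again.\<close>

lemma central_convolution:
  "(\<Sum>l\<le>k. (k choose l) * central l * central (k - l)) = (if even k then (k choose (k div 2))\<^sup>2 else 0)"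
proof (cases "even k")
  case True
  then obtain i where k: "k = 2 * i" by blast
  have "(\<Sum>l\<le>k. (k choose l) * central l * central (k - l)) = (\<Sum>l\<le>i. (k choose (2 * l)) * central (2 * l) * central (k - 2 * l))"
    unfolding k by (rule sum_even_support) simp
  also have "\<dots> = (\<Sum>l\<le>i. ((2 * i) choose i) * (i choose l)\<^sup>2)"
  proof (intro sum.cong refl)
    fix l assume "l \<in> {..i}"
    then have "l \<le> i" by simp
    have "central (k - 2 * l) = (2 * i - 2 * l) choose (i - l)"
      using central_even[of "i - l"] by (simp add: k diff_mult_distrib2 del: central_even)
    then show "(k choose (2 * l)) * central (2 * l) * central (k - 2 * l) = ((2 * i) choose i) * (i choose l)\<^sup>2"
      using binomial_even_product[OF \<open>l \<le> i\<close>] by (simp add: k)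
  qed
  also have "\<dots> = ((2 * i) choose i)\<^sup>2"
    using choose_square_sum[of i] by (simp add: power2_eq_square flip: sum_distrib_left)
  finally show ?thesis
    by (simp add: k)
next
  case False
  then have "(k choose l) * central l * central (k - l) = 0" if "l \<le> k" for l
    using that by (cases "even l") auto
  then show ?thesis
    using False by simp
qed

text \<open>The moment of order 2m of the sum of three independent terms 2 cos u; the inner sum is
  the moment of two of them.\<close>

lemma central_convolution3:
  "(\<Sum>i\<le>2 * m. ((2 * m) choose i) * (\<Sum>l\<le>i. (i choose l) * central l * central (i - l)) * central (2 * m - i))
    = ((2 * m) choose m) * walk_moment m"
proof -
  have "(\<Sum>i\<le>2 * m. ((2 * m) choose i) * (\<Sum>l\<le>i. (i choose l) * central l * central (i - l)) * central (2 * m - i))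
    = (\<Sum>i\<le>m. ((2 * m) choose (2 * i)) * ((2 * i) choose i)\<^sup>2 * central (2 * m - 2 * i))"
    unfolding central_convolution by (subst sum_even_support) auto
  also have "\<dots> = (\<Sum>i\<le>m. ((2 * m) choose m) * ((m choose i)\<^sup>2 * ((2 * i) choose i)))"
  proof (intro sum.cong refl)
    fix i assume "i \<in> {..m}"
    then have "i \<le> m" by simp
    have "central (2 * m - 2 * i) = (2 * m - 2 * i) choose (m - i)"
      using central_even[of "m - i"] by (simp add: diff_mult_distrib2 del: central_even)
    then have "((2 * m) choose (2 * i)) * ((2 * i) choose i)\<^sup>2 * central (2 * m - 2 * i)
        = (((2 * m) choose (2 * i)) * ((2 * i) choose i) * ((2 * m - 2 * i) choose (m - i))) * ((2 * i) choose i)"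
      by (simp add: power2_eq_square)
    then show "((2 * m) choose (2 * i)) * ((2 * i) choose i)\<^sup>2 * central (2 * m - 2 * i) = ((2 * m) choose m) * ((m choose i)\<^sup>2 * ((2 * i) choose i))"
      unfolding binomial_even_product[OF \<open>i \<le> m\<close>] by simp
  qed
  finally show ?thesis
    by (simp add: walk_moment_def sum_distrib_left)
qed

lemma integrable_arcw_power: "integrable lborel (\<lambda>t. arcw t * t ^ k)"
proof (rule Bochner_Integration.integrable_bound)
  show "integrable lborel arcw"
    using has_bochner_integral_arcw by (simp add: has_bochner_integral_iff)
  have "\<bar>arcw t * t ^ k\<bar> \<le> \<bar>arcw t\<bar>" for t
  proof (cases "\<bar>t\<bar> < 1")
    case True
    then have "\<bar>t\<bar> ^ k \<le> 1"
      by (intro power_le_one) auto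
    then show ?thesis
      by (simp add: abs_mult power_abs mult_left_le)
  qed (simp add: arcw_zero)
  then show "AE t in lborel. norm (arcw t * t ^ k) \<le> norm (arcw t)"
    by simp
qed measurable

text \<open>The integral of the derivative of t^(k+1) sqrt(1 - t^2) over (-1,1) is zero, since that
  function vanishes at both ends.\<close>

lemma arcw_moment_rec:
  "real (k + 2) * (\<integral>t. arcw t * t ^ (k + 2) \<partial>lborel) = real (k + 1) * (\<integral>t. arcw t * t ^ k \<partial>lborel)"
proof -
  define f where "f t = (real (k + 1) * t ^ k - real (k + 2) * t ^ (k + 2)) / sqrt (1 - t\<^sup>2)" for t :: real
  define F where "F t = t ^ (k + 1) * sqrt (1 - t\<^sup>2)" for t :: real
  have eq: "indicator (einterval (ereal (-1)) (ereal 1)) t *\<^sub>R f t = real (k + 1) * (arcw t * t ^ k) - real (k + 2) * (arcw t * t ^ (k + 2))" for t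
    by (auto simp: f_def arcw_def einterval_def diff_divide_distrib split: split_indicator)
  have cont: "continuous_on {-1..1} F"
    unfolding F_def by (intro continuous_intros)
  have "F (-1) = 0" "F 1 = 0"
    by (simp_all add: F_def)
  then have lim: "(F \<longlongrightarrow> 0) (at_right (-1))" "(F \<longlongrightarrow> 0) (at_left 1)"
    using continuous_on_Icc_at_rightD[OF cont] continuous_on_Icc_at_leftD[OF cont] by auto
  have "(LBINT t=ereal (-1)..ereal 1. f t) = 0 - 0"
  proof (rule interval_integral_FTC_integrable)
    show "((F \<circ> real_of_ereal) \<longlongrightarrow> 0) (at_right (ereal (-1)))" "((F \<circ> real_of_ereal) \<longlongrightarrow> 0) (at_left (ereal 1))"
      using lim by (auto simp: at_right_ereal at_left_ereal filterlim_filtermap)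
    show "set_integrable lborel (einterval (ereal (-1)) (ereal 1)) f"
      unfolding set_integrable_def eq
      by (intro Bochner_Integration.integrable_diff integrable_mult_right integrable_arcw_power)
    fix t assume "ereal (-1) < ereal t" "ereal t < ereal 1"
    then have t: "0 < 1 - t\<^sup>2"
      by (simp add: abs_square_less_1)
    then show "isCont f t"
      unfolding f_def by (intro continuous_intros) auto
    have d1: "((\<lambda>t. t ^ (k + 1)) has_real_derivative real (k + 1) * t ^ k) (at t)"
      using DERIV_pow[of "k + 1" t] by simp
    have d2: "((\<lambda>t. sqrt (1 - t\<^sup>2)) has_real_derivative - t / sqrt (1 - t\<^sup>2)) (at t)"
      using t by (auto intro!: derivative_eq_intros simp: field_simps)
    have "(F has_real_derivative (real (k + 1) * t ^ k * sqrt (1 - t\<^sup>2) + t ^ (k + 1) * (- t / sqrt (1 - t\<^sup>2)))) (at t)"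
      using DERIV_mult[OF d1 d2] unfolding F_def[abs_def] by (simp only: mult.commute[of "t ^ (k + 1)"])
    also have "real (k + 1) * t ^ k * sqrt (1 - t\<^sup>2) + t ^ (k + 1) * (- t / sqrt (1 - t\<^sup>2))
       = (real (k + 1) * t ^ k * (sqrt (1 - t\<^sup>2))\<^sup>2 - t ^ (k + 2)) / sqrt (1 - t\<^sup>2)"
    proof -
      have "A * s + B * (- t / s) = (A * s\<^sup>2 - B * t) / s" if "0 < s" for A B s :: real
        using that by (simp add: field_simps power2_eq_square)
      from this[of "sqrt (1 - t\<^sup>2)" "real (k + 1) * t ^ k" "t ^ (k + 1)"] show ?thesis
        using t by (simp add: mult.commute[of t])
    qed
    also have "\<dots> = f t"
      using t by (simp add: f_def) (simp add: algebra_simps power2_eq_square)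
    finally show "(F has_vector_derivative f t) (at t)"
      by (simp add: has_real_derivative_iff_has_vector_derivative)
  qed simp
  then have "(\<integral>t. real (k + 1) * (arcw t * t ^ k) - real (k + 2) * (arcw t * t ^ (k + 2)) \<partial>lborel) = 0"
    by (simp add: interval_lebesgue_integral_def set_lebesgue_integral_def eq[simplified] flip: eq)
  moreover have i: "integrable lborel (\<lambda>t. real (k + 1) * (arcw t * t ^ k))"
      "integrable lborel (\<lambda>t. real (k + 2) * (arcw t * t ^ (k + 2)))"
    by (intro integrable_mult_right integrable_arcw_power)+
  ultimately show ?thesis
    by (simp only: Bochner_Integration.integral_diff[OF i] integral_mult_right_zero eq_iff_diff_eq_0[symmetric])
qed

lemma arcw_moment: "(\<integral>t. arcw t * (2 * t) ^ k \<partial>lborel) = pi * real (central k)"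
proof (induction k rule: induct_nat_012)
  case 0
  show ?case
    using has_bochner_integral_arcw by (simp add: has_bochner_integral_iff central_def)
next
  case 1
  have "(\<integral>t. arcw t * (2 * t) \<partial>lborel) = - (\<integral>t. arcw t * (2 * t) \<partial>lborel)"
    using lborel_integral_real_affine[of "-1" "\<lambda>t. arcw t * (2 * t)" 0] by simp
  then show ?case by (simp add: central_def)
next
  case (ge2 k)
  have eq: "(\<integral>t. arcw t * (2 * t) ^ j \<partial>lborel) = 2 ^ j * (\<integral>t. arcw t * t ^ j \<partial>lborel)" for j
    unfolding integral_mult_right_zero[symmetric]
    by (intro Bochner_Integration.integral_cong refl) (simp add: power_mult_distrib)
  have "real (k + 2) * (\<integral>t. arcw t * (2 * t) ^ Suc (Suc k) \<partial>lborel) = 4 * 2 ^ k * (real (k + 2) * (\<integral>t. arcw t * t ^ (k + 2) \<partial>lborel))"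
    unfolding eq by simp
  also have "\<dots> = 4 * (real (k + 1) * (\<integral>t. arcw t * (2 * t) ^ k \<partial>lborel))"
    unfolding arcw_moment_rec eq by simp
  also have "\<dots> = pi * (4 * real (k + 1) * real (central k))"
    unfolding ge2 by simp
  also have "4 * real (k + 1) * real (central k) = real (k + 2) * real (central (Suc (Suc k)))"
  proof (cases "even k")
    case True
    then obtain i where k: "k = 2 * i" by blast
    have "Suc i * ((2 * Suc i) choose Suc i) = (2 * (2 * i + 1)) * ((2 * i) choose i)"
    proof -
      have "Suc i * (Suc (Suc (2 * i)) choose Suc i) = Suc (Suc (2 * i)) * (Suc (2 * i) choose i)"
        by (rule Suc_times_binomial)
      moreover have "Suc i * (Suc (2 * i) choose Suc i) = Suc (2 * i) * ((2 * i) choose i)"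
        by (rule Suc_times_binomial)
      moreover have "Suc (2 * i) choose Suc i = Suc (2 * i) choose i"
        using binomial_symmetric[of i "Suc (2 * i)"] by simp
      ultimately have "Suc i * (Suc i * (Suc (Suc (2 * i)) choose Suc i)) = Suc (Suc (2 * i)) * (Suc (2 * i) * ((2 * i) choose i))"
        by (simp only: mult.left_commute[of "Suc i" "Suc (Suc (2 * i))"])
      then have "Suc i * (Suc i * (Suc (Suc (2 * i)) choose Suc i)) = Suc i * (2 * (2 * i + 1) * ((2 * i) choose i))"
        by (simp del: binomial_Suc_Suc)
      then show ?thesis
        unfolding mult_cancel1 by (simp del: binomial_Suc_Suc)
    qed
    then have "real (Suc i * ((2 * Suc i) choose Suc i)) = real ((2 * (2 * i + 1)) * ((2 * i) choose i))"
      by (rule arg_cong)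
    then have "real (Suc i) * real ((2 * Suc i) choose Suc i) = (2 * (2 * real i + 1)) * real ((2 * i) choose i)"
      by (simp only: of_nat_mult of_nat_add of_nat_numeral of_nat_1)
    moreover have "central (Suc (Suc k)) = (2 * Suc i) choose Suc i"
      using central_even[of "Suc i"] by (simp add: k)
    moreover have "4 * real (k + 1) * real (central k) = 2 * ((2 * (2 * real i + 1)) * real ((2 * i) choose i))"
      by (simp add: k)
    moreover have "real (k + 2) = 2 * real (Suc i)"
      by (simp add: k)
    ultimately show ?thesis
      by (simp only: mult.assoc)
  qed simp
  finally show ?case
    by simp
qed

section \<open>The laws of one, two and three cosines, left unnormalised\<close>

definition arc_measure :: "real measure" where
  "arc_measure = density lborel (\<lambda>x. ennreal (arcw x))"

definition arc_sum_measure :: "real measure" where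
  "arc_sum_measure = density lborel conv_arc"

lemma sets_arc_measure [simp, measurable_cong]:
  "sets arc_measure = sets borel" "sets arc_sum_measure = sets borel"
  by (simp_all add: arc_measure_def arc_sum_measure_def)

lemma space_arc_measure [simp]: "space arc_measure = UNIV" "space arc_sum_measure = UNIV"
  by (simp_all add: arc_measure_def arc_sum_measure_def)

lemma finite_measure_arc_measure: "finite_measure arc_measure"
proof
  have "emeasure arc_measure (space arc_measure) = (\<integral>\<^sup>+x. ennreal (arcw x) \<partial>lborel)"
    by (simp add: arc_measure_def emeasure_density)
  also have "\<dots> = ennreal pi"
    using has_bochner_integral_arcw by (simp add: has_bochner_integral_iff nn_integral_eq_integral)
  finally show "emeasure arc_measure (space arc_measure) \<noteq> \<infinity>"
    by simp
qed

lemma AE_arc_measure: "AE x in arc_measure. \<bar>x\<bar> < 1"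
  unfolding arc_measure_def by (subst AE_density) (auto simp: arcw_def)

lemma integral_arc_measure:
  fixes f :: "real \<Rightarrow> real"
  assumes [measurable]: "f \<in> borel_measurable borel"
  shows "integral\<^sup>L arc_measure f = (\<integral>x. arcw x * f x \<partial>lborel)"
  unfolding arc_measure_def by (subst integral_density) auto

lemma integrable_arc_measure_power: "integrable arc_measure (\<lambda>x. (2 * x) ^ k)"
proof -
  interpret finite_measure arc_measure by (rule finite_measure_arc_measure)
  show ?thesis
  proof (rule integrable_const_bound)
    show "AE x in arc_measure. norm ((2 * x) ^ k) \<le> 2 ^ k"
      using AE_arc_measure
    proof eventually_elim
      case (elim x)
      then have "\<bar>2 * x\<bar> ^ k \<le> 2 ^ k"
        by (intro power_mono) auto
      then show ?case by (simp only: real_norm_def power_abs)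
    qed
  qed measurable
qed

lemma integral_arc_measure_power: "(\<integral>x. (2 * x) ^ k \<partial>arc_measure) = pi * real (central k)"
  by (subst integral_arc_measure, measurable) (rule arcw_moment)

lemma arc_sum_measure_eq_convolution: "arc_sum_measure = convolution arc_measure arc_measure"
  unfolding arc_sum_measure_def arc_measure_def conv_arc_def
  using finite_measure_arc_measure
  by (subst convolution_density) (auto simp: arc_measure_def)

lemma
  shows integrable_arc_sum_measure_power: "integrable arc_sum_measure (\<lambda>c. (2 * c) ^ k)"
    and integral_arc_sum_measure_power: "(\<integral>c. (2 * c) ^ k \<partial>arc_sum_measure) = pi\<^sup>2 * real (\<Sum>l\<le>k. (k choose l) * central l * central (k - l))"
proof -
  let ?M = "arc_measure"
  interpret finite_measure ?M by (rule finite_measure_arc_measure)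
  interpret pair_sigma_finite ?M ?M ..
  define f where "f l m p = (2 * fst p) ^ l * (2 * snd p) ^ m" for l m and p :: "real \<times> real"
  have [measurable]: "f l m \<in> borel_measurable (?M \<Otimes>\<^sub>M ?M)" for l m
    unfolding f_def by measurable
  have i: "integrable (?M \<Otimes>\<^sub>M ?M) (f l m)" for l m
  proof (rule Fubini_integrable)
    show "integrable ?M (\<lambda>x. \<integral>y. norm (f l m (x, y)) \<partial>?M)"
      unfolding f_def fst_conv snd_conv real_norm_def abs_mult integral_mult_right_zero
      by (intro integrable_mult_left integrable_abs integrable_arc_measure_power)
    show "AE x in ?M. integrable ?M (\<lambda>y. f l m (x, y))"
      unfolding f_def fst_conv snd_conv
      by (intro AE_I2 integrable_mult_right integrable_arc_measure_power)
  qed measurable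
  have v: "(\<integral>p. f l m p \<partial>(?M \<Otimes>\<^sub>M ?M)) = pi\<^sup>2 * (real (central l) * real (central m))" for l m
  proof -
    have "(\<integral>p. f l m p \<partial>(?M \<Otimes>\<^sub>M ?M)) = (\<integral>x. (\<integral>y. f l m (x, y) \<partial>?M) \<partial>?M)"
      by (rule integral_fst'[OF i, symmetric])
    then show ?thesis
      unfolding f_def fst_conv snd_conv integral_mult_right_zero integral_mult_left_zero integral_arc_measure_power
      by (simp add: power2_eq_square)
  qed
  have e: "(2 * (case p of (x, y) \<Rightarrow> x + y)) ^ k = (\<Sum>l\<le>k. real (k choose l) * f l (k - l) p)" for p :: "real \<times> real"
    by (cases p) (simp add: f_def distrib_left binomial_ring mult.assoc)
  have g: "(\<lambda>(x, y). x + y) \<in> ?M \<Otimes>\<^sub>M ?M \<rightarrow>\<^sub>M (borel :: real measure)"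
    by measurable
  show "integrable arc_sum_measure (\<lambda>c. (2 * c) ^ k)"
    unfolding arc_sum_measure_eq_convolution convolution_def
    by (subst integrable_distr_eq[OF g], measurable, unfold e)
      (intro Bochner_Integration.integrable_sum integrable_mult_right i)
  show "(\<integral>c. (2 * c) ^ k \<partial>arc_sum_measure) = pi\<^sup>2 * real (\<Sum>l\<le>k. (k choose l) * central l * central (k - l))"
    unfolding arc_sum_measure_eq_convolution convolution_def
    by (subst integral_distr[OF g], measurable, unfold e) (simp add: i v sum_distrib_left ac_simps)
qed

text \<open>This adds the third cosine, again with mass pi. The weight is centred at c instead of
  shifting f, so that t is the value of the full sum and c that of two terms.\<close>

definition arc_average :: "(real \<Rightarrow> real) \<Rightarrow> real \<Rightarrow> real" where
  "arc_average f c = (\<integral>t. arcw (t - c) * f t \<partial>lborel)"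

lemma arc_average_shift: "arc_average f c = (\<integral>t. arcw t * f (c + t) \<partial>lborel)"
  unfolding arc_average_def
  by (subst lborel_integral_real_affine[where c = 1 and t = c]) simp_all

lemma arc_average_minus:
  assumes "\<And>t. f (- t) = f t"
  shows "arc_average f (- c) = arc_average f c"
proof -
  have "arc_average f (- c) = (\<integral>t. arcw (- t) * f (- c + - t) \<partial>lborel)"
    unfolding arc_average_shift
    by (subst lborel_integral_real_affine[where c = "-1" and t = 0]) simp_all
  also have "\<dots> = arc_average f c"
    unfolding arc_average_shift using assms[of "c + t" for t] by simp
  finally show ?thesis .
qed

lemma measurable_arc_average [measurable]:
  assumes [measurable]: "f \<in> borel_measurable borel"
  shows "arc_average f \<in> borel_measurable borel"
  unfolding arc_average_def by measurable

text \<open>The mean of U_{2n} over the three-cosine law, which has mass pi^3. The expansion of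
  U_{2n} contributes (n+m choose 2m), the moment of order 2m contributes (2m choose m); their
  product (n+m choose m)(n choose m) is the coefficient in
  \<open>apery_eq_walk_moment_sum\<close>.\<close>

lemma
  shows integrable_arc_average_cheb_U: "integrable arc_sum_measure (arc_average (cheb_U (2 * n)))"
    and integral_arc_average_cheb_U: "(\<integral>c. arc_average (cheb_U (2 * n)) c \<partial>arc_sum_measure) = pi ^ 3 * real (apery n)"
proof -
  define b where "b m = (- 1) ^ (n + m) * real ((n + m) choose (2 * m))" for m
  define \<mu> where "\<mu> m c = (\<Sum>i\<le>2 * m. real ((2 * m) choose i) * (2 * c) ^ i * (pi * real (central (2 * m - i))))" for m c
  have expand: "cheb_U (2 * n) x = (\<Sum>m\<le>n. b m * (2 * x) ^ (2 * m))" for x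
    using cheb_U_expand(1)[of n "Suc n" x] by (simp add: b_def lessThan_Suc_atMost)
  have \<mu>: "has_bochner_integral lborel (\<lambda>t. arcw t * (2 * (c + t)) ^ (2 * m)) (\<mu> m c)" for m c
  proof -
    have "has_bochner_integral lborel (\<lambda>t. arcw t * (2 * t) ^ j) (pi * real (central j))" for j
      using arcw_moment[of j] integrable_mult_right[OF integrable_arcw_power[of j], of "2 ^ j"]
      by (simp add: has_bochner_integral_iff power_mult_distrib ac_simps)
    then have "has_bochner_integral lborel (\<lambda>t. \<Sum>i\<le>2 * m. real ((2 * m) choose i) * (2 * c) ^ i * (arcw t * (2 * t) ^ (2 * m - i))) (\<mu> m c)"
      unfolding \<mu>_def by (intro has_bochner_integral_sum has_bochner_integral_mult_right) auto
    moreover have "(\<Sum>i\<le>2 * m. real ((2 * m) choose i) * (2 * c) ^ i * (arcw t * (2 * t) ^ (2 * m - i))) = arcw t * (2 * (c + t)) ^ (2 * m)" for t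
      by (simp add: distrib_left binomial_ring sum_distrib_left ac_simps)
    ultimately show ?thesis by simp
  qed
  have avg: "arc_average (cheb_U (2 * n)) c = (\<Sum>m\<le>n. b m * \<mu> m c)" for c
  proof -
    have "has_bochner_integral lborel (\<lambda>t. \<Sum>m\<le>n. b m * (arcw t * (2 * (c + t)) ^ (2 * m))) (\<Sum>m\<le>n. b m * \<mu> m c)"
      by (intro has_bochner_integral_sum has_bochner_integral_mult_right \<mu>)
    moreover have "(\<Sum>m\<le>n. b m * (arcw t * (2 * (c + t)) ^ (2 * m))) = arcw t * cheb_U (2 * n) (c + t)" for t
      unfolding expand by (simp add: sum_distrib_left mult.left_commute)
    ultimately show ?thesis
      unfolding arc_average_shift by (simp add: has_bochner_integral_iff)
  qed
  have avg': "arc_average (cheb_U (2 * n)) = (\<lambda>c. \<Sum>m\<le>n. b m * \<mu> m c)"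
    using avg by auto
  have \<mu>_int: "has_bochner_integral arc_sum_measure (\<mu> m) (pi ^ 3 * (real ((2 * m) choose m) * real (walk_moment m)))" for m
  proof -
    define e2 where "e2 i = (\<Sum>l\<le>i. (i choose l) * central l * central (i - l))" for i
    have "has_bochner_integral arc_sum_measure (\<lambda>c. (2 * c) ^ i) (pi\<^sup>2 * real (e2 i))" for i
      using integrable_arc_sum_measure_power integral_arc_sum_measure_power by (simp add: has_bochner_integral_iff e2_def)
    then have "has_bochner_integral arc_sum_measure (\<mu> m)
      (\<Sum>i\<le>2 * m. real ((2 * m) choose i) * (pi\<^sup>2 * real (e2 i)) * (pi * real (central (2 * m - i))))"
      unfolding \<mu>_def[abs_def]
      by (intro has_bochner_integral_sum has_bochner_integral_mult_left has_bochner_integral_mult_right) auto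
    also have "(\<Sum>i\<le>2 * m. real ((2 * m) choose i) * (pi\<^sup>2 * real (e2 i)) * (pi * real (central (2 * m - i))))
       = pi ^ 3 * real (\<Sum>i\<le>2 * m. ((2 * m) choose i) * e2 i * central (2 * m - i))"
      by (simp add: sum_distrib_left power3_eq_cube power2_eq_square ac_simps)
    also have "(\<Sum>i\<le>2 * m. ((2 * m) choose i) * e2 i * central (2 * m - i)) = ((2 * m) choose m) * walk_moment m"
      unfolding e2_def by (rule central_convolution3)
    finally show ?thesis
      by simp
  qed
  have *: "has_bochner_integral arc_sum_measure (arc_average (cheb_U (2 * n)))
      (\<Sum>m\<le>n. b m * (pi ^ 3 * (real ((2 * m) choose m) * real (walk_moment m))))"
    unfolding avg' by (intro has_bochner_integral_sum has_bochner_integral_mult_right \<mu>_int)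
  then show "integrable arc_sum_measure (arc_average (cheb_U (2 * n)))"
    by (simp add: has_bochner_integral_iff)
  have "(\<Sum>m\<le>n. b m * (pi ^ 3 * (real ((2 * m) choose m) * real (walk_moment m))))
      = (\<Sum>m\<le>n. pi ^ 3 * ((- 1) ^ (n + m) * real (n choose m) * real ((n + m) choose m) * real (walk_moment m)))"
  proof (intro sum.cong refl)
    fix m assume "m \<in> {..n}"
    then have "((n + m) choose (2 * m)) * ((2 * m) choose m) = ((n + m) choose m) * (n choose m)"
      using choose_mult[of m "2 * m" "n + m"] by simp
    then have "real ((n + m) choose (2 * m)) * real ((2 * m) choose m) = real ((n + m) choose m) * real (n choose m)"
      by (simp flip: of_nat_mult)
    then show "b m * (pi ^ 3 * (real ((2 * m) choose m) * real (walk_moment m)))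
        = pi ^ 3 * ((- 1) ^ (n + m) * real (n choose m) * real ((n + m) choose m) * real (walk_moment m))"
      unfolding b_def by (simp only: mult.assoc mult.commute mult.left_commute)
  qed
  also have "\<dots> = pi ^ 3 * real_of_int (int (apery n))"
    unfolding apery_eq_walk_moment_sum by (simp add: sum_distrib_left)
  finally show "(\<integral>c. arc_average (cheb_U (2 * n)) c \<partial>arc_sum_measure) = pi ^ 3 * real (apery n)"
    using * by (simp add: has_bochner_integral_iff)
qed

text \<open>U_{2n} is even, so half of the two-cosine law suffices; the half c > 0 is the one on
  which the exchange identities hold.\<close>

definition pos_arc_sum :: "real measure" where
  "pos_arc_sum = density lborel (\<lambda>c. conv_arc c * indicator {0<..} c)"

definition cosh_sum :: "real measure" where
  "cosh_sum = density lborel conv_cosh"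

lemma sets_pos_arc_sum [simp, measurable_cong]:
  "sets pos_arc_sum = sets borel" "sets cosh_sum = sets borel"
  by (simp_all add: pos_arc_sum_def cosh_sum_def)

lemma integral_arc_sum_measure_even:
  fixes f :: "real \<Rightarrow> real"
  assumes f: "integrable arc_sum_measure f" and even: "\<And>c. f (- c) = f c"
  shows "integral\<^sup>L arc_sum_measure f = 2 * integral\<^sup>L pos_arc_sum f"
proof -
  have [measurable]: "f \<in> borel_measurable borel"
    using borel_measurable_integrable[OF f] by simp
  have reflect: "distr arc_sum_measure borel uminus = arc_sum_measure"
  proof -
    have "arc_sum_measure = density (distr lborel borel uminus) conv_arc"
      by (simp add: arc_sum_measure_def lborel_distr_uminus)
    also have "\<dots> = distr (density lborel (\<lambda>x. conv_arc (- x))) borel uminus"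
      by (rule density_distr) auto
    also have "\<dots> = distr arc_sum_measure borel uminus"
      by (simp only: conv_arc_minus arc_sum_measure_def)
    finally show ?thesis ..
  qed
  have pos: "pos_arc_sum = density arc_sum_measure (\<lambda>c. ennreal (indicator {0<..} c))"
    unfolding pos_arc_sum_def arc_sum_measure_def
    by (subst density_density_eq) (auto simp: ennreal_indicator)
  have i: "integrable arc_sum_measure (\<lambda>c. indicator {0<..} c * f c)" "integrable arc_sum_measure (\<lambda>c. indicator {..<0} c * f c)"
    using integrable_mult_indicator[OF _ f, of "{0<..}"] integrable_mult_indicator[OF _ f, of "{..<0}"] by auto
  have "AE c in arc_sum_measure. c \<noteq> 0"
    unfolding arc_sum_measure_def using AE_lborel_singleton[of "0::real"]
    by (subst AE_density) (auto elim: eventually_mono)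
  then have "integral\<^sup>L arc_sum_measure f = (\<integral>c. indicator {0<..} c * f c + indicator {..<0} c * f c \<partial>arc_sum_measure)"
    by (intro integral_cong_AE) (auto elim!: eventually_mono split: split_indicator)
  also have "\<dots> = (\<integral>c. indicator {0<..} c * f c \<partial>arc_sum_measure) + (\<integral>c. indicator {..<0} c * f c \<partial>arc_sum_measure)"
    using i by simp
  also have "(\<integral>c. indicator {..<0} c * f c \<partial>arc_sum_measure) = (\<integral>c. indicator {..<0} (- c) * f (- c) \<partial>arc_sum_measure)"
    by (subst reflect[symmetric], subst integral_distr) auto
  also have "\<dots> = (\<integral>c. indicator {0<..} c * f c \<partial>arc_sum_measure)"
    by (intro Bochner_Integration.integral_cong refl) (auto simp: even split: split_indicator)
  also have "(\<integral>c. indicator {0<..} c * f c \<partial>arc_sum_measure) = integral\<^sup>L pos_arc_sum f"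
    unfolding pos by (subst integral_density) auto
  finally show ?thesis
    by simp
qed

lemma apery_eq_integral_pos_arc_sum:
  "pi ^ 3 * real (apery n) = 2 * (\<integral>c. arc_average (cheb_U (2 * n)) c \<partial>pos_arc_sum)"
  using integral_arc_sum_measure_even[OF integrable_arc_average_cheb_U[of n]] arc_average_minus cheb_U_minus[of "2 * n"]
  by (simp add: integral_arc_average_cheb_U)

section \<open>Eliminating the indefinite part\<close>

lemma AE_pos_arc_sum: "AE c in pos_arc_sum. 0 < c \<and> c < 2"
  unfolding pos_arc_sum_def
proof (subst AE_density, simp, intro AE_I2 impI)
  fix c assume "0 < conv_arc c * indicator {0<..} c"
  then show "0 < c \<and> c < 2"
    by (cases "2 \<le> c") (auto simp: conv_arc_zero split: split_indicator_asm)
qed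

lemma AE_cosh_sum: "AE c in cosh_sum. 2 < c"
  unfolding cosh_sum_def
proof (subst AE_density, simp, intro AE_I2 impI)
  fix c assume "0 < conv_cosh c"
  then show "2 < c"
    by (cases "c \<le> 2") (auto simp: conv_cosh_zero)
qed

lemma nn_integral_pos_arc_sum:
  "f \<in> borel_measurable borel \<Longrightarrow> (\<integral>\<^sup>+c. f c \<partial>pos_arc_sum) = (\<integral>\<^sup>+c. conv_arc c * indicator {0<..} c * f c \<partial>lborel)"
  unfolding pos_arc_sum_def by (rule nn_integral_density) auto

lemma nn_integral_cosh_sum:
  "f \<in> borel_measurable borel \<Longrightarrow> (\<integral>\<^sup>+c. f c \<partial>cosh_sum) = (\<integral>\<^sup>+c. conv_cosh c * f c \<partial>lborel)"
  unfolding cosh_sum_def by (rule nn_integral_density) auto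

lemma nn_integral_corr_mixed_finite:
  "(\<integral>\<^sup>+c. corr_mixed c \<partial>pos_arc_sum) < \<infinity>" "(\<integral>\<^sup>+c. corr_mixed c \<partial>cosh_sum) < \<infinity>"
proof -
  have "(\<integral>\<^sup>+c. corr_mixed c \<partial>pos_arc_sum) \<le> (\<integral>\<^sup>+c\<in>{0<..}. (conv_arc c + conv_cosh c) * corr_mixed c \<partial>lborel)"
    unfolding nn_integral_pos_arc_sum[OF conv_measurable(4)]
    by (intro nn_integral_mono) (auto simp: distrib_right split: split_indicator)
  also note nn_integral_conv_corr_mixed_finite
  finally show "(\<integral>\<^sup>+c. corr_mixed c \<partial>pos_arc_sum) < \<infinity>" .
  have "(\<integral>\<^sup>+c. corr_mixed c \<partial>cosh_sum) \<le> (\<integral>\<^sup>+c\<in>{0<..}. (conv_arc c + conv_cosh c) * corr_mixed c \<partial>lborel)"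
    unfolding nn_integral_cosh_sum[OF conv_measurable(4)]
    by (intro nn_integral_mono) (auto simp: distrib_right conv_cosh_zero split: split_indicator)
  also note nn_integral_conv_corr_mixed_finite
  finally show "(\<integral>\<^sup>+c. corr_mixed c \<partial>cosh_sum) < \<infinity>" .
qed

lemma corr_mixed_reflect: "corr_mixed c = (\<integral>\<^sup>+t. ennreal (coshw (c - t) * arcw t) \<partial>lborel)"
  using nn_integral_reflect[of "\<lambda>y. ennreal (arcw (y - c)) * ennreal (coshw y)" c]
  by (simp add: corr_mixed_def ennreal_mult' mult.commute)

text \<open>With \<open>f t = arcw t * cheb_T (Suc (2 * n)) t\<close> this is R(c) of the overview.
  The arcsine weight is put into f, which then has bounded support and is odd.\<close>

definition cosh_average :: "(real \<Rightarrow> real) \<Rightarrow> real \<Rightarrow> real" where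
  "cosh_average f c = (\<integral>t. coshw (c - t) * f t \<partial>lborel)"

lemma measurable_cosh_average [measurable]:
  assumes [measurable]: "f \<in> borel_measurable borel"
  shows "cosh_average f \<in> borel_measurable borel"
  unfolding cosh_average_def by measurable

lemma integrable_cosh_average:
  assumes c: "0 < c" "c \<noteq> 2"
  shows "integrable lborel (\<lambda>t. coshw (c - t) * (arcw t * cheb_T n t))"
proof -
  have "integrable lborel (\<lambda>t. arcw (c - t - c) * coshw (c - t))"
    using lborel_integrable_real_affine[OF integrable_corr_mixed[OF c], of "-1" c] by simp
  then have "integrable lborel (\<lambda>t. coshw (c - t) * arcw t)"
    by (simp add: mult.commute)
  then show ?thesis
  proof (rule Bochner_Integration.integrable_bound)
    have "\<bar>coshw (c - t) * (arcw t * cheb_T n t)\<bar> \<le> \<bar>coshw (c - t) * arcw t\<bar>" for t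
    proof (cases "\<bar>t\<bar> < 1")
      case True
      then show ?thesis
        using cheb_T_le_1[of t n] by (simp add: abs_mult mult_left_le mult_left_mono)
    qed (simp add: arcw_zero)
    then show "AE t in lborel. norm (coshw (c - t) * (arcw t * cheb_T n t)) \<le> norm (coshw (c - t) * arcw t)"
      by simp
  qed measurable
qed

lemma integrable_arc_average:
  assumes c: "0 < c" "c \<noteq> 2"
  shows "integrable lborel (\<lambda>t. arcw (t - c) * (coshw t * cheb_T n t))" (is ?I)
    and "ennreal (norm (arc_average (\<lambda>t. coshw t * cheb_T n t) c)) \<le> ennreal ((2 * c + 3) ^ n) * corr_mixed c"
proof -
  have le: "\<bar>arcw (t - c) * (coshw t * cheb_T n t)\<bar> \<le> (2 * c + 3) ^ n * (arcw (t - c) * coshw t)" for t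
  proof (cases "\<bar>t - c\<bar> < 1")
    case True
    then have "\<bar>t\<bar> \<le> c + 1" using c by linarith
    then have "\<bar>cheb_T n t\<bar> \<le> (2 * c + 3) ^ n"
      by (intro order_trans[OF cheb_T_bound] power_mono) auto
    then have "arcw (t - c) * coshw t * \<bar>cheb_T n t\<bar> \<le> arcw (t - c) * coshw t * (2 * c + 3) ^ n"
      by (intro mult_left_mono) auto
    then show ?thesis
      by (simp add: abs_mult ac_simps)
  qed (simp add: arcw_zero)
  show I: ?I
  proof (rule Bochner_Integration.integrable_bound)
    show "integrable lborel (\<lambda>t. (2 * c + 3) ^ n * (arcw (t - c) * coshw t))"
      by (intro integrable_mult_right integrable_corr_mixed c)
    show "AE t in lborel. norm (arcw (t - c) * (coshw t * cheb_T n t)) \<le> norm ((2 * c + 3) ^ n * (arcw (t - c) * coshw t))"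
      unfolding real_norm_def by (intro AE_I2 order_trans[OF le abs_ge_self])
  qed measurable
  have "ennreal (norm (arc_average (\<lambda>t. coshw t * cheb_T n t) c)) \<le> (\<integral>\<^sup>+t. ennreal (norm (arcw (t - c) * (coshw t * cheb_T n t))) \<partial>lborel)"
    unfolding arc_average_def by (rule integral_norm_bound_ennreal[OF I])
  also have "\<dots> \<le> (\<integral>\<^sup>+t. ennreal ((2 * c + 3) ^ n) * (ennreal (arcw (t - c)) * ennreal (coshw t)) \<partial>lborel)"
    using le c by (intro nn_integral_mono) (auto simp: ennreal_leI simp flip: ennreal_mult')
  also have "\<dots> = ennreal ((2 * c + 3) ^ n) * corr_mixed c"
    unfolding corr_mixed_def by (rule nn_integral_cmult) measurable
  finally show "ennreal (norm (arc_average (\<lambda>t. coshw t * cheb_T n t) c)) \<le> ennreal ((2 * c + 3) ^ n) * corr_mixed c" .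
qed

lemma cosh_average_le:
  assumes c: "0 < c" "c \<noteq> 2"
  shows "ennreal (norm (cosh_average (\<lambda>t. arcw t * cheb_T n t) c)) \<le> corr_mixed c"
proof -
  have "ennreal (norm (cosh_average (\<lambda>t. arcw t * cheb_T n t) c)) \<le> (\<integral>\<^sup>+t. ennreal (norm (coshw (c - t) * (arcw t * cheb_T n t))) \<partial>lborel)"
    unfolding cosh_average_def by (rule integral_norm_bound_ennreal[OF integrable_cosh_average[OF c]])
  also have "\<dots> \<le> (\<integral>\<^sup>+t. ennreal (coshw (c - t) * arcw t) \<partial>lborel)"
  proof (intro nn_integral_mono ennreal_leI)
    fix t
    show "norm (coshw (c - t) * (arcw t * cheb_T n t)) \<le> coshw (c - t) * arcw t"
    proof (cases "\<bar>t\<bar> < 1")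
      case True
      then show ?thesis
        using cheb_T_le_1[of t n] by (simp add: abs_mult mult_left_le mult_left_mono)
    qed (simp add: arcw_zero)
  qed
  finally show ?thesis
    by (simp add: corr_mixed_reflect)
qed

text \<open>The reflection t -> c - t brings R(c) to the weight of the first average, with T
  evaluated at c - t, and \<open>integral_cheb_exchange\<close> applies.\<close>

lemma arc_average_minus_cosh_average:
  assumes c: "0 < c" "c \<noteq> 2"
  shows "arc_average (\<lambda>t. coshw t * cheb_T (Suc n) t) c - cosh_average (\<lambda>t. arcw t * cheb_T (Suc n) t) c
    = arc_average (cheb_U n) c"
proof -
  let ?T = "cheb_T (Suc n)"
  have i2: "integrable lborel (\<lambda>t. arcw (t - c) * (coshw t * ?T (c - t)))"
    using lborel_integrable_real_affine[OF integrable_cosh_average[OF c, of "Suc n"], of "-1" c]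
    by (simp add: arcw_commute[of c] mult.left_commute)
  have "cosh_average (\<lambda>t. arcw t * ?T t) c = (\<integral>t. arcw (t - c) * (coshw t * ?T (c - t)) \<partial>lborel)"
    unfolding cosh_average_def
    by (subst lborel_integral_real_affine[where c = "-1" and t = c])
      (simp_all add: arcw_commute[of c] mult.left_commute)
  then have "arc_average (\<lambda>t. coshw t * ?T t) c - cosh_average (\<lambda>t. arcw t * ?T t) c
     = (\<integral>t. arcw (t - c) * (coshw t * ?T t) - arcw (t - c) * (coshw t * ?T (c - t)) \<partial>lborel)"
    using Bochner_Integration.integral_diff[OF integrable_arc_average(1)[OF c, of "Suc n"] i2]
    by (simp only: arc_average_def)
  also have "\<dots> = (\<integral>t. (arcw (t - c) * coshw t) * (?T t - ?T (c - t)) \<partial>lborel)"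
    by (simp add: right_diff_distrib mult.assoc del: cheb_T.simps)
  also have "\<dots> = arc_average (cheb_U n) c"
    unfolding arc_average_def by (rule integral_cheb_exchange[OF c])
  finally show ?thesis .
qed

lemma
  shows integrable_pos_arc_sum_arc_average: "integrable pos_arc_sum (arc_average (\<lambda>t. coshw t * cheb_T n t))"
    and integrable_pos_arc_sum_cosh_average: "integrable pos_arc_sum (cosh_average (\<lambda>t. arcw t * cheb_T n t))"
    and integrable_cosh_sum_cosh_average: "integrable cosh_sum (cosh_average (\<lambda>t. arcw t * cheb_T n t))"
proof -
  have [measurable]: "(\<lambda>t. coshw t * cheb_T n t) \<in> borel_measurable borel" "(\<lambda>t. arcw t * cheb_T n t) \<in> borel_measurable borel"
    by measurable
  have "(\<integral>\<^sup>+c. ennreal (norm (arc_average (\<lambda>t. coshw t * cheb_T n t) c)) \<partial>pos_arc_sum)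
     \<le> (\<integral>\<^sup>+c. ennreal (7 ^ n) * corr_mixed c \<partial>pos_arc_sum)"
  proof (rule nn_integral_mono_AE, use AE_pos_arc_sum in eventually_elim)
    case (elim c)
    then have "ennreal (norm (arc_average (\<lambda>t. coshw t * cheb_T n t) c)) \<le> ennreal ((2 * c + 3) ^ n) * corr_mixed c"
      by (intro integrable_arc_average) auto
    \<comment> \<open>The support has c < 2, so 2c + 3 is at most 7.\<close>
    also have "\<dots> \<le> ennreal (7 ^ n) * corr_mixed c"
      using elim by (intro mult_right_mono ennreal_leI power_mono) auto
    finally show ?case .
  qed
  also have "\<dots> = ennreal (7 ^ n) * (\<integral>\<^sup>+c. corr_mixed c \<partial>pos_arc_sum)"
    by (rule nn_integral_cmult) simp
  also have "\<dots> < \<infinity>"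
    using nn_integral_corr_mixed_finite(1) by (simp add: ennreal_mult_less_top)
  finally show "integrable pos_arc_sum (arc_average (\<lambda>t. coshw t * cheb_T n t))"
    by (intro integrableI_bounded) measurable
  have "(\<integral>\<^sup>+c. ennreal (norm (cosh_average (\<lambda>t. arcw t * cheb_T n t) c)) \<partial>pos_arc_sum) \<le> (\<integral>\<^sup>+c. corr_mixed c \<partial>pos_arc_sum)"
    by (rule nn_integral_mono_AE, use AE_pos_arc_sum in eventually_elim) (rule cosh_average_le, auto)
  also note nn_integral_corr_mixed_finite(1)
  finally show "integrable pos_arc_sum (cosh_average (\<lambda>t. arcw t * cheb_T n t))"
    by (intro integrableI_bounded) measurable
  have "(\<integral>\<^sup>+c. ennreal (norm (cosh_average (\<lambda>t. arcw t * cheb_T n t) c)) \<partial>cosh_sum) \<le> (\<integral>\<^sup>+c. corr_mixed c \<partial>cosh_sum)"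
    by (rule nn_integral_mono_AE, use AE_cosh_sum in eventually_elim) (rule cosh_average_le, auto)
  also note nn_integral_corr_mixed_finite(2)
  finally show "integrable cosh_sum (cosh_average (\<lambda>t. arcw t * cheb_T n t))"
    by (intro integrableI_bounded) measurable
qed

text \<open>The exchange of triple convolutions is an identity between nonnegative extended values;
  this brings signed integrals into a form to which it applies part by part.\<close>

lemma integral_enn2real_diff:
  fixes f :: "'a \<Rightarrow> real" and p m :: "'a \<Rightarrow> ennreal"
  assumes [measurable]: "p \<in> borel_measurable M" "m \<in> borel_measurable M"
    and fin: "integral\<^sup>N M p < \<infinity>" "integral\<^sup>N M m < \<infinity>"
    and f: "AE x in M. f x = enn2real (p x) - enn2real (m x)"
    and [measurable]: "f \<in> borel_measurable M"
  shows "integral\<^sup>L M f = enn2real (integral\<^sup>N M p) - enn2real (integral\<^sup>N M m)"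
proof -
  have h: "has_bochner_integral M (\<lambda>x. enn2real (q x)) (enn2real (integral\<^sup>N M q))"
    if [measurable]: "q \<in> borel_measurable M" and fin: "integral\<^sup>N M q < \<infinity>" for q
  proof (rule has_bochner_integral_nn_integral)
    have "AE x in M. q x \<noteq> \<infinity>"
      using fin by (intro nn_integral_noteq_infinite) auto
    then have "(\<integral>\<^sup>+x. ennreal (enn2real (q x)) \<partial>M) = integral\<^sup>N M q"
      by (intro nn_integral_cong_AE) (auto elim!: eventually_mono simp: less_top)
    then show "(\<integral>\<^sup>+x. ennreal (enn2real (q x)) \<partial>M) = ennreal (enn2real (integral\<^sup>N M q))"
      using fin by simp
  qed auto
  have "integral\<^sup>L M f = (\<integral>x. enn2real (p x) - enn2real (m x) \<partial>M)"
    using f by (intro integral_cong_AE) auto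
  also have "\<dots> = enn2real (integral\<^sup>N M p) - enn2real (integral\<^sup>N M m)"
    using has_bochner_integral_diff[OF h h] fin by (simp add: has_bochner_integral_iff)
  finally show ?thesis .
qed

text \<open>Let p and m be the averages of the positive and the negative part of the odd function
  \<open>\<tau>\<close>; by oddness they are exchanged when \<open>\<tau>\<close> is reflected.
  Write x+ and x- for the integrals of p and m against b*b, and y+ and y- for those against a*a on c
  > 0. Evaluating the triple convolution in two ways and using \<open>corr_cosh_eq\<close> gives 2
  x+ = y- + x- and 2 x- = y+ + x+. Subtraction yields y+ - y- = -3 (x+ - x-).\<close>

lemma integral_pos_arc_sum_cosh_average:
  assumes "odd n"
  shows "(\<integral>c. cosh_average (\<lambda>t. arcw t * cheb_T n t) c \<partial>pos_arc_sum)
    = - 3 * (\<integral>c. cosh_average (\<lambda>t. arcw t * cheb_T n t) c \<partial>cosh_sum)"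
proof -
  define \<tau> where "\<tau> t = arcw t * cheb_T n t" for t
  have \<tau>m [measurable]: "\<tau> \<in> borel_measurable borel"
    unfolding \<tau>_def by measurable
  have odd: "\<tau> (- t) = - \<tau> t" for t
    using assms by (simp add: \<tau>_def cheb_T_minus)
  define p where "p c = (\<integral>\<^sup>+t. ennreal (coshw (c - t)) * ennreal (\<tau> t) \<partial>lborel)" for c
  define m where "m c = (\<integral>\<^sup>+t. ennreal (coshw (c - t)) * ennreal (\<tau> (- t)) \<partial>lborel)" for c
  have pm [measurable]: "p \<in> borel_measurable borel" "m \<in> borel_measurable borel"
    unfolding p_def m_def by measurable
  have \<tau>_le: "\<bar>\<tau> t\<bar> \<le> arcw t" for t
    using cheb_T_le_1[of t n] by (cases "\<bar>t\<bar> < 1") (auto simp: \<tau>_def arcw_zero abs_mult mult_left_le)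
  have le: "p c \<le> corr_mixed c" "m c \<le> corr_mixed c" for c
  proof -
    have "ennreal (coshw (c - t)) * ennreal x \<le> ennreal (coshw (c - t) * arcw t)" if "x \<le> arcw t" for t x
      using that by (auto simp: ennreal_mult' intro!: mult_left_mono ennreal_leI)
    moreover have "\<tau> t \<le> arcw t" "\<tau> (- t) \<le> arcw t" for t
      using \<tau>_le[of t] odd[of t] by auto
    ultimately show "p c \<le> corr_mixed c" "m c \<le> corr_mixed c"
      unfolding p_def m_def corr_mixed_reflect by (auto intro!: nn_integral_mono)
  qed
  have avg: "cosh_average \<tau> c = enn2real (p c) - enn2real (m c)" if c: "0 < c" "c \<noteq> 2" for c
  proof -
    have "integrable lborel (\<lambda>t. coshw (c - t) * \<tau> t)"
      unfolding \<tau>_def by (rule integrable_cosh_average[OF c])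
    then have "cosh_average \<tau> c = enn2real (\<integral>\<^sup>+t. ennreal (coshw (c - t) * \<tau> t) \<partial>lborel)
        - enn2real (\<integral>\<^sup>+t. ennreal (- (coshw (c - t) * \<tau> t)) \<partial>lborel)"
      unfolding cosh_average_def by (rule real_lebesgue_integral_def)
    also have "(\<integral>\<^sup>+t. ennreal (coshw (c - t) * \<tau> t) \<partial>lborel) = p c"
      unfolding p_def by (intro nn_integral_cong ennreal_mult') simp
    also have "(\<integral>\<^sup>+t. ennreal (- (coshw (c - t) * \<tau> t)) \<partial>lborel) = m c"
      unfolding m_def odd mult_minus_right[symmetric] by (intro nn_integral_cong ennreal_mult') simp
    finally show ?thesis .
  qed
  have fin: "integral\<^sup>N pos_arc_sum p < \<infinity>" "integral\<^sup>N pos_arc_sum m < \<infinity>"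
    "integral\<^sup>N cosh_sum p < \<infinity>" "integral\<^sup>N cosh_sum m < \<infinity>"
    by (rule le_less_trans[OF nn_integral_mono[OF le(1)] nn_integral_corr_mixed_finite(1)]
        le_less_trans[OF nn_integral_mono[OF le(2)] nn_integral_corr_mixed_finite(1)]
        le_less_trans[OF nn_integral_mono[OF le(1)] nn_integral_corr_mixed_finite(2)]
        le_less_trans[OF nn_integral_mono[OF le(2)] nn_integral_corr_mixed_finite(2)])+
  \<comment> \<open>The correlation is defined for all c, whereas its decomposition holds for
    positive c. Nothing is lost: |t| < 1 and c - t > 1 force c > 0.\<close>
  have zero: "p c = 0" "m c = 0" if "c \<le> 0" for c
  proof -
    have z: "ennreal (coshw (c - t)) * ennreal (\<tau> t) = 0" "ennreal (coshw (c - t)) * ennreal (\<tau> (- t)) = 0" for t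
      using that by (cases "\<bar>t\<bar> < 1"; simp add: \<tau>_def arcw_zero coshw_zero)+
    show "p c = 0" "m c = 0"
      unfolding p_def m_def z by simp_all
  qed
  have exch: "2 * integral\<^sup>N cosh_sum p = integral\<^sup>N pos_arc_sum m + integral\<^sup>N cosh_sum m"
    "2 * integral\<^sup>N cosh_sum m = integral\<^sup>N pos_arc_sum p + integral\<^sup>N cosh_sum p"
  proof -
    have split: "2 * (\<integral>\<^sup>+c. corr_cosh c * q c \<partial>lborel) = integral\<^sup>N pos_arc_sum q + integral\<^sup>N cosh_sum q"
      if [measurable]: "q \<in> borel_measurable borel" and q: "\<And>c. c \<le> 0 \<Longrightarrow> q c = 0" for q
    proof -
      have "2 * (\<integral>\<^sup>+c. corr_cosh c * q c \<partial>lborel) = (\<integral>\<^sup>+c. 2 * (corr_cosh c * q c) \<partial>lborel)"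
        by (rule nn_integral_cmult[symmetric]) simp
      also have "\<dots> = (\<integral>\<^sup>+c. conv_arc c * indicator {0<..} c * q c + conv_cosh c * q c \<partial>lborel)"
      proof (rule nn_integral_cong_AE, use AE_lborel_singleton[of "2::real"] in eventually_elim)
        case (elim c)
        show ?case
        proof (cases "0 < c")
          case True
          then have "2 * (corr_cosh c * q c) = (conv_arc c + conv_cosh c) * q c"
            using corr_cosh_eq[OF True elim] by (simp add: mult.assoc[symmetric])
          then show ?thesis
            using True by (simp add: distrib_right)
        qed (simp add: q)
      qed
      also have "\<dots> = integral\<^sup>N pos_arc_sum q + integral\<^sup>N cosh_sum q"
        by (simp add: nn_integral_add nn_integral_pos_arc_sum nn_integral_cosh_sum)
      finally show ?thesis .
    qed
    have "integral\<^sup>N cosh_sum p = (\<integral>\<^sup>+c. corr_cosh c * m c \<partial>lborel)"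
      unfolding nn_integral_cosh_sum[OF pm(1)] p_def m_def by (rule conv_cosh_corr_cosh_exchange) simp
    then show "2 * integral\<^sup>N cosh_sum p = integral\<^sup>N pos_arc_sum m + integral\<^sup>N cosh_sum m"
      using split[of m] zero by simp
    have "integral\<^sup>N cosh_sum m = (\<integral>\<^sup>+c. corr_cosh c * p c \<partial>lborel)"
      unfolding nn_integral_cosh_sum[OF pm(2)] p_def m_def
      using conv_cosh_corr_cosh_exchange[of "\<lambda>t. ennreal (\<tau> (- t))"] by simp
    then show "2 * integral\<^sup>N cosh_sum m = integral\<^sup>N pos_arc_sum p + integral\<^sup>N cosh_sum p"
      using split[of p] zero by simp
  qed
  define xp xm yp ym where "xp = enn2real (integral\<^sup>N cosh_sum p)" and "xm = enn2real (integral\<^sup>N cosh_sum m)"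
    and "yp = enn2real (integral\<^sup>N pos_arc_sum p)" and "ym = enn2real (integral\<^sup>N pos_arc_sum m)"
  \<comment> \<open>All four integrals are finite, so the system may be read in the reals and its
    equations subtracted.\<close>
  have x: "2 * xp = ym + xm" "2 * xm = yp + xp"
    using arg_cong[OF exch(1), of enn2real] arg_cong[OF exch(2), of enn2real] fin
    by (auto simp: enn2real_mult enn2real_plus xp_def xm_def yp_def ym_def)
  have "(\<integral>c. cosh_average \<tau> c \<partial>pos_arc_sum) = yp - ym"
    unfolding yp_def ym_def
  proof (intro integral_enn2real_diff fin)
    show "AE c in pos_arc_sum. cosh_average \<tau> c = enn2real (p c) - enn2real (m c)"
      using AE_pos_arc_sum by eventually_elim (rule avg, auto)
  qed measurable
  moreover have "(\<integral>c. cosh_average \<tau> c \<partial>cosh_sum) = xp - xm"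
    unfolding xp_def xm_def
  proof (intro integral_enn2real_diff fin)
    show "AE c in cosh_sum. cosh_average \<tau> c = enn2real (p c) - enn2real (m c)"
      using AE_cosh_sum by eventually_elim (rule avg, auto)
  qed measurable
  ultimately have "(\<integral>c. cosh_average \<tau> c \<partial>pos_arc_sum) = - 3 * (\<integral>c. cosh_average \<tau> c \<partial>cosh_sum)"
    using x by simp
  then show ?thesis
    by (simp add: \<tau>_def[abs_def])
qed

text \<open>The coefficient 2 comes from the evenness in c, and 6 is that 2 times the 3 gained when
  R is moved from a*a to b*b.\<close>

lemma apery_eq_integral_arc_average_plus_cosh_average:
  "pi ^ 3 * real (apery n) = 2 * (\<integral>c. arc_average (\<lambda>t. coshw t * cheb_T (Suc (2 * n)) t) c \<partial>pos_arc_sum)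
    + 6 * (\<integral>c. cosh_average (\<lambda>t. arcw t * cheb_T (Suc (2 * n)) t) c \<partial>cosh_sum)"
proof -
  let ?G = "arc_average (\<lambda>t. coshw t * cheb_T (Suc (2 * n)) t)"
  let ?R = "cosh_average (\<lambda>t. arcw t * cheb_T (Suc (2 * n)) t)"
  have "(\<integral>c. arc_average (cheb_U (2 * n)) c \<partial>pos_arc_sum) = (\<integral>c. ?G c - ?R c \<partial>pos_arc_sum)"
  proof (intro integral_cong_AE)
    show "AE c in pos_arc_sum. arc_average (cheb_U (2 * n)) c = ?G c - ?R c"
      using AE_pos_arc_sum
      by eventually_elim (intro arc_average_minus_cosh_average[symmetric], auto)
  qed measurable
  also have "\<dots> = (\<integral>c. ?G c \<partial>pos_arc_sum) - (\<integral>c. ?R c \<partial>pos_arc_sum)"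
    by (intro Bochner_Integration.integral_diff integrable_pos_arc_sum_arc_average integrable_pos_arc_sum_cosh_average)
  also have "(\<integral>c. ?R c \<partial>pos_arc_sum) = - 3 * (\<integral>c. ?R c \<partial>cosh_sum)"
    by (rule integral_pos_arc_sum_cosh_average) simp
  finally show ?thesis
    unfolding apery_eq_integral_pos_arc_sum by linarith
qed

section \<open>Substitution and the density\<close>

text \<open>For t = cosh u with u > 0 the two functions are exp((2n+1)u) / sinh u and exp(-(2n+1)u)
  / sinh u. They feed the branches x > 1 and x < 1 of the substitution.\<close>

definition cheb_grow :: "nat \<Rightarrow> real \<Rightarrow> real" where
  "cheb_grow n t = (if 1 < t then coshw t * cheb_T (Suc (2 * n)) t + cheb_U (2 * n) t else 0)"

definition cheb_decay :: "nat \<Rightarrow> real \<Rightarrow> real" where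
  "cheb_decay n t = (if 1 < t then coshw t * cheb_T (Suc (2 * n)) t - cheb_U (2 * n) t else 0)"

lemma cheb_grow_measurable [measurable]:
  "cheb_grow n \<in> borel_measurable borel" "cheb_decay n \<in> borel_measurable borel"
  unfolding cheb_grow_def cheb_decay_def by measurable

lemma cosh_real_gt_1_iff: "1 < cosh u \<longleftrightarrow> u \<noteq> (0::real)"
  using cosh_real_ge_1[of u] cosh_real_one_iff[of u] by linarith

lemma coshw_cosh: "0 < u \<Longrightarrow> coshw (cosh u) = 1 / sinh u"
  using cosh_square_eq[of u] by (simp add: coshw_def cosh_real_gt_1_iff)

lemma
  assumes "0 < u"
  shows cheb_grow_cosh: "cheb_grow n (cosh u) = exp (real (Suc (2 * n)) * u) / sinh u"
    and cheb_decay_cosh: "cheb_decay n (cosh u) = exp (- (real (Suc (2 * n)) * u)) / sinh u"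
proof -
  have s: "0 < sinh u" using assms by simp
  have U: "cheb_U (2 * n) (cosh u) = sinh (real (Suc (2 * n)) * u) / sinh u"
    using cheb_U_cosh[of "2 * n" u] s by (simp add: field_simps)
  have "1 < cosh u" using assms by (simp add: cosh_real_gt_1_iff)
  then show "cheb_grow n (cosh u) = exp (real (Suc (2 * n)) * u) / sinh u"
    "cheb_decay n (cosh u) = exp (- (real (Suc (2 * n)) * u)) / sinh u"
    unfolding cheb_grow_def cheb_decay_def U cheb_T_cosh coshw_cosh[OF assms]
    by (simp_all only: if_True times_divide_eq_left mult_1 add_divide_distrib[symmetric] diff_divide_distrib[symmetric] cosh_plus_sinh cosh_minus_sinh)
qed

lemma cosh_cases:
  assumes "1 < (t::real)"
  obtains u where "0 < u" "t = cosh u"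
proof
  show "0 < arcosh t" using assms by simp
  show "t = cosh (arcosh t)" using assms by simp
qed

lemma cheb_grow_nonneg: "0 \<le> cheb_grow n t" "0 \<le> cheb_decay n t"
proof -
  have "0 \<le> cheb_grow n t \<and> 0 \<le> cheb_decay n t"
  proof (cases "1 < t")
    case True
    then obtain u where "0 < u" "t = cosh u" by (rule cosh_cases)
    then show ?thesis by (simp add: cheb_grow_cosh cheb_decay_cosh)
  qed (simp add: cheb_grow_def cheb_decay_def)
  then show "0 \<le> cheb_grow n t" "0 \<le> cheb_decay n t" by auto
qed

lemma cheb_grow_add_decay: "2 * (coshw t * cheb_T (Suc (2 * n)) t) = cheb_grow n t + cheb_decay n t"
  by (simp add: cheb_grow_def cheb_decay_def coshw_zero del: cheb_T.simps)

text \<open>T_{2n+1} is half the sum of the two exponentials; keeping the 2 on the left avoids a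
  division among extended values.\<close>

lemma nn_integral_arc_average:
  "2 * ennreal (\<integral>c. arc_average (\<lambda>t. coshw t * cheb_T (Suc (2 * n)) t) c \<partial>pos_arc_sum)
    = (\<integral>\<^sup>+c. (\<integral>\<^sup>+t. ennreal (cheb_grow n t * arcw (t - c)) \<partial>lborel) + (\<integral>\<^sup>+t. ennreal (cheb_decay n t * arcw (t - c)) \<partial>lborel) \<partial>pos_arc_sum)"
proof -
  let ?f = "\<lambda>t. coshw t * cheb_T (Suc (2 * n)) t"
  have nonneg: "0 \<le> ?f t" for t
    using cheb_grow_add_decay[of t n] cheb_grow_nonneg[of n t] by linarith
  have nonneg': "0 \<le> arcw (t - c) * ?f t" for t c
    by (intro mult_nonneg_nonneg nonneg arcw_nonneg)
  have "2 * ennreal (arc_average ?f c) = (\<integral>\<^sup>+t. ennreal (cheb_grow n t * arcw (t - c)) \<partial>lborel) + (\<integral>\<^sup>+t. ennreal (cheb_decay n t * arcw (t - c)) \<partial>lborel)"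
    if c: "0 < c" "c < 2" for c
  proof -
    have "ennreal (arc_average ?f c) = (\<integral>\<^sup>+t. ennreal (arcw (t - c) * ?f t) \<partial>lborel)"
      unfolding arc_average_def using c nonneg'
      by (intro nn_integral_eq_integral[symmetric] integrable_arc_average AE_I2) auto
    then have "2 * ennreal (arc_average ?f c) = (\<integral>\<^sup>+t. 2 * ennreal (arcw (t - c) * ?f t) \<partial>lborel)"
      by (simp add: nn_integral_cmult del: cheb_T.simps)
    also have "\<dots> = (\<integral>\<^sup>+t. ennreal (cheb_grow n t * arcw (t - c)) + ennreal (cheb_decay n t * arcw (t - c)) \<partial>lborel)"
    proof (intro nn_integral_cong)
      fix t
      have "2 * ennreal (arcw (t - c) * ?f t) = ennreal (2 * (arcw (t - c) * ?f t))"
        by (subst ennreal_mult') auto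
      also have "2 * (arcw (t - c) * ?f t) = cheb_grow n t * arcw (t - c) + cheb_decay n t * arcw (t - c)"
        using cheb_grow_add_decay[of t n] by (metis distrib_right mult.commute mult.left_commute)
      finally show "2 * ennreal (arcw (t - c) * ?f t) = ennreal (cheb_grow n t * arcw (t - c)) + ennreal (cheb_decay n t * arcw (t - c))"
        by (simp add: cheb_grow_nonneg)
    qed
    also have "\<dots> = (\<integral>\<^sup>+t. ennreal (cheb_grow n t * arcw (t - c)) \<partial>lborel) + (\<integral>\<^sup>+t. ennreal (cheb_decay n t * arcw (t - c)) \<partial>lborel)"
      by (intro nn_integral_add) measurable
    finally show ?thesis .
  qed
  note eq = this
  have "ennreal (\<integral>c. arc_average ?f c \<partial>pos_arc_sum) = (\<integral>\<^sup>+c. ennreal (arc_average ?f c) \<partial>pos_arc_sum)"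
    using nonneg' unfolding arc_average_def
    by (intro nn_integral_eq_integral[symmetric] integrable_pos_arc_sum_arc_average[unfolded arc_average_def[abs_def]] AE_I2 integral_nonneg_AE) auto
  then have "2 * ennreal (\<integral>c. arc_average ?f c \<partial>pos_arc_sum) = (\<integral>\<^sup>+c. 2 * ennreal (arc_average ?f c) \<partial>pos_arc_sum)"
    by (simp add: nn_integral_cmult del: cheb_T.simps)
  also have "\<dots> = (\<integral>\<^sup>+c. (\<integral>\<^sup>+t. ennreal (cheb_grow n t * arcw (t - c)) \<partial>lborel) + (\<integral>\<^sup>+t. ennreal (cheb_decay n t * arcw (t - c)) \<partial>lborel) \<partial>pos_arc_sum)"
    by (rule nn_integral_cong_AE, use AE_pos_arc_sum in eventually_elim) (rule eq, auto)
  finally show ?thesis .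
qed

text \<open>For c > 2 the weight \<open>arcw (t - c)\<close> lives in t > 1. The exchange identity
  then expresses the oscillating R(c) as the average of
  \<open>coshw t * cheb_T (Suc (2 * n)) t - cheb_U (2 * n) t\<close>, which there is the positive
  \<open>cheb_decay n t\<close>.\<close>

lemma nn_integral_cosh_average:
  "ennreal (\<integral>c. cosh_average (\<lambda>t. arcw t * cheb_T (Suc (2 * n)) t) c \<partial>cosh_sum)
    = (\<integral>\<^sup>+c. (\<integral>\<^sup>+t. ennreal (cheb_decay n t * arcw (t - c)) \<partial>lborel) \<partial>cosh_sum)"
  "0 \<le> (\<integral>c. cosh_average (\<lambda>t. arcw t * cheb_T (Suc (2 * n)) t) c \<partial>cosh_sum)"
proof -
  let ?f = "\<lambda>t. arcw t * cheb_T (Suc (2 * n)) t"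
  have eq: "has_bochner_integral lborel (\<lambda>t. cheb_decay n t * arcw (t - c)) (cosh_average ?f c)" if c: "2 < c" for c
  proof -
    have c': "0 < c" "c \<noteq> 2" using c by auto
    have iU: "integrable lborel (\<lambda>t. arcw (t - c) * cheb_U (2 * n) t)"
    proof (rule Bochner_Integration.integrable_bound)
      show "integrable lborel (\<lambda>t. (2 * c + 3) ^ (2 * n) * arcw (t - c))"
        by (intro integrable_mult_right integrable_arcw_shift)
      have "\<bar>arcw (t - c) * cheb_U (2 * n) t\<bar> \<le> \<bar>(2 * c + 3) ^ (2 * n) * arcw (t - c)\<bar>" for t
      proof (cases "\<bar>t - c\<bar> < 1")
        case True
        then have "\<bar>t\<bar> \<le> c + 1" using c by linarith
        then have "\<bar>cheb_U (2 * n) t\<bar> \<le> (2 * c + 3) ^ (2 * n)"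
          by (intro order_trans[OF cheb_U_bound] power_mono) auto
        then have "arcw (t - c) * \<bar>cheb_U (2 * n) t\<bar> \<le> arcw (t - c) * (2 * c + 3) ^ (2 * n)"
          by (intro mult_left_mono) auto
        then show ?thesis
          using c by (simp add: abs_mult mult.commute)
      qed (simp add: arcw_zero)
      then show "AE t in lborel. norm (arcw (t - c) * cheb_U (2 * n) t) \<le> norm ((2 * c + 3) ^ (2 * n) * arcw (t - c))"
        by simp
    qed measurable
    have e: "arcw (t - c) * (coshw t * cheb_T (Suc (2 * n)) t) - arcw (t - c) * cheb_U (2 * n) t = cheb_decay n t * arcw (t - c)" for t
      using c by (cases "1 < t") (auto simp: cheb_decay_def arcw_zero algebra_simps simp del: cheb_T.simps)
    have "has_bochner_integral lborel (\<lambda>t. arcw (t - c) * (coshw t * cheb_T (Suc (2 * n)) t) - arcw (t - c) * cheb_U (2 * n) t)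
       (arc_average (\<lambda>t. coshw t * cheb_T (Suc (2 * n)) t) c - arc_average (cheb_U (2 * n)) c)"
      unfolding arc_average_def
      by (intro has_bochner_integral_diff has_bochner_integral_integrable integrable_arc_average iU c')
    also have "arc_average (\<lambda>t. coshw t * cheb_T (Suc (2 * n)) t) c - arc_average (cheb_U (2 * n)) c = cosh_average ?f c"
      using arc_average_minus_cosh_average[OF c', of "2 * n"] by linarith
    finally show ?thesis
      unfolding e .
  qed
  have nonneg: "0 \<le> cosh_average ?f c" if "2 < c" for c
    unfolding has_bochner_integral_integral_eq[OF eq[OF that], symmetric]
    by (intro integral_nonneg_AE AE_I2 mult_nonneg_nonneg cheb_grow_nonneg arcw_nonneg)
  have AE: "AE c in cosh_sum. 0 \<le> cosh_average ?f c"
    using AE_cosh_sum by eventually_elim (rule nonneg)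
  then show "0 \<le> (\<integral>c. cosh_average ?f c \<partial>cosh_sum)"
    by (rule integral_nonneg_AE)
  have "ennreal (\<integral>c. cosh_average ?f c \<partial>cosh_sum) = (\<integral>\<^sup>+c. ennreal (cosh_average ?f c) \<partial>cosh_sum)"
    by (intro nn_integral_eq_integral[symmetric] integrable_cosh_sum_cosh_average AE)
  also have "\<dots> = (\<integral>\<^sup>+c. (\<integral>\<^sup>+t. ennreal (cheb_decay n t * arcw (t - c)) \<partial>lborel) \<partial>cosh_sum)"
  proof (rule nn_integral_cong_AE, use AE_cosh_sum in eventually_elim)
    case (elim c)
    show ?case
      using eq[OF elim] cheb_grow_nonneg by (subst nn_integral_eq_integral) (auto simp: has_bochner_integral_iff)
  qed
  finally show "ennreal (\<integral>c. cosh_average ?f c \<partial>cosh_sum) = (\<integral>\<^sup>+c. (\<integral>\<^sup>+t. ennreal (cheb_decay n t * arcw (t - c)) \<partial>lborel) \<partial>cosh_sum)" .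
qed

text \<open>The Joukowski map in \<open>sqrt x\<close>, which is s in the overview. It takes x and
  1/x to the same value, hence the separate treatment of (0,1) and (1,oo).\<close>

definition zhukovsky :: "real \<Rightarrow> real" where
  "zhukovsky x = (sqrt x + 1 / sqrt x) / 2"

lemma zhukovsky_measurable [measurable]: "zhukovsky \<in> borel_measurable borel"
  unfolding zhukovsky_def by measurable

lemma sqrt_exp_double: "sqrt (exp (2 * u)) = exp u"
  by (simp add: exp_double)

lemma zhukovsky_exp: "zhukovsky (exp (2 * u)) = cosh u"
  by (simp add: zhukovsky_def sqrt_exp_double cosh_def exp_minus inverse_eq_divide)

lemma exp_double_cases:
  assumes "0 < (x::real)"
  obtains u where "x = exp (2 * u)"
  using assms that[of "ln x / 2"] by simp

lemma zhukovsky_image: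
  "zhukovsky ` {1<..} = {1<..}" "zhukovsky ` {0<..<1} = {1<..}"
proof -
  have gt: "1 < zhukovsky x" if "0 < x" "x \<noteq> 1" for x
  proof -
    from \<open>0 < x\<close> obtain u where "x = exp (2 * u)" by (rule exp_double_cases)
    then show ?thesis
      using that by (auto simp: zhukovsky_exp cosh_real_gt_1_iff)
  qed
  have "t \<in> zhukovsky ` {1<..}" "t \<in> zhukovsky ` {0<..<1}" if "1 < t" for t
  proof -
    obtain u where u: "0 < u" "t = cosh u" using \<open>1 < t\<close> by (rule cosh_cases)
    show "t \<in> zhukovsky ` {1<..}"
      using u by (intro image_eqI[of _ _ "exp (2 * u)"]) (auto simp: zhukovsky_exp)
    show "t \<in> zhukovsky ` {0<..<1}"
      using u zhukovsky_exp[of "- u"] by (intro image_eqI[of _ _ "exp (2 * - u)"]) auto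
  qed
  then show "zhukovsky ` {1<..} = {1<..}" "zhukovsky ` {0<..<1} = {1<..}"
    using gt by auto
qed

lemma zhukovsky_inj: "inj_on zhukovsky {1<..}" "inj_on zhukovsky {0<..<1}"
proof -
  have inj: "cosh u = cosh v \<Longrightarrow> 0 \<le> u * v \<Longrightarrow> u = v" for u v :: real
    by (auto simp: abs_if zero_le_mult_iff split: if_splits)
  show "inj_on zhukovsky {1<..}"
  proof (rule inj_onI)
    fix x y :: real assume "x \<in> {1<..}" "y \<in> {1<..}" and eq: "zhukovsky x = zhukovsky y"
    then have "1 < x" "1 < y" by auto
    then obtain u v where "x = exp (2 * u)" "y = exp (2 * v)"
      using exp_double_cases[of x] exp_double_cases[of y] by (metis order.strict_trans zero_less_one)
    then show "x = y"
      using eq inj[of u v] \<open>1 < x\<close> \<open>1 < y\<close> by (simp add: zhukovsky_exp)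
  qed
  show "inj_on zhukovsky {0<..<1}"
  proof (rule inj_onI)
    fix x y :: real assume "x \<in> {0<..<1}" "y \<in> {0<..<1}" and eq: "zhukovsky x = zhukovsky y"
    then have xy: "0 < x" "0 < y" "x < 1" "y < 1" by auto
    then obtain u v where "x = exp (2 * u)" "y = exp (2 * v)"
      using exp_double_cases[of x] exp_double_cases[of y] by metis
    then show "x = y"
      using eq inj[of u v] xy by (simp add: zhukovsky_exp mult_nonpos_nonpos)
  qed
qed

definition zhukovsky_deriv :: "real \<Rightarrow> real" where
  "zhukovsky_deriv x = (1 - 1 / x) / (4 * sqrt x)"

lemma zhukovsky_deriv_measurable [measurable]: "zhukovsky_deriv \<in> borel_measurable borel"
  unfolding zhukovsky_deriv_def by measurable

lemma has_real_derivative_zhukovsky: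
  assumes "0 < x"
  shows "(zhukovsky has_real_derivative zhukovsky_deriv x) (at x)"
proof -
  have d: "(sqrt has_real_derivative inverse (sqrt x) / 2) (at x)"
    by (rule DERIV_real_sqrt[OF assms])
  have "((\<lambda>x. (sqrt x + inverse (sqrt x)) / 2) has_real_derivative
      (inverse (sqrt x) / 2 + - (inverse (sqrt x) * (inverse (sqrt x) / 2) * inverse (sqrt x))) / 2) (at x)"
    using assms by (intro DERIV_cdivide DERIV_add d DERIV_inverse'[OF d]) simp
  also have "(\<lambda>x. (sqrt x + inverse (sqrt x)) / 2) = zhukovsky"
    by (simp add: zhukovsky_def[abs_def] inverse_eq_divide)
  also have "(inverse (sqrt x) / 2 + - (inverse (sqrt x) * (inverse (sqrt x) / 2) * inverse (sqrt x))) / 2 = zhukovsky_deriv x"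
  proof -
    have "1 / x = inverse (sqrt x) * inverse (sqrt x)"
      using assms by (simp add: inverse_eq_divide flip: real_sqrt_mult)
    moreover have "(inverse s / 2 + - (inverse s * (inverse s / 2) * inverse s)) / 2 = (1 - inverse s * inverse s) / (4 * s)" for s :: real
      by (cases "s = 0") (simp_all add: field_simps)
    ultimately show ?thesis
      by (simp only: zhukovsky_deriv_def)
  qed
  finally show ?thesis .
qed

lemma zhukovsky_deriv_exp: "zhukovsky_deriv (exp (2 * u)) = exp (- (2 * u)) * sinh u / 2"
proof -
  have "(1 - 1 / e\<^sup>2) / (4 * e) = inverse (e\<^sup>2) * ((e - inverse e) / 2) / 2" if "e \<noteq> 0" for e :: real
    using that by (simp add: field_simps power2_eq_square)
  from this[of "exp u"] show ?thesis
    unfolding zhukovsky_deriv_def sqrt_exp_double by (simp add: sinh_field_def exp_minus exp_double)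
qed

text \<open>For x = exp(2u) the derivative has absolute value exp(-2u) |sinh u| / 2 and cancels the
  denominator sinh. Since u is negative for x < 1, the decaying exponential gives the same power of
  x there as the growing one does for x > 1.\<close>

lemma zhukovsky_weight:
  assumes "0 < x"
  shows "1 < x \<Longrightarrow> \<bar>zhukovsky_deriv x\<bar> * cheb_grow n (zhukovsky x) = x ^ n / (2 * sqrt x)"
    and "x < 1 \<Longrightarrow> \<bar>zhukovsky_deriv x\<bar> * cheb_decay n (zhukovsky x) = x ^ n / (2 * sqrt x)"
proof -
  obtain u where x: "x = exp (2 * u)" using assms by (rule exp_double_cases)
  have w: "x ^ n / (2 * sqrt x) = exp (- (2 * u)) * exp (real (Suc (2 * n)) * u) / 2"
    unfolding x sqrt_exp_double
    by (simp add: exp_of_nat_mult[symmetric] exp_minus field_simps flip: exp_add)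
  show "\<bar>zhukovsky_deriv x\<bar> * cheb_grow n (zhukovsky x) = x ^ n / (2 * sqrt x)" if "1 < x"
  proof -
    have "0 < u" using that x by simp
    then show ?thesis
      unfolding w unfolding x zhukovsky_exp zhukovsky_deriv_exp cheb_grow_cosh[OF \<open>0 < u\<close>]
      by (simp add: abs_mult)
  qed
  show "\<bar>zhukovsky_deriv x\<bar> * cheb_decay n (zhukovsky x) = x ^ n / (2 * sqrt x)" if "x < 1"
  proof -
    have u: "0 < - u" using that x by simp
    have "cheb_decay n (cosh u) = exp (real (Suc (2 * n)) * u) / - sinh u"
      using cheb_decay_cosh[OF u, of n] by simp
    then show ?thesis
      unfolding w unfolding x zhukovsky_exp zhukovsky_deriv_exp
      using u by (simp add: abs_mult)
  qed
qed

lemma nn_integral_cheb_substitution: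
  fixes f :: "real \<Rightarrow> real"
  assumes [measurable]: "f \<in> borel_measurable borel" and nonneg: "\<And>t. 0 \<le> f t"
  shows "(\<integral>\<^sup>+t. ennreal (cheb_grow n t * f t) \<partial>lborel) = (\<integral>\<^sup>+x\<in>{1<..}. ennreal (x ^ n / (2 * sqrt x)) * ennreal (f (zhukovsky x)) \<partial>lborel)"
    and "(\<integral>\<^sup>+t. ennreal (cheb_decay n t * f t) \<partial>lborel) = (\<integral>\<^sup>+x\<in>{0<..<1}. ennreal (x ^ n / (2 * sqrt x)) * ennreal (f (zhukovsky x)) \<partial>lborel)"
proof -
  have "(\<integral>\<^sup>+t. ennreal (cheb_grow n t * f t) \<partial>lborel) = (\<integral>\<^sup>+t\<in>zhukovsky ` {1<..}. ennreal (cheb_grow n t * f t) \<partial>lborel)"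
    unfolding zhukovsky_image by (intro nn_integral_cong) (auto simp: cheb_grow_def split: split_indicator)
  also have "\<dots> = (\<integral>\<^sup>+x\<in>{1<..}. ennreal (\<bar>zhukovsky_deriv x\<bar> * (cheb_grow n (zhukovsky x) * f (zhukovsky x))) \<partial>lborel)"
    by (rule nn_integral_change_of_variables)
      (auto simp: zhukovsky_image nonneg cheb_grow_nonneg intro!: zhukovsky_inj has_real_derivative_zhukovsky)
  also have "\<dots> = (\<integral>\<^sup>+x\<in>{1<..}. ennreal (x ^ n / (2 * sqrt x)) * ennreal (f (zhukovsky x)) \<partial>lborel)"
    by (intro nn_integral_cong)
      (auto simp: zhukovsky_weight mult.assoc[symmetric] ennreal_mult'' nonneg split: split_indicator)
  finally show "(\<integral>\<^sup>+t. ennreal (cheb_grow n t * f t) \<partial>lborel) = (\<integral>\<^sup>+x\<in>{1<..}. ennreal (x ^ n / (2 * sqrt x)) * ennreal (f (zhukovsky x)) \<partial>lborel)" .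
  have "(\<integral>\<^sup>+t. ennreal (cheb_decay n t * f t) \<partial>lborel) = (\<integral>\<^sup>+t\<in>zhukovsky ` {0<..<1}. ennreal (cheb_decay n t * f t) \<partial>lborel)"
    unfolding zhukovsky_image by (intro nn_integral_cong) (auto simp: cheb_decay_def split: split_indicator)
  also have "\<dots> = (\<integral>\<^sup>+x\<in>{0<..<1}. ennreal (\<bar>zhukovsky_deriv x\<bar> * (cheb_decay n (zhukovsky x) * f (zhukovsky x))) \<partial>lborel)"
    by (rule nn_integral_change_of_variables)
      (auto simp: zhukovsky_image nonneg cheb_grow_nonneg intro!: zhukovsky_inj has_real_derivative_zhukovsky)
  also have "\<dots> = (\<integral>\<^sup>+x\<in>{0<..<1}. ennreal (x ^ n / (2 * sqrt x)) * ennreal (f (zhukovsky x)) \<partial>lborel)"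
    by (intro nn_integral_cong)
      (auto simp: zhukovsky_weight mult.assoc[symmetric] ennreal_mult'' nonneg split: split_indicator)
  finally show "(\<integral>\<^sup>+t. ennreal (cheb_decay n t * f t) \<partial>lborel) = (\<integral>\<^sup>+x\<in>{0<..<1}. ennreal (x ^ n / (2 * sqrt x)) * ennreal (f (zhukovsky x)) \<partial>lborel)" .
qed

text \<open>Convolution with the arcsine weight, once the integration over c is moved inside.
  Applied to the restricted \<open>conv_arc\<close> and to \<open>conv_cosh\<close> it gives h and g
  of the overview.\<close>

definition arc_smooth :: "(real \<Rightarrow> ennreal) \<Rightarrow> real \<Rightarrow> ennreal" where
  "arc_smooth w t = (\<integral>\<^sup>+c. w c * ennreal (arcw (t - c)) \<partial>lborel)"

lemma arc_smooth_measurable [measurable]: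
  assumes [measurable]: "w \<in> borel_measurable borel"
  shows "arc_smooth w \<in> borel_measurable borel"
  unfolding arc_smooth_def by measurable

lemma nn_integral_arc_smooth:
  fixes F w :: "real \<Rightarrow> ennreal"
  assumes [measurable]: "F \<in> borel_measurable borel" "w \<in> borel_measurable borel"
  shows "(\<integral>\<^sup>+c. w c * (\<integral>\<^sup>+x. F x * ennreal (arcw (zhukovsky x - c)) \<partial>lborel) \<partial>lborel)
    = (\<integral>\<^sup>+x. F x * arc_smooth w (zhukovsky x) \<partial>lborel)"
proof -
  have "(\<integral>\<^sup>+c. w c * (\<integral>\<^sup>+x. F x * ennreal (arcw (zhukovsky x - c)) \<partial>lborel) \<partial>lborel)
     = (\<integral>\<^sup>+c. (\<integral>\<^sup>+x. w c * (F x * ennreal (arcw (zhukovsky x - c))) \<partial>lborel) \<partial>lborel)"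
    by (simp add: nn_integral_cmult)
  also have "\<dots> = (\<integral>\<^sup>+x. (\<integral>\<^sup>+c. w c * (F x * ennreal (arcw (zhukovsky x - c))) \<partial>lborel) \<partial>lborel)"
    by (rule lborel_pair.Fubini') simp
  also have "\<dots> = (\<integral>\<^sup>+x. F x * arc_smooth w (zhukovsky x) \<partial>lborel)"
    unfolding arc_smooth_def by (simp add: mult.left_commute[of "w _"] nn_integral_cmult)
  finally show ?thesis .
qed

text \<open>Here 1/(2 sqrt x) comes from the substitution and 1/pi^3 from the mass of three cosines.
  The coefficient 2 of the first integral cancels against the half in T = (growing + decaying)/2, so
  h has coefficient 1 while g keeps 6.\<close>

definition apery_weight :: "real \<Rightarrow> ennreal" where
  "apery_weight x = ennreal (1 / (2 * pi ^ 3 * sqrt x)) *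
    (arc_smooth (\<lambda>c. conv_arc c * indicator {0<..} c) (zhukovsky x)
     + 6 * indicator {0<..<1} x * arc_smooth conv_cosh (zhukovsky x))"

lemma apery_weight_measurable [measurable]: "apery_weight \<in> borel_measurable borel"
  unfolding apery_weight_def by measurable

lemma integral_arc_average_nonneg:
  "0 \<le> (\<integral>c. arc_average (\<lambda>t. coshw t * cheb_T (Suc (2 * n)) t) c \<partial>pos_arc_sum)"
proof -
  have nonneg: "0 \<le> coshw t * cheb_T (Suc (2 * n)) t" for t
    using cheb_grow_add_decay[of t n] cheb_grow_nonneg[of n t] by linarith
  show ?thesis
    unfolding arc_average_def
    by (intro integral_nonneg_AE AE_I2 mult_nonneg_nonneg[OF arcw_nonneg] nonneg)
qed

lemma apery_eq_nn_integral:
  "ennreal (real (apery n)) = (\<integral>\<^sup>+x\<in>{0<..}. ennreal (x ^ n) * apery_weight x \<partial>lborel)"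
proof -
  let ?a = "\<lambda>c. conv_arc c * indicator {0<..} c"
  let ?G = "\<integral>c. arc_average (\<lambda>t. coshw t * cheb_T (Suc (2 * n)) t) c \<partial>pos_arc_sum"
  let ?R = "\<integral>c. cosh_average (\<lambda>t. arcw t * cheb_T (Suc (2 * n)) t) c \<partial>cosh_sum"
  let ?K = "\<lambda>c x. ennreal (arcw (zhukovsky x - c))"
  define P where "P x = ennreal (x ^ n / (2 * sqrt x))" for x
  have [measurable]: "P \<in> borel_measurable borel"
    unfolding P_def by measurable
  have grow: "(\<integral>\<^sup>+t. ennreal (cheb_grow n t * arcw (t - c)) \<partial>lborel) = (\<integral>\<^sup>+x. P x * indicator {1<..} x * ?K c x \<partial>lborel)"
    and decay: "(\<integral>\<^sup>+t. ennreal (cheb_decay n t * arcw (t - c)) \<partial>lborel) = (\<integral>\<^sup>+x. P x * indicator {0<..<1} x * ?K c x \<partial>lborel)" for c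
    using nn_integral_cheb_substitution[of "\<lambda>t. arcw (t - c)" n] by (simp_all add: P_def ac_simps)
  have G: "2 * ennreal ?G = (\<integral>\<^sup>+x. P x * indicator {1<..} x * arc_smooth ?a (zhukovsky x) \<partial>lborel)
     + (\<integral>\<^sup>+x. P x * indicator {0<..<1} x * arc_smooth ?a (zhukovsky x) \<partial>lborel)"
    unfolding nn_integral_arc_average grow decay
    by (subst nn_integral_pos_arc_sum, measurable) (simp add: distrib_left nn_integral_add nn_integral_arc_smooth)
  have R: "ennreal ?R = (\<integral>\<^sup>+x. P x * indicator {0<..<1} x * arc_smooth conv_cosh (zhukovsky x) \<partial>lborel)"
    unfolding nn_integral_cosh_average decay
    by (subst nn_integral_cosh_sum, measurable) (simp add: nn_integral_arc_smooth)
  have "0 \<le> ?R"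
    by (rule nn_integral_cosh_average)
  then have total: "ennreal (pi ^ 3 * real (apery n)) = 2 * ennreal ?G + 6 * ennreal ?R"
    unfolding apery_eq_integral_arc_average_plus_cosh_average
    by (simp add: integral_arc_average_nonneg ennreal_mult' del: cheb_T.simps)
  have "ennreal (real (apery n)) = ennreal (1 / pi ^ 3) * ennreal (pi ^ 3 * real (apery n))"
    by (simp flip: ennreal_mult')
  also have "\<dots> = ennreal (1 / pi ^ 3) * (\<integral>\<^sup>+x. P x * indicator {1<..} x * arc_smooth ?a (zhukovsky x)
      + P x * indicator {0<..<1} x * arc_smooth ?a (zhukovsky x)
      + 6 * (P x * indicator {0<..<1} x * arc_smooth conv_cosh (zhukovsky x)) \<partial>lborel)"
    unfolding total G R by (simp add: nn_integral_add nn_integral_cmult)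
  also have "\<dots> = (\<integral>\<^sup>+x. ennreal (1 / pi ^ 3) * (P x * indicator {1<..} x * arc_smooth ?a (zhukovsky x)
      + P x * indicator {0<..<1} x * arc_smooth ?a (zhukovsky x)
      + 6 * (P x * indicator {0<..<1} x * arc_smooth conv_cosh (zhukovsky x))) \<partial>lborel)"
    by (rule nn_integral_cmult[symmetric]) measurable
  also have "\<dots> = (\<integral>\<^sup>+x\<in>{0<..}. ennreal (x ^ n) * apery_weight x \<partial>lborel)"
  proof (rule nn_integral_cong_AE, use AE_lborel_singleton[of "1::real"] in eventually_elim)
    case (elim x)
    show ?case
    proof (cases "0 < x")
      case True
      define Sa Sc where "Sa = arc_smooth ?a (zhukovsky x)" and "Sc = arc_smooth conv_cosh (zhukovsky x)"
      have "P x * indicator {1<..} x * Sa + P x * indicator {0<..<1} x * Sa + 6 * (P x * indicator {0<..<1} x * Sc)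
          = P x * (Sa + 6 * indicator {0<..<1} x * Sc)"
        using elim True by (cases "x < 1") (simp_all add: distrib_left mult.left_commute)
      moreover have "ennreal (1 / pi ^ 3) * P x = ennreal (x ^ n) * ennreal (1 / (2 * pi ^ 3 * sqrt x))"
        using True by (simp add: P_def flip: ennreal_mult')
      ultimately show ?thesis
        using True unfolding apery_weight_def Sa_def Sc_def by (simp add: mult.assoc[symmetric])
    qed simp
  qed
  finally show ?thesis .
qed

section \<open>Positivity and support of the density\<close>

lemma nn_integral_pos:
  fixes f :: "real \<Rightarrow> ennreal"
  assumes [measurable]: "f \<in> borel_measurable borel" and "a < b" and pos: "\<And>x. a < x \<Longrightarrow> x < b \<Longrightarrow> 0 < f x"
  shows "0 < (\<integral>\<^sup>+x. f x \<partial>lborel)"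
proof (rule ccontr)
  assume "\<not> 0 < (\<integral>\<^sup>+x. f x \<partial>lborel)"
  then have "AE x in lborel. f x = 0"
    by (simp add: nn_integral_0_iff_AE)
  then have "AE x in lborel. x \<notin> {a<..<b}"
    by eventually_elim (use pos in force)
  then have "{a<..<b} \<in> null_sets lborel"
    by (subst AE_iff_null_sets) auto
  then show False
    using \<open>a < b\<close> by (auto simp: null_sets_def)
qed

lemma conv_arc_pos: "0 < c \<Longrightarrow> c < 2 \<Longrightarrow> 0 < conv_arc c"
  unfolding conv_arc_def
  by (rule nn_integral_pos[of _ "c - 1" 1]) (auto simp: arcw_pos ennreal_zero_less_mult_iff)

lemma conv_cosh_pos: "2 < c \<Longrightarrow> 0 < conv_cosh c"
  unfolding conv_cosh_def
  by (rule nn_integral_pos[of _ 1 "c - 1"]) (auto simp: coshw_pos ennreal_zero_less_mult_iff)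

text \<open>The end point \<open>t = 1\<close> is included because x = 1 is mapped to it. On the
  interval from t - 1 to 2 all factors of the integrand are positive.\<close>

lemma arc_smooth_conv_arc_pos:
  assumes "1 \<le> t" "t < 3"
  shows "0 < arc_smooth (\<lambda>c. conv_arc c * indicator {0<..} c) t"
  unfolding arc_smooth_def using assms
  by (intro nn_integral_pos[of _ "t - 1" 2]) (auto simp: conv_arc_pos arcw_pos ennreal_zero_less_mult_iff)

lemma arc_smooth_conv_cosh_pos:
  assumes "1 < t"
  shows "0 < arc_smooth conv_cosh t"
  unfolding arc_smooth_def using assms
  by (intro nn_integral_pos[of _ "max 2 (t - 1)" "t + 1"]) (auto simp: conv_cosh_pos arcw_pos ennreal_zero_less_mult_iff)

lemma arc_smooth_conv_arc_zero:
  assumes "3 \<le> t"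
  shows "arc_smooth (\<lambda>c. conv_arc c * indicator {0<..} c) t = 0"
proof -
  have "conv_arc c * indicator {0<..} c * ennreal (arcw (t - c)) = 0" for c
    using assms by (cases "2 \<le> c") (simp_all add: conv_arc_zero arcw_zero)
  then show ?thesis
    unfolding arc_smooth_def by (simp only: nn_integral_const mult_zero_left)
qed

text \<open>Equal to (1 + sqrt 2)^4, the larger solution of \<open>zhukovsky x = 3\<close>; 3 is the
  largest value of a sum of three cosines.\<close>

definition apery_growth :: real where
  "apery_growth = (3 + 2 * sqrt 2)\<^sup>2"

lemma zhukovsky_less_3_iff:
  assumes "1 \<le> x"
  shows "zhukovsky x < 3 \<longleftrightarrow> x < apery_growth"
proof -
  define y where "y = sqrt x"
  have y: "1 \<le> y" "x = y\<^sup>2" using assms by (auto simp: y_def)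
  have "zhukovsky x < 3 \<longleftrightarrow> (y - 3)\<^sup>2 < (2 * sqrt 2)\<^sup>2"
    using y by (simp add: zhukovsky_def power2_eq_square field_simps)
  also have "\<dots> \<longleftrightarrow> \<bar>y - 3\<bar> < 2 * sqrt 2"
    using abs_le_square_iff[of "2 * sqrt 2" "y - 3"] by (simp add: not_le[symmetric])
  \<comment> \<open>The other root 3 - 2 sqrt 2 lies below 1 and so below y.\<close>
  also have "\<dots> \<longleftrightarrow> y < 3 + 2 * sqrt 2"
  proof -
    have "1 < sqrt 2" by simp
    then show ?thesis using y by linarith
  qed
  also have "\<dots> \<longleftrightarrow> x < apery_growth"
  proof -
    have "\<bar>3 + 2 * sqrt 2\<bar> = 3 + 2 * sqrt 2" "\<bar>y\<bar> = y"
      using y by auto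
    then show ?thesis
      unfolding apery_growth_def y using abs_le_square_iff[of "3 + 2 * sqrt 2" y]
      by (simp only: not_le[symmetric])
  qed
  finally show ?thesis .
qed

text \<open>For small x the value \<open>zhukovsky x\<close> exceeds 3 and h vanishes; below x = 1
  positivity rests on g, which is positive for every argument above 1. From x = 1 on it rests on
  h.\<close>

lemma apery_weight_pos:
  assumes "0 < x" "x < apery_growth"
  shows "0 < apery_weight x"
proof -
  have "0 < arc_smooth (\<lambda>c. conv_arc c * indicator {0<..} c) (zhukovsky x)
     + 6 * indicator {0<..<1} x * arc_smooth conv_cosh (zhukovsky x)"
  proof (cases "x < 1")
    case True
    then have "zhukovsky x \<in> {1<..}"
      unfolding zhukovsky_image(2)[symmetric] using assms by (intro imageI) simp
    then show ?thesis
      using True assms arc_smooth_conv_cosh_pos[of "zhukovsky x"]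
      by (simp add: ennreal_zero_less_mult_iff add_nonneg_pos)
  next
    case False
    then have "zhukovsky x < 3"
      using assms zhukovsky_less_3_iff by simp
    moreover have "1 \<le> zhukovsky x"
    proof -
      obtain u where "x = exp (2 * u)" using \<open>0 < x\<close> by (rule exp_double_cases)
      then show ?thesis by (simp add: zhukovsky_exp cosh_real_ge_1)
    qed
    ultimately show ?thesis
      using arc_smooth_conv_arc_pos[of "zhukovsky x"] by (simp add: add_pos_nonneg)
  qed
  then show ?thesis
    using assms by (simp add: apery_weight_def ennreal_zero_less_mult_iff)
qed

lemma apery_weight_zero:
  assumes "apery_growth \<le> x"
  shows "apery_weight x = 0"
proof -
  have "1 \<le> apery_growth"
    unfolding apery_growth_def by (intro one_le_power) simp
  then have "1 \<le> x" "3 \<le> zhukovsky x"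
    using assms zhukovsky_less_3_iff[of x] by auto
  then show ?thesis
    by (simp add: apery_weight_def arc_smooth_conv_arc_zero)
qed

theorem theorem1:
  "\<exists>(c::real) (\<phi>::real \<Rightarrow> real).
     c > 0 \<and>
     (\<forall>x\<in>{0<..<c}. \<phi> x > 0) \<and>
     set_integrable lebesgue {0<..<c} \<phi> \<and>
     (\<forall>n::nat. real (apery n) = (LINT x:{0<..<c}|lebesgue. x ^ n * \<phi> x))"
proof -
  \<comment> \<open>The weight is known to be finite only almost everywhere. Where it is infinite
    \<open>enn2real\<close> would return 0 and spoil positivity, so 1 is taken instead.\<close>
  define \<phi> where "\<phi> x = (if apery_weight x = \<infinity> then 1 else enn2real (apery_weight x))" for x
  have [measurable]: "\<phi> \<in> borel_measurable borel"
    unfolding \<phi>_def by measurable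
  let ?I = "{0<..<apery_growth}"
  have growth: "0 < apery_growth"
    unfolding apery_growth_def by (intro zero_less_power) (simp add: add_pos_pos)
  have pos: "0 < \<phi> x" if "x \<in> ?I" for x
    using apery_weight_pos[of x] that by (auto simp: \<phi>_def enn2real_positive_iff less_top[symmetric])
  have moment: "(\<integral>\<^sup>+x\<in>?I. ennreal (x ^ n) * apery_weight x \<partial>lborel) = ennreal (real (apery n))" for n
    unfolding apery_eq_nn_integral
    by (intro nn_integral_cong) (auto simp: apery_weight_zero not_less split: split_indicator)
  \<comment> \<open>The moment of order 0 is finite, hence so is the weight almost
    everywhere.\<close>
  have "AE x in lborel. apery_weight x * indicator ?I x \<noteq> \<infinity>"
    using moment[of 0] by (intro nn_integral_noteq_infinite) auto
  then have fin: "AE x in lborel. x \<in> ?I \<longrightarrow> ennreal (\<phi> x) = apery_weight x"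
    by eventually_elim (auto simp: \<phi>_def less_top[symmetric] split: split_indicator_asm)
  have bochner: "has_bochner_integral lborel (\<lambda>x. indicator ?I x * (x ^ n * \<phi> x)) (real (apery n))" for n
  proof (rule has_bochner_integral_nn_integral)
    have "(\<integral>\<^sup>+x. ennreal (indicator ?I x * (x ^ n * \<phi> x)) \<partial>lborel) = (\<integral>\<^sup>+x\<in>?I. ennreal (x ^ n) * apery_weight x \<partial>lborel)"
    proof (rule nn_integral_cong_AE, use fin in eventually_elim)
      case (elim x)
      then show ?case
        by (auto simp: ennreal_mult' split: split_indicator)
    qed
    then show "(\<integral>\<^sup>+x. ennreal (indicator ?I x * (x ^ n * \<phi> x)) \<partial>lborel) = ennreal (real (apery n))"
      by (simp add: moment)
    show "AE x in lborel. 0 \<le> indicator ?I x * (x ^ n * \<phi> x)"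
      using pos by (intro AE_I2) (auto simp: less_imp_le split: split_indicator)
  qed auto
  show ?thesis
  proof (intro exI conjI allI ballI)
    show "set_integrable lebesgue ?I \<phi>"
      using bochner[of 0] by (auto simp: set_integrable_def has_bochner_integral_iff intro!: integrable_completion[THEN iffD2])
    fix n
    have "(LINT x:?I|lebesgue. x ^ n * \<phi> x) = (\<integral>x. indicator ?I x * (x ^ n * \<phi> x) \<partial>lborel)"
      unfolding set_lebesgue_integral_def real_scaleR_def by (rule integral_completion) measurable
    then show "real (apery n) = (LINT x:?I|lebesgue. x ^ n * \<phi> x)"
      using bochner[of n] by (simp add: has_bochner_integral_iff)
  qed (use growth pos in auto)
qed

end
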